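(* Let $\mu$ be a finite Borel measure on $\mathbb{D}$ such that the set of analytic bounded point evaluations of $P^2(\mu)$ contains all of $\mathbb{D}$. Suppose $\mathfrak{A}$ is a dual subalgebra of $\mathfrak{M}(P^2(\mu))$. Then $\mathfrak{A}$ has a Nevanlinna-Pick family of kernels, i.e. $\{k^L:L\in\operatorname{CycLat}(\mathfrak{A})\}$ is a Nevanlinna-Pick family of kernels for $\mathfrak{A}$.
   Context: $\mathbb{D}$ is the open unit disk. $P^2(\mu)$ is the closure of the polynomials in $L^2(\mu)$. A bounded point evaluation for $P^2(\mu)$ is a point $\lambda$ for which there is $M>0$ with $|p(\lambda)|\le M\|p\|_{P^2(\mu)}$ for every polynomial $p$; then there is $k_\lambda\in P^2(\mu)$ with $p(\lambda)=\langle p,k_\lambda\rangle$ for polynomials $p$, and for $f\in P^2(\mu)$ one sets $f(\lambda)=\langle f,k_\lambda\rangle$. A point $\lambda$ is an analytic bounded point evaluation if it is in the interior of the set of bounded point evaluations and $z\mapsto f(z)$ is analytic in a neighborhood of $\lambda$ for every $f\in P^2(\mu)$. Under the hypothesis, $H=P^2(\mu)$ is regarded as a reproducing kernel Hilbert space of functions on $X=\mathbb{D}$ with kernels $k_\lambda$. $\mathfrak{M}(H)=\{f:X\to\mathbb{C}: fh\in H\ \forall h\in H\}$, with $f$ identified with the bounded operator $M_fh=fh$. A dual subalgebra $\mathfrak{A}$ of $\mathfrak{M}(H)$ is a subalgebra containing $I$ and closed in the weak-$*$ topology of $\mathcal{B}(H)$. For finite $E\subset X$, $\mathfrak{J}_E=\{f\in\mathfrak{A}:f|_E=0\}$,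 $\mathfrak{J}_\lambda=\mathfrak{J}_{\{\lambda\}}$, and $\operatorname{dist}(f,\mathfrak{J}_E)=\inf_{g\in\mathfrak{J}_E}\|M_f-M_g\|$. $\operatorname{CycLat}(\mathfrak{A})$ is the set of cyclic invariant subspaces $\mathfrak{A}[h]=\overline{\mathfrak{A}h}$, $h\in H$; $\mathfrak{J}_\lambda[h]=\overline{\mathfrak{J}_\lambda h}$. $L\ominus\mathfrak{J}_EL$ is the set of vectors in $L$ orthogonal to all $gx$, $g\in\mathfrak{J}_E$, $x\in L$; $P_N$ is the orthogonal projection onto $N$. For $L=\mathfrak{A}[h]$: $k^L_\lambda=P_Lk_\lambda$ if this is nonzero; if $P_Lk_\lambda=0$ but $\mathfrak{J}_\lambda[h]\ne\mathfrak{A}[h]$, $k^L_\lambda$ is a chosen unit vector in the one-dimensional space $\mathfrak{A}[h]\ominus\mathfrak{J}_\lambda[h]$; otherwise $k^L_\lambda=0$. The collection $\{k^L:L\in\operatorname{CycLat}(\mathfrak{A})\}$ is a Nevanlinna-Pick family of kernels for $\mathfrak{A}$ if for every finite $E\subset X$ and every $f\in\mathfrak{A}$, $\operatorname{dist}(f,\mathfrak{J}_E)=\sup_{L\in\operatorname{CycLat}(\mathfrak{A})}\|P_{N_L}M_f^*|_{N_L}\|$, where $N_L=L\ominus\mathfrak{J}_EL$. *)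

theory Defs
  imports "HOL-Analysis.Analysis" "HOL-Computational_Algebra.Polynomial"
begin

section \<open>The space $P^2(\mu)$\<close>

text \<open>Elements of $L^2(\mu)$ are handled through representatives: two functions that agree
  $\mu$-almost everywhere describe the same element.\<close>

definition L2 :: "complex measure \<Rightarrow> (complex \<Rightarrow> complex) set" where
  "L2 \<mu> = {f \<in> borel_measurable \<mu>. integrable \<mu> (\<lambda>z. (cmod (f z))\<^sup>2)}"

definition L2_inner :: "complex measure \<Rightarrow> (complex \<Rightarrow> complex) \<Rightarrow> (complex \<Rightarrow> complex) \<Rightarrow> complex" where
  "L2_inner \<mu> f g = (LINT z|\<mu>. f z * cnj (g z))"

definition L2_norm :: "complex measure \<Rightarrow> (complex \<Rightarrow> complex) \<Rightarrow> real" where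
  "L2_norm \<mu> f = sqrt (LINT z|\<mu>. (cmod (f z))\<^sup>2)"

definition P2 :: "complex measure \<Rightarrow> (complex \<Rightarrow> complex) set" where
  "P2 \<mu> = {f \<in> L2 \<mu>. \<forall>\<epsilon>>0. \<exists>p :: complex poly. L2_norm \<mu> (\<lambda>z. f z - poly p z) < \<epsilon>}"

definition bounded_point_evaluations :: "complex measure \<Rightarrow> complex set" where
  "bounded_point_evaluations \<mu> =
     {w. \<exists>M>0. \<forall>p :: complex poly. cmod (poly p w) \<le> M * L2_norm \<mu> (poly p)}"

text \<open>The kernel is only determined up to a $\mu$-null set, which \<open>P2_eval\<close> does not see.\<close>

definition P2_kernel :: "complex measure \<Rightarrow> complex \<Rightarrow> complex \<Rightarrow> complex" where
  "P2_kernel \<mu> w =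
     (SOME k. k \<in> P2 \<mu> \<and> (\<forall>p :: complex poly. poly p w = L2_inner \<mu> (poly p) k))"

definition P2_eval :: "complex measure \<Rightarrow> (complex \<Rightarrow> complex) \<Rightarrow> complex \<Rightarrow> complex" where
  "P2_eval \<mu> f w = L2_inner \<mu> f (P2_kernel \<mu> w)"

definition analytic_bounded_point_evaluations :: "complex measure \<Rightarrow> complex set" where
  "analytic_bounded_point_evaluations \<mu> =
     {w \<in> interior (bounded_point_evaluations \<mu>). \<forall>f \<in> P2 \<mu>. P2_eval \<mu> f analytic_on {w}}"

section \<open>Hilbert spaces of functions and their multipliers\<close>

text \<open>A Hilbert space of functions on a set \<open>points H\<close>. A function on \<open>points H\<close> is
  represented by its extension by \<open>0\<close>, so that equality of functions is equality on
  \<open>points H\<close> and the vector space operations are the pointwise ones. The inner product is linear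
  in its first argument.\<close>

record 'x function_space =
  points :: "'x set"
  vectors :: "('x \<Rightarrow> complex) set"
  inner_prod :: "('x \<Rightarrow> complex) \<Rightarrow> ('x \<Rightarrow> complex) \<Rightarrow> complex"

definition functions_on :: "'x set \<Rightarrow> ('x \<Rightarrow> complex) set" where
  "functions_on X = {f. \<forall>x. x \<notin> X \<longrightarrow> f x = 0}"

definition hnorm :: "'x function_space \<Rightarrow> ('x \<Rightarrow> complex) \<Rightarrow> real" where
  "hnorm H h = sqrt (Re (inner_prod H h h))"

definition reproducing_kernel :: "'x function_space \<Rightarrow> 'x \<Rightarrow> 'x \<Rightarrow> complex" where
  "reproducing_kernel H x = (THE k. k \<in> vectors H \<and> (\<forall>h\<in>vectors H. h x = inner_prod H h k))"

definition hclosure :: "'x function_space \<Rightarrow> ('x \<Rightarrow> complex) set \<Rightarrow> ('x \<Rightarrow> complex) set" where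
  "hclosure H S = {h \<in> vectors H. \<forall>\<epsilon>>0. \<exists>s\<in>S. hnorm H (\<lambda>x. h x - s x) < \<epsilon>}"

definition proj :: "'x function_space \<Rightarrow> ('x \<Rightarrow> complex) set \<Rightarrow> ('x \<Rightarrow> complex) \<Rightarrow> 'x \<Rightarrow> complex" where
  "proj H N v = (THE w. w \<in> N \<and> (\<forall>u\<in>N. inner_prod H (\<lambda>x. v x - w x) u = 0))"

text \<open>Operators are \<open>undefined\<close> off \<open>vectors H\<close>, so that operators agreeing on
  \<open>vectors H\<close> are equal.\<close>

definition bounded_operators ::
    "'x function_space \<Rightarrow> (('x \<Rightarrow> complex) \<Rightarrow> 'x \<Rightarrow> complex) set" where
  "bounded_operators H = {T \<in> vectors H \<rightarrow>\<^sub>E vectors H.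
     (\<forall>g\<in>vectors H. \<forall>h\<in>vectors H. T (\<lambda>x. g x + h x) = (\<lambda>x. T g x + T h x)) \<and>
     (\<forall>c. \<forall>h\<in>vectors H. T (\<lambda>x. c * h x) = (\<lambda>x. c * T h x)) \<and>
     (\<exists>C. \<forall>h\<in>vectors H. hnorm H (T h) \<le> C * hnorm H h)}"

definition op_norm :: "'x function_space \<Rightarrow> ('x \<Rightarrow> complex) set \<Rightarrow>
    (('x \<Rightarrow> complex) \<Rightarrow> 'x \<Rightarrow> complex) \<Rightarrow> real" where
  "op_norm H V T = (SUP v\<in>{v \<in> V. hnorm H v \<le> 1}. hnorm H (T v))"

definition hadjoint :: "'x function_space \<Rightarrow> (('x \<Rightarrow> complex) \<Rightarrow> 'x \<Rightarrow> complex) \<Rightarrow>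
    ('x \<Rightarrow> complex) \<Rightarrow> 'x \<Rightarrow> complex" where
  "hadjoint H T = (\<lambda>h\<in>vectors H.
     (THE w. w \<in> vectors H \<and> (\<forall>u\<in>vectors H. inner_prod H (T u) h = inner_prod H u w)))"

text \<open>The weak-* topology of $\mathcal B(H)$ is the one induced by its predual, the trace class.
  The trace class operators are the sums $C = \sum_n x_n \otimes y_n$ with
  $\sum_n \|x_n\|^2 < \infty$ and $\sum_n \|y_n\|^2 < \infty$, and
  $\mathrm{tr}(TC) = \sum_n \langle T x_n, y_n\rangle$. The choice \<open>U = UNIV\<close> below makes
  \<open>bounded_operators H\<close> the underlying space.\<close>

definition weak_star_topology ::
    "'x function_space \<Rightarrow> (('x \<Rightarrow> complex) \<Rightarrow> 'x \<Rightarrow> complex) topology" where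
  "weak_star_topology H = topology_generated_by
     {{T \<in> bounded_operators H. (\<Sum>n. inner_prod H (T (x n)) (y n)) \<in> U} | x y U.
        range x \<subseteq> vectors H \<and> range y \<subseteq> vectors H \<and>
        summable (\<lambda>n::nat. (hnorm H (x n))\<^sup>2) \<and> summable (\<lambda>n. (hnorm H (y n))\<^sup>2) \<and> open U}"

definition mult_op :: "'x function_space \<Rightarrow> ('x \<Rightarrow> complex) \<Rightarrow> ('x \<Rightarrow> complex) \<Rightarrow> 'x \<Rightarrow> complex" where
  "mult_op H f = (\<lambda>h\<in>vectors H. (\<lambda>x. f x * h x))"

definition multipliers :: "'x function_space \<Rightarrow> ('x \<Rightarrow> complex) set" where
  "multipliers H =
     {f \<in> functions_on (points H). \<forall>h\<in>vectors H. (\<lambda>x. f x * h x) \<in> vectors H}"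

definition dual_subalgebra :: "'x function_space \<Rightarrow> ('x \<Rightarrow> complex) set \<Rightarrow> bool" where
  "dual_subalgebra H A \<longleftrightarrow>
     A \<subseteq> multipliers H \<and>
     (\<lambda>x. if x \<in> points H then 1 else 0) \<in> A \<and>
     (\<forall>f\<in>A. \<forall>g\<in>A. (\<lambda>x. f x + g x) \<in> A) \<and>
     (\<forall>c. \<forall>f\<in>A. (\<lambda>x. c * f x) \<in> A) \<and>
     (\<forall>f\<in>A. \<forall>g\<in>A. (\<lambda>x. f x * g x) \<in> A) \<and>
     closedin (weak_star_topology H) (mult_op H ` A)"

section \<open>Nevanlinna-Pick families\<close>

definition vanishing_ideal :: "('x \<Rightarrow> complex) set \<Rightarrow> 'x set \<Rightarrow> ('x \<Rightarrow> complex) set" where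
  "vanishing_ideal A E = {f \<in> A. \<forall>x\<in>E. f x = 0}"

definition ideal_dist :: "'x function_space \<Rightarrow> ('x \<Rightarrow> complex) set \<Rightarrow> 'x set \<Rightarrow>
    ('x \<Rightarrow> complex) \<Rightarrow> real" where
  "ideal_dist H A E f =
     (INF g\<in>vanishing_ideal A E. op_norm H (vectors H) (\<lambda>h x. mult_op H f h x - mult_op H g h x))"

text \<open>$\mathfrak S[h]$, used for $\mathfrak S = \mathfrak A$ and $\mathfrak S = \mathfrak J_\lambda$.\<close>

definition cyclic_space :: "'x function_space \<Rightarrow> ('x \<Rightarrow> complex) set \<Rightarrow> ('x \<Rightarrow> complex) \<Rightarrow>
    ('x \<Rightarrow> complex) set" where
  "cyclic_space H S h = hclosure H ((\<lambda>f. mult_op H f h) ` S)"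

definition CycLat :: "'x function_space \<Rightarrow> ('x \<Rightarrow> complex) set \<Rightarrow> ('x \<Rightarrow> complex) set set" where
  "CycLat H A = cyclic_space H A ` vectors H"

definition ominus :: "'x function_space \<Rightarrow> ('x \<Rightarrow> complex) set \<Rightarrow> ('x \<Rightarrow> complex) set \<Rightarrow>
    ('x \<Rightarrow> complex) set" where
  "ominus H L M = {v \<in> L. \<forall>u\<in>M. inner_prod H v u = 0}"

definition defect_space :: "'x function_space \<Rightarrow> ('x \<Rightarrow> complex) set \<Rightarrow> 'x set \<Rightarrow>
    ('x \<Rightarrow> complex) set \<Rightarrow> ('x \<Rightarrow> complex) set" where
  "defect_space H A E L = ominus H L {mult_op H g u | g u. g \<in> vanishing_ideal A E \<and> u \<in> L}"

text \<open>\<open>cyclic_kernels H A k\<close>: the function \<open>k\<close> assigns to each $L \in \mathrm{CycLat}(\mathfrak A)$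
  a kernel function $k^L$, for some choice of the unit vectors. The cyclic vector \<open>h\<close> of
  $L = \mathfrak A[h]$ ranges over all possibilities; whether
  $\mathfrak J_\lambda[h] \neq \mathfrak A[h]$, and the space
  $\mathfrak A[h] \ominus \mathfrak J_\lambda[h]$, depend on $L$ alone.\<close>

definition cyclic_kernels :: "'x function_space \<Rightarrow> ('x \<Rightarrow> complex) set \<Rightarrow>
    (('x \<Rightarrow> complex) set \<Rightarrow> 'x \<Rightarrow> 'x \<Rightarrow> complex) \<Rightarrow> bool" where
  "cyclic_kernels H A k \<longleftrightarrow> (\<forall>h\<in>vectors H. \<forall>w\<in>points H.
     let L = cyclic_space H A h;
         J = cyclic_space H (vanishing_ideal A {w}) h;
         q = proj H L (reproducing_kernel H w)
     in if q \<noteq> (\<lambda>_. 0) then k L w = q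
        else if J \<noteq> L then k L w \<in> ominus H L J \<and> hnorm H (k L w) = 1
        else k L w = (\<lambda>_. 0))"

definition nevanlinna_pick_family :: "'x function_space \<Rightarrow> ('x \<Rightarrow> complex) set \<Rightarrow>
    (('x \<Rightarrow> complex) set \<Rightarrow> 'x \<Rightarrow> 'x \<Rightarrow> complex) \<Rightarrow> bool" where
  "nevanlinna_pick_family H A k \<longleftrightarrow> cyclic_kernels H A k \<and>
     (\<forall>E f. finite E \<longrightarrow> E \<subseteq> points H \<longrightarrow> f \<in> A \<longrightarrow>
        ideal_dist H A E f =
        (SUP L\<in>CycLat H A.
           let N = defect_space H A E L
           in op_norm H N (\<lambda>v. proj H N (hadjoint H (mult_op H f) v))))"

section \<open>$P^2(\mu)$ as a space of functions on the disk\<close>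

text \<open>If every point of the disk is a bounded point evaluation, then \<open>P2_eval \<mu> f\<close> is itself a
  representative of \<open>f \<in> P2 \<mu>\<close>: polynomials converging to \<open>f\<close> in $L^2(\mu)$ converge pointwise to
  \<open>P2_eval \<mu> f\<close> on the disk, and a subsequence converges to \<open>f\<close> almost everywhere. So
  $f \mapsto$ \<open>P2_eval \<mu> f\<close> is injective on $P^2(\mu)$, and the inner product of $L^2(\mu)$ may be
  evaluated on these functions.\<close>

definition P2_space :: "complex measure \<Rightarrow> complex function_space" where
  "P2_space \<mu> = \<lparr> points = ball 0 1,
     vectors = (\<lambda>f z. if z \<in> ball 0 1 then P2_eval \<mu> f z else 0) ` P2 \<mu>,
     inner_prod = L2_inner \<mu> \<rparr>"

end

theory Submission
  imports Defs "HOL-Complex_Analysis.Complex_Analysis"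
begin

text \<open>Write $J_E$ for the ideal of all $f$ in the algebra $A$ that vanish on the finite set $E$. That the
supremum over the cyclic subspaces is at most $\mathrm{dist}(f, J_E)$ is elementary: $M_g^*$
compresses to \<open>0\<close> on $N_L = L \ominus J_E L$ for $g \in J_E$, so $f$ may be replaced by $f - g$.

For the other inequality, $A / J_E$ is finite dimensional, and the Hahn-Banach theorem gives a
functional $\varphi(h) = \sum_{w \in E} c_w h(w)$ of norm at most \<open>1\<close> on $A$ with
$|\varphi(f)| \ge \mathrm{dist}(f, J_E)$. Suppose that $\varphi(h) = \langle h x, y \rangle$ for all
$h \in A$, with $\|x\|, \|y\| \le 1 + \epsilon$. Put $L = A[x]$ and project $y$ to $L$; since $\varphi$
vanishes on $J_E$, the projection lies in $N_L$, and $|\varphi(f)|$ is at most $(1 + \epsilon)^2$ times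
the norm of the compression of $M_f^*$ to $N_L$. This is \<open>functional_le_compression\<close>. So the theorem
follows from the factorization of $\varphi$ (the theorem \<open>factorization\<close>, which is property
$A_1(1)$ for such functionals), and this is where the space $P^2(\mu)$ enters.

A function in $A$ acts on $P^2(\mu) \subseteq L^2(\mu)$ by multiplication, so that its operator norm is at
most its supremum norm over the disk. The functions in $A$ bounded by \<open>1\<close> on the disk form a set that
is compact for pointwise convergence, by Montel's theorem and because $A$ is weak-* closed; and if
$f_n \to f$ pointwise in this set then $f_n h \to f h$ in $L^2(\mu)$ for every $h$, by dominated
convergence, because $\mu$ is carried by the open disk.

Fix a point $w$ near which the point evaluations are uniformly bounded; such points are dense, by
Baire's theorem. Let $H_n$ be the space of all functions in $P^2(\mu)$ that vanish at $w$ to order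
$n$, and let $v_n$ be a unit vector in $H_n \ominus H_{n+1}$. Multiplication by $f - f(w)$ maps $H_n$ into
$H_{n+1}$, so $\langle f v_n, v_n \rangle = f(w)$ for every $f \in A$. The sequence $v_n$ is
orthonormal, hence weakly null, and by compactness $\langle f h, v_n \rangle$ and
$\langle f v_n, h \rangle$ tend to \<open>0\<close> uniformly over the $f$ bounded by \<open>1\<close>. So the passage from
$(x, y)$ to $(x + a v_n, y + b v_n)$ adds $a \overline{b} f(w)$ to $\langle f x, y \rangle$, up to an error
that is small uniformly in $f$, and adds about $|a|^2$ and $|b|^2$ to the squares of the norms. This is
\<open>null_vector\<close>.

Finally, a functional on $A$ of norm at most $\delta$ that is continuous for bounded pointwise
convergence is a norm limit of combinations $\sum_j d_j f(w_j)$ of evaluations at such points with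
$\sum_j |d_j| \le \delta$: by compactness finitely many points nearly suffice to compute its norm, and a
second use of the Hahn-Banach theorem gives the $d_j$ (\<open>normal_functional_approximation\<close>). Hence
every such functional is nearly of the form $\langle f x, y \rangle$ with $\|x\|^2, \|y\|^2$ about
$\delta$. Applied to the remaining error, again and again, this produces $x$ and $y$ as sums of rapidly
convergent series.\<close>

section \<open>Spaces of functions with a semi-inner product\<close>

text \<open>A nonzero vector may have norm \<open>0\<close> here. This admits the spaces of representatives of elements of
$L^2(\mu)$ next to the function spaces proper.\<close>

locale semi_inner_space =
  fixes H :: "'x function_space"
  assumes zero_mem: "(\<lambda>_. 0) \<in> vectors H"
    and add_mem: "\<lbrakk>a \<in> vectors H; b \<in> vectors H\<rbrakk> \<Longrightarrow> (\<lambda>x. a x + b x) \<in> vectors H"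
    and scale_mem: "a \<in> vectors H \<Longrightarrow> (\<lambda>x. c * a x) \<in> vectors H"
    and ip_add_left: "\<lbrakk>a \<in> vectors H; b \<in> vectors H; u \<in> vectors H\<rbrakk> \<Longrightarrow>
      inner_prod H (\<lambda>x. a x + b x) u = inner_prod H a u + inner_prod H b u"
    and ip_scale_left: "\<lbrakk>a \<in> vectors H; u \<in> vectors H\<rbrakk> \<Longrightarrow>
      inner_prod H (\<lambda>x. c * a x) u = c * inner_prod H a u"
    and ip_cnj: "\<lbrakk>a \<in> vectors H; u \<in> vectors H\<rbrakk> \<Longrightarrow> cnj (inner_prod H a u) = inner_prod H u a"
    and ip_self_nonneg: "a \<in> vectors H \<Longrightarrow> 0 \<le> Re (inner_prod H a a)"
begin

lemma uminus_mem: "a \<in> vectors H \<Longrightarrow> (\<lambda>x. - a x) \<in> vectors H"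
  using scale_mem[of a "-1"] by simp

lemma diff_mem: "\<lbrakk>a \<in> vectors H; b \<in> vectors H\<rbrakk> \<Longrightarrow> (\<lambda>x. a x - b x) \<in> vectors H"
  using add_mem[OF _ uminus_mem, of a b] by simp

lemma ip_diff_left: "\<lbrakk>a \<in> vectors H; b \<in> vectors H; u \<in> vectors H\<rbrakk> \<Longrightarrow>
    inner_prod H (\<lambda>x. a x - b x) u = inner_prod H a u - inner_prod H b u"
proof -
  assume *: "a \<in> vectors H" "b \<in> vectors H" "u \<in> vectors H"
  have "inner_prod H (\<lambda>x. - b x) u = - inner_prod H b u"
    using ip_scale_left[OF *(2,3), of "-1"] by simp
  then show ?thesis
    using ip_add_left[OF *(1) uminus_mem[OF *(2)] *(3)] by simp
qed

lemma ip_zero_left: "u \<in> vectors H \<Longrightarrow> inner_prod H (\<lambda>x. 0) u = 0"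
  using ip_scale_left[OF zero_mem, of u 0] by (simp only: mult_zero_left)

lemma ip_add_right: "\<lbrakk>a \<in> vectors H; b \<in> vectors H; u \<in> vectors H\<rbrakk> \<Longrightarrow>
    inner_prod H u (\<lambda>x. a x + b x) = inner_prod H u a + inner_prod H u b"
proof -
  assume *: "a \<in> vectors H" "b \<in> vectors H" "u \<in> vectors H"
  show ?thesis
    unfolding ip_cnj[OF add_mem[OF *(1,2)] *(3), symmetric] ip_add_left[OF *]
    by (simp add: ip_cnj *)
qed

lemma ip_diff_right: "\<lbrakk>a \<in> vectors H; b \<in> vectors H; u \<in> vectors H\<rbrakk> \<Longrightarrow>
    inner_prod H u (\<lambda>x. a x - b x) = inner_prod H u a - inner_prod H u b"
proof -
  assume *: "a \<in> vectors H" "b \<in> vectors H" "u \<in> vectors H"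
  show ?thesis
    unfolding ip_cnj[OF diff_mem[OF *(1,2)] *(3), symmetric] ip_diff_left[OF *]
    by (simp add: ip_cnj *)
qed

lemma ip_scale_right: "\<lbrakk>a \<in> vectors H; u \<in> vectors H\<rbrakk> \<Longrightarrow>
    inner_prod H u (\<lambda>x. c * a x) = cnj c * inner_prod H u a"
proof -
  assume *: "a \<in> vectors H" "u \<in> vectors H"
  show ?thesis
    unfolding ip_cnj[OF scale_mem[OF *(1)] *(2), symmetric] ip_scale_left[OF *]
    by (simp add: ip_cnj *)
qed

lemma ip_zero_right: "u \<in> vectors H \<Longrightarrow> inner_prod H u (\<lambda>x. 0) = 0"
  using ip_scale_right[OF zero_mem, of u 0] by (simp only: mult_zero_left complex_cnj_zero)

lemmas ip_simps = ip_add_left ip_add_right ip_diff_left ip_diff_right ip_scale_left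
  ip_scale_right ip_zero_left ip_zero_right add_mem diff_mem scale_mem zero_mem

lemma hnorm_nonneg: "a \<in> vectors H \<Longrightarrow> 0 \<le> hnorm H a"
  by (simp add: hnorm_def ip_self_nonneg)

lemma hnorm_sq: "a \<in> vectors H \<Longrightarrow> (hnorm H a)\<^sup>2 = Re (inner_prod H a a)"
  by (simp add: hnorm_def ip_self_nonneg)

lemma ip_self: "a \<in> vectors H \<Longrightarrow> inner_prod H a a = of_real ((hnorm H a)\<^sup>2)"
  using ip_cnj[of a a] by (simp add: hnorm_sq complex_eq_iff)

lemma hnorm_zero: "hnorm H (\<lambda>x. 0) = 0"
  by (simp add: hnorm_def ip_zero_left zero_mem)

lemma hnorm_scale: "a \<in> vectors H \<Longrightarrow> hnorm H (\<lambda>x. c * a x) = cmod c * hnorm H a"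
proof -
  assume a: "a \<in> vectors H"
  have "(hnorm H (\<lambda>x. c * a x))\<^sup>2 = Re (c * cnj c * inner_prod H a a)"
    using a by (simp add: hnorm_sq ip_simps mult.assoc)
  also have "\<dots> = (cmod c * hnorm H a)\<^sup>2"
    using a by (simp add: ip_self complex_norm_square[symmetric] power_mult_distrib)
  finally show ?thesis
    using a hnorm_nonneg scale_mem by (simp add: power2_eq_iff_nonneg)
qed

lemma hnorm_diff_sq:
  "\<lbrakk>a \<in> vectors H; b \<in> vectors H\<rbrakk> \<Longrightarrow>
    (hnorm H (\<lambda>x. a x - b x))\<^sup>2 = (hnorm H a)\<^sup>2 - 2 * Re (inner_prod H a b) + (hnorm H b)\<^sup>2"
  using arg_cong[OF ip_cnj[of a b], of Re] by (simp add: hnorm_sq ip_simps)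

lemma hnorm_add_sq:
  "\<lbrakk>a \<in> vectors H; b \<in> vectors H\<rbrakk> \<Longrightarrow>
    (hnorm H (\<lambda>x. a x + b x))\<^sup>2 = (hnorm H a)\<^sup>2 + 2 * Re (inner_prod H a b) + (hnorm H b)\<^sup>2"
  using arg_cong[OF ip_cnj[of a b], of Re] by (simp add: hnorm_sq ip_simps)

text \<open>The computation behind both the Cauchy-Schwarz inequality and the orthogonality of nearest points:
one moves from $a$ in the direction of the component of $a$ along $b$.\<close>

lemma hnorm_diff_scaled_sq:
  fixes t :: real
  assumes "a \<in> vectors H" "b \<in> vectors H"
  shows "(hnorm H (\<lambda>x. a x - of_real t * inner_prod H a b * b x))\<^sup>2 =
    (hnorm H a)\<^sup>2 - 2 * t * (cmod (inner_prod H a b))\<^sup>2 + t\<^sup>2 * (cmod (inner_prod H a b))\<^sup>2 * (hnorm H b)\<^sup>2"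
proof -
  have "Re (cnj c * c) = (cmod c)\<^sup>2" for c
    by (simp add: cmod_def power2_eq_square)
  then show ?thesis
    using assms
    by (simp add: hnorm_diff_sq ip_simps hnorm_scale norm_mult power_mult_distrib mult.assoc)
qed

lemma Cauchy_Schwarz:
  assumes "a \<in> vectors H" "b \<in> vectors H"
  shows "cmod (inner_prod H a b) \<le> hnorm H a * hnorm H b"
proof -
  define c where "c = (cmod (inner_prod H a b))\<^sup>2"
  have key: "0 \<le> (hnorm H a)\<^sup>2 - 2 * t * c + t\<^sup>2 * c * (hnorm H b)\<^sup>2" for t
    using hnorm_diff_scaled_sq[OF assms, of t] zero_le_power2 unfolding c_def by metis
  have "c \<le> (hnorm H a * hnorm H b)\<^sup>2"
  proof (cases "hnorm H b = 0")
    case True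
    have "c = 0"
    proof (rule ccontr)
      assume "c \<noteq> 0"
      then have "c > 0" by (simp add: c_def)
      then show False
        \<comment> \<open>the expression in \<open>key\<close> is affine in \<open>t\<close> here, so a large \<open>t\<close> makes it negative\<close>
        using key[of "((hnorm H a)\<^sup>2 + 1) / c"] True zero_le_power2[of "hnorm H a"] by simp
    qed
    then show ?thesis by simp
  next
    case False
    then show ?thesis
      using key[of "1 / (hnorm H b)\<^sup>2"]
      by (auto simp: field_simps power2_eq_square zero_le_divide_iff mult_le_0_iff)
  qed
  then show ?thesis
    using assms hnorm_nonneg unfolding c_def
    by (simp add: power2_le_iff_abs_le abs_mult)
qed

lemma hnorm_triangle:
  assumes "a \<in> vectors H" "b \<in> vectors H"
  shows "hnorm H (\<lambda>x. a x + b x) \<le> hnorm H a + hnorm H b"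
proof (rule power2_le_imp_le)
  have "Re (inner_prod H a b) \<le> hnorm H a * hnorm H b"
    using Cauchy_Schwarz[OF assms] complex_Re_le_cmod order_trans by blast
  then show "(hnorm H (\<lambda>x. a x + b x))\<^sup>2 \<le> (hnorm H a + hnorm H b)\<^sup>2"
    using assms by (simp add: hnorm_add_sq power2_sum)
qed (use assms hnorm_nonneg in auto)

lemma hnorm_minus: "a \<in> vectors H \<Longrightarrow> hnorm H (\<lambda>x. - a x) = hnorm H a"
  using hnorm_scale[of a "-1"] by simp

lemma hnorm_commute:
  assumes "a \<in> vectors H" "b \<in> vectors H"
  shows "hnorm H (\<lambda>x. a x - b x) = hnorm H (\<lambda>x. b x - a x)"
  using hnorm_minus[OF diff_mem[OF assms]] by simp

lemma hnorm_triangle_diff: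
  assumes "a \<in> vectors H" "b \<in> vectors H" "u \<in> vectors H"
  shows "hnorm H (\<lambda>x. a x - u x) \<le> hnorm H (\<lambda>x. a x - b x) + hnorm H (\<lambda>x. b x - u x)"
  using hnorm_triangle[OF diff_mem[OF assms(1,2)] diff_mem[OF assms(2,3)]] by simp

lemma hnorm_le_add_diff:
  assumes "a \<in> vectors H" "b \<in> vectors H"
  shows "hnorm H a \<le> hnorm H b + hnorm H (\<lambda>x. a x - b x)"
  using hnorm_triangle[OF assms(2) diff_mem[OF assms]] by simp

lemma tendsto_ip:
  assumes "\<And>n. a n \<in> vectors H" "\<And>n. b n \<in> vectors H" "l \<in> vectors H" "m \<in> vectors H"
    and a: "(\<lambda>n. hnorm H (\<lambda>x. a n x - l x)) \<longlonglongrightarrow> 0"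
    and b: "(\<lambda>n. hnorm H (\<lambda>x. b n x - m x)) \<longlonglongrightarrow> 0"
  shows "(\<lambda>n. inner_prod H (a n) (b n)) \<longlonglongrightarrow> inner_prod H l m"
proof -
  let ?da = "\<lambda>n x. a n x - l x" and ?db = "\<lambda>n x. b n x - m x"
  have eq: "inner_prod H (a n) (b n) - inner_prod H l m =
      inner_prod H (?da n) (?db n) + inner_prod H (?da n) m + inner_prod H l (?db n)" for n
    using assms by (simp add: ip_simps algebra_simps)
  have "cmod (inner_prod H (a n) (b n) - inner_prod H l m) \<le>
      hnorm H (?da n) * hnorm H (?db n) + hnorm H (?da n) * hnorm H m + hnorm H l * hnorm H (?db n)" for n
    unfolding eq using assms diff_mem
    by (intro norm_triangle_le add_mono Cauchy_Schwarz) auto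
  moreover have "(\<lambda>n. hnorm H (?da n) * hnorm H (?db n) + hnorm H (?da n) * hnorm H m
      + hnorm H l * hnorm H (?db n)) \<longlonglongrightarrow> 0"
    by (rule tendsto_eq_intros a b refl | simp)+
  ultimately have "(\<lambda>n. inner_prod H (a n) (b n) - inner_prod H l m) \<longlonglongrightarrow> 0"
    by (rule Lim_null_comparison[OF always_eventually[OF allI]])
  then show ?thesis using LIM_zero_iff by blast
qed

definition closed_subspace :: "('x \<Rightarrow> complex) set \<Rightarrow> bool" where
  "closed_subspace N \<longleftrightarrow> N \<subseteq> vectors H \<and> (\<lambda>_. 0) \<in> N \<and>
     (\<forall>a\<in>N. \<forall>b\<in>N. (\<lambda>x. a x + b x) \<in> N) \<and> (\<forall>c. \<forall>a\<in>N. (\<lambda>x. c * a x) \<in> N) \<and>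
     hclosure H N \<subseteq> N"

lemma hclosure_iff_seq:
  assumes "S \<subseteq> vectors H"
  shows "h \<in> hclosure H S \<longleftrightarrow>
    h \<in> vectors H \<and> (\<exists>s. (\<forall>n. s n \<in> S) \<and> (\<lambda>n. hnorm H (\<lambda>x. s n x - h x)) \<longlonglongrightarrow> 0)"
proof safe
  assume h: "h \<in> hclosure H S"
  then show hv: "h \<in> vectors H" by (simp add: hclosure_def)
  have "\<exists>s\<in>S. hnorm H (\<lambda>x. h x - s x) < inverse (real (Suc n))" for n
    using h by (simp add: hclosure_def)
  then obtain s where s: "\<And>n. s n \<in> S" "\<And>n. hnorm H (\<lambda>x. h x - s n x) < inverse (real (Suc n))"
    by metis
  have le: "hnorm H (\<lambda>x. s n x - h x) \<le> inverse (real (Suc n))" for n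
    using s(2)[of n] hnorm_commute[OF hv subsetD[OF assms s(1)[of n]]] by linarith
  have "(\<lambda>n. hnorm H (\<lambda>x. s n x - h x)) \<longlonglongrightarrow> 0"
  proof (rule tendsto_sandwich[OF _ _ tendsto_const LIMSEQ_inverse_real_of_nat])
    show "\<forall>\<^sub>F n in sequentially. 0 \<le> hnorm H (\<lambda>x. s n x - h x)"
      using s(1) assms hv by (auto intro!: always_eventually hnorm_nonneg diff_mem)
  qed (use le in auto)
  then show "\<exists>s. (\<forall>n. s n \<in> S) \<and> (\<lambda>n. hnorm H (\<lambda>x. s n x - h x)) \<longlonglongrightarrow> 0"
    using s(1) by (intro exI[of _ s] conjI allI)
next
  fix s assume hv: "h \<in> vectors H" and s: "\<forall>n. s n \<in> S"
    and lim: "(\<lambda>n. hnorm H (\<lambda>x. s n x - h x)) \<longlonglongrightarrow> 0"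
  show "h \<in> hclosure H S"
    unfolding hclosure_def
  proof (safe)
    fix e :: real assume "e > 0"
    then have "\<forall>\<^sub>F n in sequentially. hnorm H (\<lambda>x. s n x - h x) < e"
      using order_tendstoD(2)[OF lim] by simp
    then obtain n where n: "hnorm H (\<lambda>x. s n x - h x) < e"
      unfolding eventually_sequentially by (elim exE) auto
    have sn: "s n \<in> S" using s by simp
    show "\<exists>s\<in>S. hnorm H (\<lambda>x. h x - s x) < e"
      using n hnorm_commute[OF hv subsetD[OF assms sn]] by (intro bexI[OF _ sn]) linarith
  next
    show "h \<in> vectors H" by (rule hv)
  qed
qed

end

locale semi_hilbert_space = semi_inner_space +
  assumes complete: "\<lbrakk>\<And>n. s n \<in> vectors H;
      \<And>e. e > 0 \<Longrightarrow> \<exists>N. \<forall>m\<ge>N. \<forall>n\<ge>N. hnorm H (\<lambda>x. s m x - s n x) < e\<rbrakk> \<Longrightarrow>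
    \<exists>l\<in>vectors H. (\<lambda>n. hnorm H (\<lambda>x. s n x - l x)) \<longlonglongrightarrow> 0"
begin

text \<open>A minimizing sequence is Cauchy by the parallelogram law, and its limit $w$ is a nearest point.
Moving $w$ along $u \in N$ does not decrease the distance, which forces $v - w$ to be orthogonal to $u$.\<close>

lemma projection_exists:
  assumes N: "closed_subspace N" and v: "v \<in> vectors H"
  shows "\<exists>w\<in>N. \<forall>u\<in>N. inner_prod H (\<lambda>x. v x - w x) u = 0"
proof -
  have NV: "N \<subseteq> vectors H" and N0: "(\<lambda>_. 0) \<in> N" and Nadd: "\<And>a b. a \<in> N \<Longrightarrow> b \<in> N \<Longrightarrow> (\<lambda>x. a x + b x) \<in> N"
    and Nsc: "\<And>c a. a \<in> N \<Longrightarrow> (\<lambda>x. c * a x) \<in> N" and Ncl: "hclosure H N \<subseteq> N"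
    using N by (auto simp: closed_subspace_def)
  define q where "q u = (hnorm H (\<lambda>x. v x - u x))\<^sup>2" for u
  define d where "d = (INF u\<in>N. q u)"
  have bdd: "bdd_below (q ` N)" by (rule bdd_belowI2[of _ 0]) (simp add: q_def)
  have d_le: "d \<le> q u" if "u \<in> N" for u
    unfolding d_def using bdd that by (rule cINF_lower)
  have "\<exists>u\<in>N. q u < d + inverse (real (Suc n))" for n
    unfolding d_def using bdd N0 by (subst cINF_less_iff[symmetric]) auto
  then obtain s where s: "\<And>n. s n \<in> N" "\<And>n. q (s n) < d + inverse (real (Suc n))"
    by metis
  have sV: "s n \<in> vectors H" for n using s NV by blast
  \<comment> \<open>parallelogram law, with the midpoint of \<open>a\<close> and \<open>b\<close> as a competitor\<close>
  have par: "(hnorm H (\<lambda>x. a x - b x))\<^sup>2 \<le> 2 * (q a - d) + 2 * (q b - d)" if "a \<in> N" "b \<in> N" for a b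
  proof -
    have aV: "a \<in> vectors H" "b \<in> vectors H" using that NV by auto
    let ?A = "\<lambda>x. v x - a x" and ?B = "\<lambda>x. v x - b x"
    have AV: "?A \<in> vectors H" and BV: "?B \<in> vectors H"
      using diff_mem[OF v aV(1)] diff_mem[OF v aV(2)] by auto
    have "(\<lambda>x. (1/2) * (a x + b x)) \<in> N" using that Nadd Nsc by blast
    from d_le[OF this] have "d \<le> (hnorm H (\<lambda>x. (1/2) * (?A x + ?B x)))\<^sup>2"
      by (simp add: q_def field_simps)
    also have "\<dots> = (hnorm H (\<lambda>x. ?A x + ?B x))\<^sup>2 / 4"
      unfolding hnorm_scale[OF add_mem[OF AV BV]] by (simp add: power_mult_distrib power2_eq_square)
    also have "(hnorm H (\<lambda>x. ?A x + ?B x))\<^sup>2 = 2 * q a + 2 * q b - (hnorm H (\<lambda>x. ?A x - ?B x))\<^sup>2"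
      unfolding hnorm_add_sq[OF AV BV] hnorm_diff_sq[OF AV BV] q_def by simp
    also have "(\<lambda>x. ?A x - ?B x) = (\<lambda>x. b x - a x)" by auto
    finally show ?thesis using hnorm_commute[OF aV] by simp
  qed
  have cau: "\<exists>M. \<forall>m\<ge>M. \<forall>n\<ge>M. hnorm H (\<lambda>x. s m x - s n x) < e" if e: "e > 0" for e
  proof -
    obtain M where M: "inverse (real (Suc M)) < e\<^sup>2 / 4"
      using reals_Archimedean[of "e\<^sup>2 / 4"] e by auto
    have "hnorm H (\<lambda>x. s m x - s n x) < e" if mn: "m \<ge> M" "n \<ge> M" for m n
    proof (rule power2_less_imp_less)
      have lt: "q (s k) - d < e\<^sup>2 / 4" if "k \<ge> M" for k
      proof -
        have "inverse (real (Suc k)) \<le> inverse (real (Suc M))" using that by simp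
        then show ?thesis using s(2)[of k] M by linarith
      qed
      show "(hnorm H (\<lambda>x. s m x - s n x))\<^sup>2 < e\<^sup>2"
        using par[OF s(1)[of m] s(1)[of n]] lt[OF mn(1)] lt[OF mn(2)] by argo
    qed (use e in simp)
    then show ?thesis by blast
  qed
  obtain w where wV: "w \<in> vectors H" and lim: "(\<lambda>n. hnorm H (\<lambda>x. s n x - w x)) \<longlonglongrightarrow> 0"
    using complete[OF sV cau] by blast
  have "w \<in> hclosure H N" using hclosure_iff_seq[OF NV] wV lim s(1) by blast
  then have wN: "w \<in> N" using Ncl by blast
  have zV: "(\<lambda>x. v x - w x) \<in> vectors H" using v wV by (rule diff_mem)
  have qw: "q w \<le> d"
  proof -
    have "(\<lambda>n. q (s n)) \<longlonglongrightarrow> q w"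
    proof -
      have "(\<lambda>n. inner_prod H (\<lambda>x. v x - s n x) (\<lambda>x. v x - s n x))
          \<longlonglongrightarrow> inner_prod H (\<lambda>x. v x - w x) (\<lambda>x. v x - w x)"
      proof (rule tendsto_ip)
        show "(\<lambda>n. hnorm H (\<lambda>x. v x - s n x - (v x - w x))) \<longlonglongrightarrow> 0"
          using lim hnorm_commute[OF sV wV] by simp
        then show "(\<lambda>n. hnorm H (\<lambda>x. v x - s n x - (v x - w x))) \<longlonglongrightarrow> 0" .
      qed (use v sV wV diff_mem in auto)
      then show ?thesis
        using v sV wV by (auto simp: q_def hnorm_sq diff_mem intro: tendsto_Re)
    qed
    moreover have "(\<lambda>n. d + inverse (real (Suc n))) \<longlonglongrightarrow> d + 0"
      by (intro tendsto_intros LIMSEQ_inverse_real_of_nat)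
    ultimately show ?thesis
      using s(2) by (intro LIMSEQ_le[of "\<lambda>n. q (s n)" "q w" "\<lambda>n. d + inverse (real (Suc n))"])
        (auto intro: less_imp_le)
  qed
  have "inner_prod H (\<lambda>x. v x - w x) u = 0" if u: "u \<in> N" for u
  proof -
    let ?z = "\<lambda>x. v x - w x"
    define c where "c = (cmod (inner_prod H ?z u))\<^sup>2"
    define B where "B = (hnorm H u)\<^sup>2"
    define t where "t = 1 / (B + 1)"
    have B: "B \<ge> 0" by (simp add: B_def)
    have uV: "u \<in> vectors H" using u NV by blast
    have "(\<lambda>x. w x + of_real t * inner_prod H ?z u * u x) \<in> N"
      using wN u Nadd Nsc by blast
    from d_le[OF this] have "q w \<le> (hnorm H (\<lambda>x. ?z x - of_real t * inner_prod H ?z u * u x))\<^sup>2"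
      using qw by (simp add: q_def algebra_simps)
    also have "\<dots> = q w - 2 * t * c + t\<^sup>2 * c * B"
      using hnorm_diff_scaled_sq[OF zV uV, of t] by (simp add: q_def c_def B_def)
    finally have "0 \<le> t * c * (t * B - 2)" by (simp add: power2_eq_square algebra_simps)
    moreover have "t > 0" "t * B - 2 < 0" using B by (auto simp: t_def field_simps)
    ultimately have "c \<le> 0"
      by (metis linorder_not_le mult_pos_neg mult_pos_pos)
    then show ?thesis by (simp add: c_def)
  qed
  then show ?thesis by (intro bexI[OF _ wN] ballI)
qed

text \<open>The representing vector spans the complement of the kernel. It is unique only up to vectors of norm
\<open>0\<close>.\<close>

lemma Riesz_representation:
  assumes add: "\<And>a b. \<lbrakk>a \<in> vectors H; b \<in> vectors H\<rbrakk> \<Longrightarrow> \<phi> (\<lambda>x. a x + b x) = \<phi> a + \<phi> b"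
    and scale: "\<And>c a. a \<in> vectors H \<Longrightarrow> \<phi> (\<lambda>x. c * a x) = c * \<phi> a"
    and bound: "\<And>a. a \<in> vectors H \<Longrightarrow> cmod (\<phi> a) \<le> C * hnorm H a"
  shows "\<exists>k\<in>vectors H. \<forall>a\<in>vectors H. \<phi> a = inner_prod H a k"
proof (cases "\<forall>a\<in>vectors H. \<phi> a = 0")
  case True
  show ?thesis
  proof (intro bexI ballI)
    show "\<phi> a = inner_prod H a (\<lambda>_. 0)" if "a \<in> vectors H" for a
      using True that ip_zero_right[OF that] by simp
  qed (rule zero_mem)
next
  case False
  then obtain v where v: "v \<in> vectors H" "\<phi> v \<noteq> 0" by blast
  have diff: "\<phi> (\<lambda>x. a x - b x) = \<phi> a - \<phi> b" if "a \<in> vectors H" "b \<in> vectors H" for a b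
    using add[OF that(1) scale_mem[OF that(2), of "-1"]] scale[OF that(2), of "-1"] by simp
  define N where "N = {a \<in> vectors H. \<phi> a = 0}"
  have NV: "N \<subseteq> vectors H" by (auto simp: N_def)
  have "closed_subspace N"
    unfolding closed_subspace_def
  proof (intro conjI subsetI)
    show "(\<lambda>_. 0) \<in> N"
      using scale[OF zero_mem, of 0] by (simp add: N_def zero_mem)
    fix h assume "h \<in> hclosure H N"
    then obtain s where hV: "h \<in> vectors H" and s: "\<And>n. s n \<in> N"
      and lim: "(\<lambda>n. hnorm H (\<lambda>x. s n x - h x)) \<longlonglongrightarrow> 0"
      using hclosure_iff_seq[OF NV] by blast
    have "cmod (\<phi> h) \<le> C * hnorm H (\<lambda>x. s n x - h x)" for n
    proof -
      have "\<phi> (\<lambda>x. s n x - h x) = - \<phi> h" "s n \<in> vectors H"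
        using diff[OF _ hV, of "s n"] s[of n] by (auto simp: N_def)
      then show ?thesis using bound[of "\<lambda>x. s n x - h x"] hV diff_mem by (metis norm_minus_cancel)
    qed
    moreover have "(\<lambda>n. C * hnorm H (\<lambda>x. s n x - h x)) \<longlonglongrightarrow> C * 0"
      by (intro tendsto_intros lim)
    ultimately have "cmod (\<phi> h) \<le> C * 0"
      using LIMSEQ_le_const by blast
    then show "h \<in> N" using hV by (simp add: N_def)
  qed (auto simp: N_def add scale add_mem scale_mem)
  from projection_exists[OF this v(1)] obtain w where w: "w \<in> N"
    and orth: "\<And>u. u \<in> N \<Longrightarrow> inner_prod H (\<lambda>x. v x - w x) u = 0" by blast
  define z where "z = (\<lambda>x. v x - w x)"
  have zV: "z \<in> vectors H" using v w NV diff_mem unfolding z_def by blast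
  have \<phi>z: "\<phi> z = \<phi> v" using diff[of v w] v w by (simp add: N_def z_def)
  have "hnorm H z \<noteq> 0"
    using bound[OF zV] v \<phi>z by auto
  then have nz: "inner_prod H z z \<noteq> 0" using ip_self[OF zV] by simp
  define c where "c = cnj (\<phi> z / inner_prod H z z)"
  define k where "k = (\<lambda>x. c * z x)"
  have "\<phi> a = inner_prod H a k" if a: "a \<in> vectors H" for a
  proof -
    have "(\<lambda>x. \<phi> z * a x - \<phi> a * z x) \<in> N"
      using a zV by (simp add: N_def diff diff_mem scale_mem scale)
    then have "cnj (inner_prod H z (\<lambda>x. \<phi> z * a x - \<phi> a * z x)) = 0"
      using orth unfolding z_def by simp
    then have "\<phi> z * inner_prod H a z = \<phi> a * inner_prod H z z"
      using a zV by (simp add: ip_cnj ip_simps)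
    then show ?thesis
      unfolding k_def ip_scale_right[OF zV a] using nz by (simp add: c_def field_simps)
  qed
  moreover have "k \<in> vectors H" unfolding k_def by (rule scale_mem[OF zV])
  ultimately show ?thesis by (intro bexI ballI)
qed

end

context semi_inner_space
begin

lemma closed_subspaceD:
  assumes "closed_subspace N"
  shows "N \<subseteq> vectors H" "(\<lambda>_. 0) \<in> N" "\<lbrakk>a \<in> N; b \<in> N\<rbrakk> \<Longrightarrow> (\<lambda>x. a x + b x) \<in> N"
    "a \<in> N \<Longrightarrow> (\<lambda>x. c * a x) \<in> N" "hclosure H N \<subseteq> N"
  using assms by (auto simp: closed_subspace_def)

lemma closed_subspace_diff:
  assumes "closed_subspace N" "a \<in> N" "b \<in> N"
  shows "(\<lambda>x. a x - b x) \<in> N"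
  using closed_subspaceD(3)[OF assms(1,2) closed_subspaceD(4)[OF assms(1,3), of "-1"]] by simp

lemma closed_subspace_limit:
  assumes "closed_subspace N" "\<And>n. s n \<in> N" "h \<in> vectors H"
    "(\<lambda>n. hnorm H (\<lambda>x. s n x - h x)) \<longlonglongrightarrow> 0"
  shows "h \<in> N"
proof -
  have "h \<in> hclosure H N"
    unfolding hclosure_iff_seq[OF closed_subspaceD(1)[OF assms(1)]] using assms by auto
  then show ?thesis using closed_subspaceD(5)[OF assms(1)] by auto
qed

lemma tendsto_ip_left:
  assumes "\<And>n. a n \<in> vectors H" "l \<in> vectors H" "m \<in> vectors H"
    and a: "(\<lambda>n. hnorm H (\<lambda>x. a n x - l x)) \<longlonglongrightarrow> 0"
  shows "(\<lambda>n. inner_prod H (a n) m) \<longlonglongrightarrow> inner_prod H l m"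
  by (rule tendsto_ip) (use assms in \<open>simp_all add: hnorm_zero\<close>)

lemma tendsto_ip_right:
  assumes "\<And>n. a n \<in> vectors H" "l \<in> vectors H" "m \<in> vectors H"
    and a: "(\<lambda>n. hnorm H (\<lambda>x. a n x - l x)) \<longlonglongrightarrow> 0"
  shows "(\<lambda>n. inner_prod H m (a n)) \<longlonglongrightarrow> inner_prod H m l"
  by (rule tendsto_ip) (use assms in \<open>simp_all add: hnorm_zero\<close>)

lemma hclosure_subset: "S \<subseteq> vectors H \<Longrightarrow> S \<subseteq> hclosure H S"
proof
  fix h assume "S \<subseteq> vectors H" "h \<in> S"
  then show "h \<in> hclosure H S"
    unfolding hclosure_def by (auto intro!: bexI[of _ h] simp: hnorm_zero)
qed

lemma hclosure_closed_subspace: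
  assumes M: "M \<subseteq> vectors H" "(\<lambda>_. 0) \<in> M"
    and add: "\<And>a b. \<lbrakk>a \<in> M; b \<in> M\<rbrakk> \<Longrightarrow> (\<lambda>x. a x + b x) \<in> M"
    and scale: "\<And>c a. a \<in> M \<Longrightarrow> (\<lambda>x. c * a x) \<in> M"
  shows "closed_subspace (hclosure H M)"
  unfolding closed_subspace_def
proof (intro conjI ballI allI)
  let ?C = "hclosure H M"
  show CV: "?C \<subseteq> vectors H" by (auto simp: hclosure_def)
  show "(\<lambda>_. 0) \<in> ?C" using hclosure_subset[OF M(1)] M(2) by blast
  fix a assume a: "a \<in> ?C"
  then obtain s where aV: "a \<in> vectors H" and s: "\<And>n. s n \<in> M" "(\<lambda>n. hnorm H (\<lambda>x. s n x - a x)) \<longlonglongrightarrow> 0"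
    using hclosure_iff_seq[OF M(1)] by auto
  have sV: "s n \<in> vectors H" for n using s(1) M(1) by auto
  {
    fix c
    have "hnorm H (\<lambda>x. c * s n x - c * a x) = cmod c * hnorm H (\<lambda>x. s n x - a x)" for n
      using hnorm_scale[OF diff_mem[OF sV aV], of c n] by (simp add: algebra_simps)
    then have "(\<lambda>n. hnorm H (\<lambda>x. c * s n x - c * a x)) \<longlonglongrightarrow> 0"
      using tendsto_mult[OF tendsto_const s(2), of "cmod c"] by simp
    then show "(\<lambda>x. c * a x) \<in> ?C"
      unfolding hclosure_iff_seq[OF M(1)] using s(1) scale scale_mem[OF aV]
      by (intro conjI exI[of _ "\<lambda>n x. c * s n x"]) auto
  }
  fix b assume "b \<in> ?C"
  then obtain t where bV: "b \<in> vectors H" and t: "\<And>n. t n \<in> M" "(\<lambda>n. hnorm H (\<lambda>x. t n x - b x)) \<longlonglongrightarrow> 0"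
    using hclosure_iff_seq[OF M(1)] by auto
  have tV: "t n \<in> vectors H" for n using t(1) M(1) by auto
  have le: "hnorm H (\<lambda>x. (s n x + t n x) - (a x + b x)) \<le>
      hnorm H (\<lambda>x. s n x - a x) + hnorm H (\<lambda>x. t n x - b x)" for n
    using hnorm_triangle[OF diff_mem[OF sV aV] diff_mem[OF tV bV], of n n] by (simp add: algebra_simps)
  have nn: "0 \<le> hnorm H (\<lambda>x. (s n x + t n x) - (a x + b x))" for n
    by (intro hnorm_nonneg diff_mem add_mem sV tV aV bV)
  have "(\<lambda>n. hnorm H (\<lambda>x. (s n x + t n x) - (a x + b x))) \<longlonglongrightarrow> 0"
    by (rule tendsto_sandwich[OF always_eventually always_eventually tendsto_const
          tendsto_add_zero[OF s(2) t(2)]]) (use le nn in auto)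
  then show "(\<lambda>x. a x + b x) \<in> ?C"
    unfolding hclosure_iff_seq[OF M(1)] using s(1) t(1) add add_mem[OF aV bV]
    by (intro conjI exI[of _ "\<lambda>n x. s n x + t n x"]) auto
next
  let ?C = "hclosure H M"
  have CV: "?C \<subseteq> vectors H" by (auto simp: hclosure_def)
  show "hclosure H ?C \<subseteq> ?C"
  proof
    fix h assume h: "h \<in> hclosure H ?C"
    then have hV: "h \<in> vectors H" by (simp add: hclosure_def)
    have "\<exists>s\<in>M. hnorm H (\<lambda>x. h x - s x) < e" if "e > 0" for e
    proof -
      obtain b where b: "b \<in> ?C" "hnorm H (\<lambda>x. h x - b x) < e/2"
        using h \<open>e > 0\<close> unfolding hclosure_def[of H ?C] by (auto dest!: spec[of _ "e/2"])
      then obtain s where s: "s \<in> M" "hnorm H (\<lambda>x. b x - s x) < e/2"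
        using \<open>e > 0\<close> unfolding hclosure_def[of H M] by (auto dest!: spec[of _ "e/2"])
      have "hnorm H (\<lambda>x. h x - s x) < e"
        using hnorm_triangle_diff[OF hV, of b s] b s CV M(1) by fastforce
      then show ?thesis using s(1) by blast
    qed
    then show "h \<in> ?C" using hV by (simp add: hclosure_def)
  qed
qed

lemma ominus_closed_subspace:
  assumes L: "closed_subspace L" and M: "M \<subseteq> vectors H"
  shows "closed_subspace (ominus H L M)"
proof -
  have LV: "L \<subseteq> vectors H" by (rule closed_subspaceD[OF L])
  have sub: "ominus H L M \<subseteq> vectors H" using LV by (auto simp: ominus_def)
  have cl: "h \<in> ominus H L M" if h: "h \<in> hclosure H (ominus H L M)" for h
  proof -
    obtain s where hV: "h \<in> vectors H" and s: "\<And>n. s n \<in> ominus H L M"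
      and lim: "(\<lambda>n. hnorm H (\<lambda>x. s n x - h x)) \<longlonglongrightarrow> 0"
      using h hclosure_iff_seq[OF sub] by auto
    have sL: "s n \<in> L" for n using s by (simp add: ominus_def)
    have "inner_prod H h u = 0" if u: "u \<in> M" for u
    proof (rule LIMSEQ_unique)
      show "(\<lambda>n. inner_prod H (s n) u) \<longlonglongrightarrow> inner_prod H h u"
        by (rule tendsto_ip_left) (use sL LV M u hV lim in auto)
      show "(\<lambda>n. inner_prod H (s n) u) \<longlonglongrightarrow> 0"
        using s u by (simp add: ominus_def)
    qed
    then show ?thesis
      using closed_subspace_limit[OF L sL hV lim] by (simp add: ominus_def)
  qed
  then show ?thesis
    unfolding closed_subspace_def
  proof (intro conjI ballI allI subsetI)
    fix a b assume "a \<in> ominus H L M" "b \<in> ominus H L M"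
    then show "(\<lambda>x. a x + b x) \<in> ominus H L M"
      using closed_subspaceD(3)[OF L] LV M by (auto simp: ominus_def subset_iff ip_add_left)
  next
    fix a c assume "a \<in> ominus H L M"
    then show "(\<lambda>x. c * a x) \<in> ominus H L M"
      using closed_subspaceD(4)[OF L] LV M by (auto simp: ominus_def subset_iff ip_scale_left)
  next
    show "(\<lambda>_. 0) \<in> ominus H L M"
      using closed_subspaceD(2)[OF L] M by (auto simp: ominus_def subset_iff ip_zero_left)
  next
    show "a \<in> vectors H" if "a \<in> ominus H L M" for a using that sub by auto
  qed (rule cl)
qed

end

context semi_inner_space
begin

text \<open>Bessel's inequality, in the form that subtracting the components along the \<open>v n\<close> one after the other
gives residuals $r_n$ of decreasing norm, where $\|r_n\|^2 - \|r_{n+1}\|^2$ is the squared modulus of the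
$n$-th coefficient.\<close>

lemma orthonormal_weakly_null:
  assumes v: "\<And>n. v n \<in> vectors H" "\<And>n. hnorm H (v n) = 1"
    and orth: "\<And>m n. m \<noteq> n \<Longrightarrow> inner_prod H (v m) (v n) = 0"
    and h: "h \<in> vectors H"
  shows "(\<lambda>n. inner_prod H h (v n)) \<longlonglongrightarrow> 0"
proof -
  define r where "r = rec_nat h (\<lambda>n u x. u x - inner_prod H h (v n) * v n x)"
  have r0: "r 0 = h" by (simp add: r_def)
  have rS: "r (Suc n) = (\<lambda>x. r n x - inner_prod H h (v n) * v n x)" for n by (simp add: r_def)
  have rV: "r n \<in> vectors H" for n
  proof (induction n)
    case (Suc n)
    show ?case unfolding rS by (intro diff_mem scale_mem Suc v)
  qed (simp add: r0 h)
  have ipr: "inner_prod H (r n) (v m) = inner_prod H h (v m)" if "n \<le> m" for n m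
    using that
  proof (induction n)
    case (Suc n)
    have "inner_prod H (r (Suc n)) (v m) =
        inner_prod H (r n) (v m) - inner_prod H h (v n) * inner_prod H (v n) (v m)"
      unfolding rS ip_diff_left[OF rV scale_mem[OF v(1)] v(1)] ip_scale_left[OF v(1) v(1)] ..
    also have "inner_prod H (v n) (v m) = 0" using Suc.prems by (intro orth) simp
    finally show ?case using Suc by simp
  qed (simp add: r0)
  have step: "(hnorm H (r (Suc n)))\<^sup>2 = (hnorm H (r n))\<^sup>2 - (cmod (inner_prod H h (v n)))\<^sup>2" for n
    using hnorm_diff_scaled_sq[OF rV v(1), of n 1 n] by (simp add: rS ipr v(2))
  have "decseq (\<lambda>n. (hnorm H (r n))\<^sup>2)"
    by (rule decseq_SucI) (simp add: step)
  moreover have "bdd_below (range (\<lambda>n. (hnorm H (r n))\<^sup>2))" by (rule bdd_belowI2[of _ 0]) simp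
  ultimately have "convergent (\<lambda>n. (hnorm H (r n))\<^sup>2)"
    using LIMSEQ_decseq_INF convergentI by blast
  then obtain l where l: "(\<lambda>n. (hnorm H (r n))\<^sup>2) \<longlonglongrightarrow> l" by (auto simp: convergent_def)
  have "(\<lambda>n. (hnorm H (r n))\<^sup>2 - (hnorm H (r (Suc n)))\<^sup>2) \<longlonglongrightarrow> l - l"
    by (rule tendsto_diff[OF l LIMSEQ_Suc[OF l]])
  then have "(\<lambda>n. (cmod (inner_prod H h (v n)))\<^sup>2) \<longlonglongrightarrow> 0" by (simp add: step)
  then have "(\<lambda>n. sqrt ((cmod (inner_prod H h (v n)))\<^sup>2)) \<longlonglongrightarrow> sqrt 0" by (rule tendsto_real_sqrt)
  then show ?thesis by (simp add: tendsto_norm_zero_iff)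
qed

end

context semi_hilbert_space
begin

lemma geometric_limit:
  assumes s: "\<And>n. s n \<in> vectors H"
    and step: "\<And>n. hnorm H (\<lambda>x. s (Suc n) x - s n x) \<le> \<epsilon> / 2 ^ Suc n"
  shows "\<exists>l\<in>vectors H. (\<lambda>n. hnorm H (\<lambda>x. s n x - l x)) \<longlonglongrightarrow> 0 \<and>
    hnorm H (\<lambda>x. l x - s 0 x) \<le> \<epsilon>"
proof -
  have \<epsilon>: "\<epsilon> \<ge> 0" using step[of 0] hnorm_nonneg[OF diff_mem[OF s s], of "Suc 0" 0] by simp
  have le: "hnorm H (\<lambda>x. s (n + k) x - s n x) \<le> \<epsilon> / 2 ^ n - \<epsilon> / 2 ^ (n + k)" for n k
  proof (induction k)
    case 0
    show ?case by (simp add: hnorm_zero)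
  next
    case (Suc k)
    have "hnorm H (\<lambda>x. s (n + Suc k) x - s n x) \<le>
        hnorm H (\<lambda>x. s (Suc (n + k)) x - s (n + k) x) + hnorm H (\<lambda>x. s (n + k) x - s n x)"
      using hnorm_triangle_diff[OF s[of "Suc (n + k)"] s[of "n + k"] s[of n]] by simp
    also have "\<dots> \<le> \<epsilon> / 2 ^ Suc (n + k) + (\<epsilon> / 2 ^ n - \<epsilon> / 2 ^ (n + k))"
      by (rule add_mono[OF step Suc])
    also have "\<dots> = \<epsilon> / 2 ^ n - \<epsilon> / 2 ^ (n + Suc k)"
      by (simp add: field_simps)
    finally show ?case .
  qed
  have le': "hnorm H (\<lambda>x. s m x - s n x) \<le> \<epsilon> / 2 ^ n" if "n \<le> m" for m n
  proof -
    have "0 \<le> \<epsilon> / 2 ^ (n + (m - n))" using \<epsilon> by simp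
    then show ?thesis using le[of n "m - n"] that by simp
  qed
  have cau: "\<exists>N. \<forall>m\<ge>N. \<forall>n\<ge>N. hnorm H (\<lambda>x. s m x - s n x) < e" if e: "e > 0" for e
  proof -
    have "(\<lambda>n. \<epsilon> * (1 / 2) ^ n) \<longlonglongrightarrow> \<epsilon> * 0"
      by (intro tendsto_mult tendsto_const LIMSEQ_realpow_zero) auto
    then have "\<forall>\<^sub>F n in sequentially. \<epsilon> * (1 / 2) ^ n < e / 2"
      using order_tendstoD(2)[of _ "\<epsilon> * 0" _ "e / 2"] e by simp
    then obtain N where N: "\<epsilon> / 2 ^ N < e / 2"
      unfolding eventually_sequentially by (auto simp: power_divide)
    have "hnorm H (\<lambda>x. s m x - s n x) < e" if "m \<ge> N" "n \<ge> N" for m n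
    proof -
      have "hnorm H (\<lambda>x. s m x - s n x) \<le>
          hnorm H (\<lambda>x. s m x - s N x) + hnorm H (\<lambda>x. s N x - s n x)"
        by (rule hnorm_triangle_diff[OF s s s])
      also have "hnorm H (\<lambda>x. s N x - s n x) = hnorm H (\<lambda>x. s n x - s N x)"
        by (rule hnorm_commute[OF s s])
      finally show ?thesis using le'[OF that(1)] le'[OF that(2)] N by linarith
    qed
    then show ?thesis by blast
  qed
  have "\<exists>l\<in>vectors H. (\<lambda>n. hnorm H (\<lambda>x. s n x - l x)) \<longlonglongrightarrow> 0"
    by (rule complete[OF s cau])
  then obtain l where l: "l \<in> vectors H"
    and lim: "(\<lambda>n. hnorm H (\<lambda>x. s n x - l x)) \<longlonglongrightarrow> 0"
    by (elim bexE)
  have "hnorm H (\<lambda>x. l x - s 0 x) \<le> hnorm H (\<lambda>x. s n x - l x) + \<epsilon>" for n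
    using hnorm_triangle_diff[OF l s[of n] s[of 0]] hnorm_commute[OF l s, of n] le'[of 0 n] by simp
  then have "hnorm H (\<lambda>x. l x - s 0 x) \<le> 0 + \<epsilon>"
    by (intro LIMSEQ_le_const[OF tendsto_add[OF lim tendsto_const]]) auto
  then show ?thesis using l lim by (intro bexI[of _ l]) simp_all
qed

end

section \<open>Projections and adjoints\<close>

lemma (in semi_inner_space) normalize:
  assumes "q \<in> vectors H" "hnorm H q \<noteq> 0"
  shows "\<exists>c. hnorm H (\<lambda>x. c * q x) = 1"
  using assms hnorm_nonneg[OF assms(1)]
  by (intro exI[of _ "complex_of_real (1 / hnorm H q)"]) (simp only: hnorm_scale norm_of_real, simp)

locale hilbert_function_space = semi_hilbert_space +
  assumes definite: "\<lbrakk>a \<in> vectors H; hnorm H a = 0\<rbrakk> \<Longrightarrow> a = (\<lambda>_. 0)"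
begin

lemma proj_eqI:
  assumes N: "closed_subspace N" and v: "v \<in> vectors H" and w: "w \<in> N"
    and orth: "\<And>u. u \<in> N \<Longrightarrow> inner_prod H (\<lambda>x. v x - w x) u = 0"
  shows "proj H N v = w"
  unfolding proj_def
proof (rule the_equality)
  show "w \<in> N \<and> (\<forall>u\<in>N. inner_prod H (\<lambda>x. v x - w x) u = 0)" using w orth by auto
  fix w' assume w': "w' \<in> N \<and> (\<forall>u\<in>N. inner_prod H (\<lambda>x. v x - w' x) u = 0)"
  have NV: "N \<subseteq> vectors H" by (rule closed_subspaceD[OF N])
  let ?d = "\<lambda>x. w' x - w x"
  have dN: "?d \<in> N" using closed_subspace_diff[OF N] w w' by blast
  have V: "w \<in> vectors H" "w' \<in> vectors H" "?d \<in> vectors H" using NV w w' dN by auto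
  have "inner_prod H ?d ?d = inner_prod H (\<lambda>x. v x - w x) ?d - inner_prod H (\<lambda>x. v x - w' x) ?d"
    using V v by (simp add: ip_diff_left)
  then have "inner_prod H ?d ?d = 0" using w' orth[OF dN] dN by auto
  then have "?d = (\<lambda>_. 0)" using definite[OF V(3)] ip_self[OF V(3)] by simp
  then show "w' = w" by (metis eq_iff_diff_eq_0 ext)
qed

lemma proj:
  assumes N: "closed_subspace N" and v: "v \<in> vectors H"
  shows proj_mem: "proj H N v \<in> N"
    and proj_orth: "u \<in> N \<Longrightarrow> inner_prod H (\<lambda>x. v x - proj H N v x) u = 0"
proof -
  obtain w where w: "w \<in> N" "\<And>u. u \<in> N \<Longrightarrow> inner_prod H (\<lambda>x. v x - w x) u = 0"
    using projection_exists[OF N v] by auto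
  have "proj H N v = w" by (rule proj_eqI[OF N v w])
  then show "proj H N v \<in> N" "u \<in> N \<Longrightarrow> inner_prod H (\<lambda>x. v x - proj H N v x) u = 0"
    using w by auto
qed

lemma proj_ip:
  assumes N: "closed_subspace N" and v: "v \<in> vectors H" and u: "u \<in> N"
  shows "inner_prod H (proj H N v) u = inner_prod H v u"
    and "inner_prod H u (proj H N v) = inner_prod H u v"
proof -
  have V: "proj H N v \<in> vectors H" "u \<in> vectors H"
    using proj_mem[OF N v] u closed_subspaceD(1)[OF N] by auto
  show "inner_prod H (proj H N v) u = inner_prod H v u"
    using proj_orth[OF N v u] V v by (simp add: ip_diff_left)
  then show "inner_prod H u (proj H N v) = inner_prod H u v"
    using ip_cnj V v by metis
qed

text \<open>Normalize the component of \<open>e\<close> orthogonal to \<open>J\<close>.\<close>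

lemma orthogonal_unit_vector:
  assumes L: "closed_subspace L" and J: "closed_subspace J" "J \<subseteq> L" and e: "e \<in> L" "e \<notin> J"
  shows "\<exists>v\<in>L. hnorm H v = 1 \<and> (\<forall>u\<in>J. inner_prod H v u = 0)"
proof -
  have eV: "e \<in> vectors H" using closed_subspaceD(1)[OF L] e(1) by auto
  let ?w = "\<lambda>x. e x - proj H J e x"
  have wL: "?w \<in> L" using proj_mem[OF J(1) eV] J(2) by (intro closed_subspace_diff[OF L e(1)]) auto
  have wV: "?w \<in> vectors H" using closed_subspaceD(1)[OF L] wL by auto
  have "hnorm H ?w \<noteq> 0"
  proof
    assume "hnorm H ?w = 0"
    then have "?w = (\<lambda>_. 0)" by (rule definite[OF wV])
    then have "e = proj H J e" by (metis eq_iff_diff_eq_0 ext)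
    then show False using e(2) proj_mem[OF J(1) eV] by simp
  qed
  then obtain c where c: "hnorm H (\<lambda>x. c * ?w x) = 1" using normalize[OF wV] by auto
  have "inner_prod H (\<lambda>x. c * ?w x) u = 0" if u: "u \<in> J" for u
  proof -
    have uV: "u \<in> vectors H" using u closed_subspaceD(1)[OF J(1)] by auto
    show ?thesis unfolding ip_scale_left[OF wV uV] proj_orth[OF J(1) eV u] by simp
  qed
  then show ?thesis using c closed_subspaceD(4)[OF L wL] by blast
qed

lemma hnorm_proj_le:
  assumes N: "closed_subspace N" and v: "v \<in> vectors H"
  shows "hnorm H (proj H N v) \<le> hnorm H v"
proof -
  have V: "proj H N v \<in> vectors H" using proj_mem[OF N v] closed_subspaceD(1)[OF N] by auto
  have "(hnorm H (proj H N v))\<^sup>2 = cmod (inner_prod H v (proj H N v))"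
    using proj_ip(1)[OF N v proj_mem[OF N v]] ip_self[OF V] by (metis norm_of_real abs_power2)
  also have "\<dots> \<le> hnorm H v * hnorm H (proj H N v)" by (rule Cauchy_Schwarz[OF v V])
  finally show ?thesis
    using hnorm_nonneg[OF V] hnorm_nonneg[OF v] by (auto simp: power2_eq_square mult_le_cancel_right)
qed

lemma hadjoint:
  assumes T: "T \<in> bounded_operators H" and h: "h \<in> vectors H"
  shows hadjoint_mem: "hadjoint H T h \<in> vectors H"
    and ip_hadjoint: "u \<in> vectors H \<Longrightarrow> inner_prod H u (hadjoint H T h) = inner_prod H (T u) h"
proof -
  have TV: "\<And>u. u \<in> vectors H \<Longrightarrow> T u \<in> vectors H" and
    Tadd: "\<And>a b. a \<in> vectors H \<Longrightarrow> b \<in> vectors H \<Longrightarrow> T (\<lambda>x. a x + b x) = (\<lambda>x. T a x + T b x)" and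
    Tsc: "\<And>c a. a \<in> vectors H \<Longrightarrow> T (\<lambda>x. c * a x) = (\<lambda>x. c * T a x)"
    using T by (auto simp: bounded_operators_def)
  have "\<exists>C. \<forall>u\<in>vectors H. hnorm H (T u) \<le> C * hnorm H u"
    using T by (simp add: bounded_operators_def)
  then obtain C where C: "\<forall>u\<in>vectors H. hnorm H (T u) \<le> C * hnorm H u" by (elim exE)
  have "\<exists>k\<in>vectors H. \<forall>a\<in>vectors H. inner_prod H (T a) h = inner_prod H a k"
  proof (rule Riesz_representation)
    fix a assume a: "a \<in> vectors H"
    have "cmod (inner_prod H (T a) h) \<le> hnorm H (T a) * hnorm H h"
      by (rule Cauchy_Schwarz[OF TV[OF a] h])
    also have "\<dots> \<le> (C * hnorm H a) * hnorm H h"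
      by (rule mult_right_mono[OF bspec[OF C a] hnorm_nonneg[OF h]])
    finally show "cmod (inner_prod H (T a) h) \<le> (C * hnorm H h) * hnorm H a"
      by (simp add: mult_ac)
  qed (simp_all add: Tadd Tsc TV h ip_add_left ip_scale_left)
  then obtain k where k: "k \<in> vectors H" "\<And>a. a \<in> vectors H \<Longrightarrow> inner_prod H (T a) h = inner_prod H a k"
    by auto
  have "(THE w. w \<in> vectors H \<and> (\<forall>u\<in>vectors H. inner_prod H (T u) h = inner_prod H u w)) = k"
  proof (rule the_equality)
    show "k \<in> vectors H \<and> (\<forall>u\<in>vectors H. inner_prod H (T u) h = inner_prod H u k)" using k by auto
    fix w assume w: "w \<in> vectors H \<and> (\<forall>u\<in>vectors H. inner_prod H (T u) h = inner_prod H u w)"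
    let ?d = "\<lambda>x. w x - k x"
    have d: "?d \<in> vectors H" using w k diff_mem by auto
    have "inner_prod H ?d ?d = inner_prod H ?d w - inner_prod H ?d k"
      using w k(1) d by (intro ip_diff_right) auto
    also have "\<dots> = 0" using w k(2)[OF d] d by auto
    finally have "inner_prod H ?d ?d = 0" .
    then have "?d = (\<lambda>_. 0)" using definite[OF d] ip_self[OF d] by simp
    then show "w = k" by (metis eq_iff_diff_eq_0 ext)
  qed
  then have "hadjoint H T h = k" using h by (simp add: hadjoint_def)
  then show "hadjoint H T h \<in> vectors H"
    "u \<in> vectors H \<Longrightarrow> inner_prod H u (hadjoint H T h) = inner_prod H (T u) h"
    using k by auto
qed

end

section \<open>Algebras of bounded multipliers\<close>

text \<open>The functions in \<open>vectors H\<close> are extended by \<open>0\<close>, so the unit of the algebra is the indicator function of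
\<open>points H\<close>.\<close>

locale multiplier_algebra = hilbert_function_space H for H :: "'x function_space" +
  fixes A :: "('x \<Rightarrow> complex) set"
  assumes vectors_functions_on: "vectors H \<subseteq> functions_on (points H)"
    and unit_mem: "(\<lambda>x. if x \<in> points H then 1 else 0) \<in> A"
    and A_add: "\<lbrakk>f \<in> A; g \<in> A\<rbrakk> \<Longrightarrow> (\<lambda>x. f x + g x) \<in> A"
    and A_scale: "f \<in> A \<Longrightarrow> (\<lambda>x. c * f x) \<in> A"
    and A_mult: "\<lbrakk>f \<in> A; g \<in> A\<rbrakk> \<Longrightarrow> (\<lambda>x. f x * g x) \<in> A"
    and mult_op_bounded: "f \<in> A \<Longrightarrow> mult_op H f \<in> bounded_operators H"
begin

lemma A_zero: "(\<lambda>_. 0) \<in> A"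
  using A_scale[OF unit_mem, of 0] by simp

lemma A_diff: "\<lbrakk>f \<in> A; g \<in> A\<rbrakk> \<Longrightarrow> (\<lambda>x. f x - g x) \<in> A"
  using A_add[OF _ A_scale[of g "-1"], of f] by simp

lemma mult_op_eq: "h \<in> vectors H \<Longrightarrow> mult_op H f h = (\<lambda>x. f x * h x)"
  by (simp add: mult_op_def)

lemma mult_mem: "\<lbrakk>f \<in> A; h \<in> vectors H\<rbrakk> \<Longrightarrow> (\<lambda>x. f x * h x) \<in> vectors H"
  using mult_op_bounded[of f] by (auto simp: bounded_operators_def mult_op_def PiE_iff)

lemma mult_bound:
  assumes "f \<in> A"
  shows "\<exists>C. C \<ge> 0 \<and> (\<forall>h\<in>vectors H. hnorm H (\<lambda>x. f x * h x) \<le> C * hnorm H h)"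
proof -
  have "\<exists>C. \<forall>h\<in>vectors H. hnorm H (mult_op H f h) \<le> C * hnorm H h"
    using mult_op_bounded[OF assms] by (simp add: bounded_operators_def)
  then obtain C where C: "\<forall>h\<in>vectors H. hnorm H (mult_op H f h) \<le> C * hnorm H h" by (elim exE)
  show ?thesis
  proof (intro exI conjI ballI)
    fix h assume h: "h \<in> vectors H"
    have "hnorm H (\<lambda>x. f x * h x) \<le> C * hnorm H h" using bspec[OF C h] by (simp only: mult_op_eq[OF h])
    also have "\<dots> \<le> max C 0 * hnorm H h" using hnorm_nonneg[OF h] by (simp add: mult_right_mono)
    finally show "hnorm H (\<lambda>x. f x * h x) \<le> max C 0 * hnorm H h" .
  qed simp
qed

lemma unit_mult: "h \<in> vectors H \<Longrightarrow> (\<lambda>x. (if x \<in> points H then 1 else 0) * h x) = h"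
  using vectors_functions_on by (fastforce simp: functions_on_def)

lemma tendsto_mult_op:
  assumes f: "f \<in> A" and s: "\<And>n. s n \<in> vectors H" and h: "h \<in> vectors H"
    and lim: "(\<lambda>n. hnorm H (\<lambda>x. s n x - h x)) \<longlonglongrightarrow> 0"
  shows "(\<lambda>n. hnorm H (\<lambda>x. f x * s n x - f x * h x)) \<longlonglongrightarrow> 0"
proof -
  obtain C where C0: "C \<ge> 0" and C': "\<forall>h\<in>vectors H. hnorm H (\<lambda>x. f x * h x) \<le> C * hnorm H h"
    using mult_bound[OF f] by (elim exE conjE)
  note C = bspec[OF C']
  have le: "hnorm H (\<lambda>x. f x * s n x - f x * h x) \<le> C * hnorm H (\<lambda>x. s n x - h x)" for n
    using C[OF diff_mem[OF s h], of n] by (simp only: right_diff_distrib)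
  have nn: "0 \<le> hnorm H (\<lambda>x. f x * s n x - f x * h x)" for n
    by (intro hnorm_nonneg diff_mem mult_mem f s h)
  have lim': "(\<lambda>n. C * hnorm H (\<lambda>x. s n x - h x)) \<longlonglongrightarrow> 0"
    using tendsto_mult[OF tendsto_const lim, of C] by simp
  show ?thesis
    by (rule tendsto_sandwich[OF always_eventually always_eventually tendsto_const lim'])
      (use le nn in auto)
qed

lemma cyclic_space_eq:
  "h \<in> vectors H \<Longrightarrow> cyclic_space H S h = hclosure H ((\<lambda>f x. f x * h x) ` S)"
  by (simp add: cyclic_space_def mult_op_eq)

lemma vanishing_ideal_subset: "vanishing_ideal A E \<subseteq> A"
  by (auto simp: vanishing_ideal_def)

lemma vanishing_ideal_mult: "\<lbrakk>f \<in> A; g \<in> vanishing_ideal A E\<rbrakk> \<Longrightarrow> (\<lambda>x. f x * g x) \<in> vanishing_ideal A E"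
  by (auto simp: vanishing_ideal_def A_mult)

lemma cyclic_space_seq:
  assumes "h \<in> vectors H" "S \<subseteq> A"
  shows "u \<in> cyclic_space H S h \<longleftrightarrow> u \<in> vectors H \<and>
    (\<exists>a. (\<forall>n. a n \<in> S) \<and> (\<lambda>n. hnorm H (\<lambda>x. a n x * h x - u x)) \<longlonglongrightarrow> 0)"
proof -
  have sub: "(\<lambda>f x. f x * h x) ` S \<subseteq> vectors H" using assms mult_mem by auto
  show ?thesis
    unfolding cyclic_space_eq[OF assms(1)] hclosure_iff_seq[OF sub]
  proof (intro conj_cong refl iffI)
    assume "\<exists>s. (\<forall>n. s n \<in> (\<lambda>f x. f x * h x) ` S) \<and> (\<lambda>n. hnorm H (\<lambda>x. s n x - u x)) \<longlonglongrightarrow> 0"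
    then obtain s where s: "\<forall>n. s n \<in> (\<lambda>f x. f x * h x) ` S"
      and lim: "(\<lambda>n. hnorm H (\<lambda>x. s n x - u x)) \<longlonglongrightarrow> 0"
      by (elim exE conjE)
    have "\<forall>n. \<exists>f\<in>S. s n = (\<lambda>x. f x * h x)" using s by (simp add: image_iff)
    then obtain a where "\<And>n. a n \<in> S" "\<And>n. s n = (\<lambda>x. a n x * h x)" by metis
    then show "\<exists>a. (\<forall>n. a n \<in> S) \<and> (\<lambda>n. hnorm H (\<lambda>x. a n x * h x - u x)) \<longlonglongrightarrow> 0"
      using lim by (intro exI[of _ a]) auto
  next
    assume "\<exists>a. (\<forall>n. a n \<in> S) \<and> (\<lambda>n. hnorm H (\<lambda>x. a n x * h x - u x)) \<longlonglongrightarrow> 0"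
    then obtain a where "\<And>n. a n \<in> S" "(\<lambda>n. hnorm H (\<lambda>x. a n x * h x - u x)) \<longlonglongrightarrow> 0" by auto
    then show "\<exists>s. (\<forall>n. s n \<in> (\<lambda>f x. f x * h x) ` S) \<and> (\<lambda>n. hnorm H (\<lambda>x. s n x - u x)) \<longlonglongrightarrow> 0"
      by (intro exI[of _ "\<lambda>n x. a n x * h x"]) auto
  qed
qed

lemma cyclic_space_closed_subspace:
  assumes h: "h \<in> vectors H" and S: "S \<subseteq> A" "(\<lambda>_. 0) \<in> S"
    and add: "\<And>f g. \<lbrakk>f \<in> S; g \<in> S\<rbrakk> \<Longrightarrow> (\<lambda>x. f x + g x) \<in> S"
    and scale: "\<And>c f. f \<in> S \<Longrightarrow> (\<lambda>x. c * f x) \<in> S"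
  shows "closed_subspace (cyclic_space H S h)"
  unfolding cyclic_space_eq[OF h]
proof (rule hclosure_closed_subspace)
  show "(\<lambda>f x. f x * h x) ` S \<subseteq> vectors H" using S mult_mem[OF _ h] by auto
  show "(\<lambda>_. 0) \<in> (\<lambda>f x. f x * h x) ` S" using S(2) by (auto intro!: image_eqI[of _ _ "\<lambda>_. 0"])
  fix a assume "a \<in> (\<lambda>f x. f x * h x) ` S"
  then obtain f where f: "f \<in> S" "a = (\<lambda>x. f x * h x)" by auto
  show "(\<lambda>x. c * a x) \<in> (\<lambda>f x. f x * h x) ` S" for c
    using scale[OF f(1), of c] f(2) by (auto intro!: image_eqI[of _ _ "\<lambda>x. c * f x"])
  fix b assume "b \<in> (\<lambda>f x. f x * h x) ` S"
  then obtain g where g: "g \<in> S" "b = (\<lambda>x. g x * h x)" by auto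
  show "(\<lambda>x. a x + b x) \<in> (\<lambda>f x. f x * h x) ` S"
    using add[OF f(1) g(1)] f(2) g(2)
    by (auto intro!: image_eqI[of _ _ "\<lambda>x. f x + g x"] simp: algebra_simps)
qed

lemma cyclic_closed: "h \<in> vectors H \<Longrightarrow> closed_subspace (cyclic_space H A h)"
  by (rule cyclic_space_closed_subspace) (auto simp: A_zero A_add A_scale)

lemma cyclic_ideal_closed: "h \<in> vectors H \<Longrightarrow> closed_subspace (cyclic_space H (vanishing_ideal A E) h)"
  by (rule cyclic_space_closed_subspace) (auto simp: vanishing_ideal_def A_zero A_add A_scale)

lemma cyclic_self: "h \<in> vectors H \<Longrightarrow> h \<in> cyclic_space H A h"
  unfolding cyclic_space_seq[OF _ order_refl]
proof (intro conjI exI[of _ "\<lambda>_ x. if x \<in> points H then 1 else 0"] allI)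
  assume h: "h \<in> vectors H"
  have "(\<lambda>x. (if x \<in> points H then 1 else 0) * h x - h x) = (\<lambda>_. 0)"
    using unit_mult[OF h] by (metis cancel_comm_monoid_add_class.diff_cancel)
  then show "(\<lambda>n. hnorm H (\<lambda>x. (if x \<in> points H then 1 else 0) * h x - h x)) \<longlonglongrightarrow> 0"
    by (simp only: hnorm_zero tendsto_const)
qed (simp_all add: unit_mem)

lemma cyclic_invariant:
  assumes h: "h \<in> vectors H" and f: "f \<in> A" and u: "u \<in> cyclic_space H A h"
  shows "(\<lambda>x. f x * u x) \<in> cyclic_space H A h"
proof -
  obtain a where uV: "u \<in> vectors H" and a: "\<And>n. a n \<in> A"
    and lim: "(\<lambda>n. hnorm H (\<lambda>x. a n x * h x - u x)) \<longlonglongrightarrow> 0"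
    using u unfolding cyclic_space_seq[OF h order_refl] by auto
  have "(\<lambda>n. hnorm H (\<lambda>x. f x * (a n x * h x) - f x * u x)) \<longlonglongrightarrow> 0"
    by (rule tendsto_mult_op[OF f mult_mem[OF a h] uV lim])
  then show ?thesis
    unfolding cyclic_space_seq[OF h order_refl] using mult_mem[OF f uV] A_mult[OF f a]
    by (intro conjI exI[of _ "\<lambda>n x. f x * a n x"]) (auto simp: mult.assoc)
qed

text \<open>The right-hand side mentions the cyclic subspace $A[h]$ but not $h$ itself. This is why
$A[h] \ominus J_E[h]$ depends on the subspace alone, whatever cyclic vector is used.\<close>

lemma ideal_orthogonal_iff:
  assumes h: "h \<in> vectors H" and v: "v \<in> vectors H"
  shows "(\<forall>u\<in>cyclic_space H (vanishing_ideal A E) h. inner_prod H v u = 0) \<longleftrightarrow>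
    (\<forall>g\<in>vanishing_ideal A E. \<forall>u\<in>cyclic_space H A h. inner_prod H v (\<lambda>x. g x * u x) = 0)"
    (is "?lhs \<longleftrightarrow> ?rhs")
proof
  let ?J = "vanishing_ideal A E"
  have gh: "(\<lambda>x. g x * h x) \<in> cyclic_space H ?J h" if "g \<in> ?J" for g
    unfolding cyclic_space_seq[OF h vanishing_ideal_subset]
    using that vanishing_ideal_subset mult_mem[OF _ h]
    by (intro conjI exI[of _ "\<lambda>_. g"]) (auto simp: hnorm_zero)
  {
    assume L: ?lhs
    show ?rhs
    proof (intro ballI)
      fix g u assume g: "g \<in> ?J" and u: "u \<in> cyclic_space H A h"
      have gA: "g \<in> A" using g vanishing_ideal_subset by auto
      obtain a where uV: "u \<in> vectors H" and a: "\<And>n. a n \<in> A"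
        and lim: "(\<lambda>n. hnorm H (\<lambda>x. a n x * h x - u x)) \<longlonglongrightarrow> 0"
        using u unfolding cyclic_space_seq[OF h order_refl] by auto
      have "(\<lambda>n. inner_prod H v (\<lambda>x. g x * (a n x * h x))) \<longlonglongrightarrow> inner_prod H v (\<lambda>x. g x * u x)"
        by (rule tendsto_ip_right[OF _ _ v tendsto_mult_op[OF gA mult_mem[OF a h] uV lim]])
          (intro mult_mem gA a h uV)+
      moreover have "inner_prod H v (\<lambda>x. g x * (a n x * h x)) = 0" for n
        using L gh[OF vanishing_ideal_mult[OF a g], of n] by (simp add: mult_ac)
      ultimately show "inner_prod H v (\<lambda>x. g x * u x) = 0"
        by (simp add: LIMSEQ_const_iff)
    qed
  }
  assume R: ?rhs
  show ?lhs
  proof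
    fix u assume "u \<in> cyclic_space H ?J h"
    then obtain a where uV: "u \<in> vectors H" and a: "\<And>n. a n \<in> ?J"
      and lim: "(\<lambda>n. hnorm H (\<lambda>x. a n x * h x - u x)) \<longlonglongrightarrow> 0"
      unfolding cyclic_space_seq[OF h vanishing_ideal_subset] by auto
    have "(\<lambda>n. inner_prod H v (\<lambda>x. a n x * h x)) \<longlonglongrightarrow> inner_prod H v u"
      by (rule tendsto_ip_right[OF mult_mem[OF _ h] uV v lim]) (use a vanishing_ideal_subset in auto)
    moreover have "inner_prod H v (\<lambda>x. a n x * h x) = 0" for n
      using R a cyclic_self[OF h] by blast
    ultimately show "inner_prod H v u = 0" by (simp add: LIMSEQ_const_iff)
  qed
qed

lemma defect_space_iff:
  assumes "L \<subseteq> vectors H"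
  shows "v \<in> defect_space H A E L \<longleftrightarrow>
    v \<in> L \<and> (\<forall>g\<in>vanishing_ideal A E. \<forall>u\<in>L. inner_prod H v (\<lambda>x. g x * u x) = 0)"
  using assms by (auto simp: defect_space_def ominus_def mult_op_def subset_iff)

lemma ominus_cyclic_ideal:
  assumes h: "h \<in> vectors H"
  shows "ominus H (cyclic_space H A h) (cyclic_space H (vanishing_ideal A E) h) =
    defect_space H A E (cyclic_space H A h)"
proof -
  have LV: "cyclic_space H A h \<subseteq> vectors H" by (rule closed_subspaceD(1)[OF cyclic_closed[OF h]])
  show ?thesis
    using ideal_orthogonal_iff[OF h, of _ E] LV unfolding set_eq_iff defect_space_iff[OF LV]
    by (auto simp: ominus_def)
qed

lemma defect_space_closed:
  assumes h: "h \<in> vectors H"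
  shows "closed_subspace (defect_space H A E (cyclic_space H A h))"
  unfolding ominus_cyclic_ideal[OF h, symmetric]
  by (rule ominus_closed_subspace[OF cyclic_closed[OF h] closed_subspaceD(1)[OF cyclic_ideal_closed[OF h]]])

lemma unit_vector_in_defect_space:
  assumes h: "h \<in> vectors H"
  shows "(\<exists>v\<in>defect_space H A E (cyclic_space H A h). hnorm H v = 1) \<longleftrightarrow>
    cyclic_space H (vanishing_ideal A E) h \<noteq> cyclic_space H A h"
proof -
  let ?L = "cyclic_space H A h" and ?J = "cyclic_space H (vanishing_ideal A E) h"
  have L: "closed_subspace ?L" and J: "closed_subspace ?J"
    using cyclic_closed[OF h] cyclic_ideal_closed[OF h] by auto
  have LV: "?L \<subseteq> vectors H" and JV: "?J \<subseteq> vectors H"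
    using closed_subspaceD(1)[OF L] closed_subspaceD(1)[OF J] by auto
  have JL: "?J \<subseteq> ?L"
    using cyclic_space_seq[OF h vanishing_ideal_subset] cyclic_space_seq[OF h order_refl]
      vanishing_ideal_subset by blast
  show ?thesis
    unfolding ominus_cyclic_ideal[OF h, symmetric]
  proof
    assume "\<exists>v\<in>ominus H ?L ?J. hnorm H v = 1"
    then obtain v where v: "v \<in> ?L" "\<forall>u\<in>?J. inner_prod H v u = 0" "hnorm H v = 1"
      by (auto simp: ominus_def)
    show "?J \<noteq> ?L"
    proof
      assume "?J = ?L"
      then have "inner_prod H v v = 0" using v by simp
      then show False using v(3) ip_self[of v] v(1) LV by auto
    qed
  next
    assume "?J \<noteq> ?L"
    then obtain v where v: "v \<in> ?L" "v \<notin> ?J" using JL by blast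
    from orthogonal_unit_vector[OF L J JL v]
    show "\<exists>v\<in>ominus H ?L ?J. hnorm H v = 1" unfolding ominus_def by blast
  qed
qed

text \<open>One choice of a unit vector has to serve all cyclic vectors \<open>h\<close> of the same subspace $L$. By
\<open>ominus_cyclic_ideal\<close> and \<open>unit_vector_in_defect_space\<close> both the condition and the set to choose from are
determined by $L$.\<close>

lemma cyclic_kernels_exist: "\<exists>k. cyclic_kernels H A k"
proof -
  define k where "k L w = (let q = proj H L (reproducing_kernel H w); D = defect_space H A {w} L in
    if q \<noteq> (\<lambda>_. 0) then q else if \<exists>v\<in>D. hnorm H v = 1 then SOME v. v \<in> D \<and> hnorm H v = 1
    else (\<lambda>_. 0))" for L w
  have "cyclic_kernels H A k"
    unfolding cyclic_kernels_def Let_def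
  proof (intro ballI)
    fix h w assume h: "h \<in> vectors H"
    let ?L = "cyclic_space H A h" and ?J = "cyclic_space H (vanishing_ideal A {w}) h"
    let ?q = "proj H ?L (reproducing_kernel H w)" and ?D = "defect_space H A {w} ?L"
    have unit: "?J \<noteq> ?L \<longleftrightarrow> (\<exists>v\<in>?D. hnorm H v = 1)"
      using unit_vector_in_defect_space[OF h, of "{w}"] by simp
    show "if ?q \<noteq> (\<lambda>_. 0) then k ?L w = ?q
        else if ?J \<noteq> ?L then k ?L w \<in> ominus H ?L ?J \<and> hnorm H (k ?L w) = 1
        else k ?L w = (\<lambda>_. 0)"
      unfolding unit ominus_cyclic_ideal[OF h]
    proof (split if_split, intro conjI impI)
      assume "?q \<noteq> (\<lambda>_. 0)"
      then show "k ?L w = ?q" by (simp add: k_def)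
    next
      assume "\<not> ?q \<noteq> (\<lambda>_. 0)"
      then have k: "k ?L w = (if \<exists>v\<in>?D. hnorm H v = 1 then SOME v. v \<in> ?D \<and> hnorm H v = 1 else (\<lambda>_. 0))"
        by (simp add: k_def)
      show "if \<exists>v\<in>?D. hnorm H v = 1 then k ?L w \<in> ?D \<and> hnorm H (k ?L w) = 1 else k ?L w = (\<lambda>_. 0)"
      proof (cases "\<exists>v\<in>?D. hnorm H v = 1")
        case True
        then have "\<exists>v. v \<in> ?D \<and> hnorm H v = 1" by auto
        from someI_ex[OF this] show ?thesis using True k by simp
      qed (use k in simp)
    qed
  qed
  then show ?thesis by blast
qed

end

section \<open>Compressions to defect spaces\<close>

context multiplier_algebra
begin

lemma op_norm_upper:
  assumes f: "f \<in> A" and h: "h \<in> vectors H" "hnorm H h \<le> 1"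
    and T: "\<And>h. h \<in> vectors H \<Longrightarrow> T h = (\<lambda>x. f x * h x)"
  shows "hnorm H (\<lambda>x. f x * h x) \<le> op_norm H (vectors H) T"
proof -
  obtain C where C0: "C \<ge> 0" and C: "\<forall>h\<in>vectors H. hnorm H (\<lambda>x. f x * h x) \<le> C * hnorm H h"
    using mult_bound[OF f] by (elim exE conjE)
  have "hnorm H (T h) \<le> op_norm H (vectors H) T"
    unfolding op_norm_def
  proof (rule cSUP_upper[OF _ bdd_aboveI2])
    fix v assume v: "v \<in> {v \<in> vectors H. hnorm H v \<le> 1}"
    then have "hnorm H (T v) \<le> C * hnorm H v" using T C by simp
    also have "\<dots> \<le> C * 1" using v C0 by (intro mult_left_mono) auto
    finally show "hnorm H (T v) \<le> C" by simp
  qed (use h in simp)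
  then show ?thesis using T[OF h(1)] by simp
qed

lemma op_norm_nonneg:
  assumes f: "f \<in> A" and T: "\<And>h. h \<in> vectors H \<Longrightarrow> T h = (\<lambda>x. f x * h x)"
  shows "0 \<le> op_norm H (vectors H) T"
  using op_norm_upper[OF f zero_mem _ T] by (simp add: hnorm_zero)

lemma hnorm_mult_le_op_norm:
  assumes f: "f \<in> A" and h: "h \<in> vectors H"
    and T: "\<And>h. h \<in> vectors H \<Longrightarrow> T h = (\<lambda>x. f x * h x)"
  shows "hnorm H (\<lambda>x. f x * h x) \<le> op_norm H (vectors H) T * hnorm H h"
proof (cases "hnorm H h = 0")
  case True
  then show ?thesis using mult_bound[OF f] h by auto
next
  case False
  then obtain c where c: "hnorm H (\<lambda>x. c * h x) = 1" using normalize[OF h] by auto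
  have fh: "(\<lambda>x. f x * (c * h x)) = (\<lambda>x. c * (f x * h x))" by (simp add: mult.left_commute)
  have "cmod c * hnorm H (\<lambda>x. f x * h x) \<le> op_norm H (vectors H) T"
    using op_norm_upper[OF f scale_mem[OF h] _ T, of c] c
    unfolding fh hnorm_scale[OF mult_mem[OF f h]] by simp
  moreover have ch: "cmod c * hnorm H h = 1" using c by (simp add: hnorm_scale[OF h])
  ultimately have "(cmod c * hnorm H (\<lambda>x. f x * h x)) * hnorm H h \<le> op_norm H (vectors H) T * hnorm H h"
    by (intro mult_right_mono hnorm_nonneg h)
  then show ?thesis using ch by (metis (no_types) mult.assoc mult.commute mult.right_neutral)
qed

lemma ip_hadjoint_mult:
  assumes "f \<in> A" "u \<in> vectors H" "v \<in> vectors H"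
  shows "inner_prod H u (hadjoint H (mult_op H f) v) = inner_prod H (\<lambda>x. f x * u x) v"
  using ip_hadjoint[OF mult_op_bounded[OF assms(1)] assms(3,2)] by (simp only: mult_op_eq[OF assms(2)])

lemma hadjoint_mult_mem: "\<lbrakk>f \<in> A; v \<in> vectors H\<rbrakk> \<Longrightarrow> hadjoint H (mult_op H f) v \<in> vectors H"
  by (rule hadjoint_mem[OF mult_op_bounded])

text \<open>Let $w$ be the compression of $M_f^*$ at $v$. Then
$\|w\|^2 = \langle f w, v \rangle = \langle (f - g) w, v \rangle$, because $v$ is orthogonal to
$g w \in J_E L$.\<close>

lemma compression_le_quotient_norm:
  assumes h: "h \<in> vectors H" and f: "f \<in> A" and g: "g \<in> vanishing_ideal A E"
    and v: "v \<in> defect_space H A E (cyclic_space H A h)" "hnorm H v \<le> 1"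
  shows "hnorm H (proj H (defect_space H A E (cyclic_space H A h)) (hadjoint H (mult_op H f) v))
    \<le> op_norm H (vectors H) (\<lambda>h x. mult_op H f h x - mult_op H g h x)"
proof -
  let ?L = "cyclic_space H A h" and ?N = "defect_space H A E (cyclic_space H A h)"
  let ?T = "\<lambda>h x. mult_op H f h x - mult_op H g h x"
  have N: "closed_subspace ?N" by (rule defect_space_closed[OF h])
  have LV: "?L \<subseteq> vectors H" by (rule closed_subspaceD(1)[OF cyclic_closed[OF h]])
  have gA: "g \<in> A" using g vanishing_ideal_subset by auto
  have vV: "v \<in> vectors H" using v(1) closed_subspaceD(1)[OF N] by auto
  let ?a = "hadjoint H (mult_op H f) v"
  have aV: "?a \<in> vectors H" by (rule hadjoint_mult_mem[OF f vV])
  define w where "w = proj H ?N ?a"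
  have wN: "w \<in> ?N" unfolding w_def by (rule proj_mem[OF N aV])
  have wV: "w \<in> vectors H" using wN closed_subspaceD(1)[OF N] by auto
  have wL: "w \<in> ?L" using wN by (simp add: defect_space_iff[OF LV])
  have "complex_of_real ((hnorm H w)\<^sup>2) = inner_prod H w ?a"
    using proj_ip(2)[OF N aV wN] ip_self[OF wV] by (simp add: w_def)
  also have "\<dots> = inner_prod H (\<lambda>x. f x * w x) v"
    by (rule ip_hadjoint_mult[OF f wV vV])
  also have "\<dots> = inner_prod H (\<lambda>x. (f x - g x) * w x) v + inner_prod H (\<lambda>x. g x * w x) v"
    using ip_add_left[OF mult_mem[OF A_diff[OF f gA] wV] mult_mem[OF gA wV] vV]
    by (simp add: algebra_simps)
  also have "inner_prod H (\<lambda>x. g x * w x) v = cnj (inner_prod H v (\<lambda>x. g x * w x))"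
    by (rule ip_cnj[OF vV mult_mem[OF gA wV], symmetric])
  also have "inner_prod H v (\<lambda>x. g x * w x) = 0"
    using v(1) g wL by (simp add: defect_space_iff[OF LV])
  finally have eq: "complex_of_real ((hnorm H w)\<^sup>2) = inner_prod H (\<lambda>x. (f x - g x) * w x) v" by simp
  have "(hnorm H w)\<^sup>2 = cmod (inner_prod H (\<lambda>x. (f x - g x) * w x) v)"
    unfolding eq[symmetric] norm_of_real by simp
  also have "\<dots> \<le> hnorm H (\<lambda>x. (f x - g x) * w x) * hnorm H v"
    by (rule Cauchy_Schwarz[OF mult_mem[OF A_diff[OF f gA] wV] vV])
  also have "\<dots> \<le> hnorm H (\<lambda>x. (f x - g x) * w x) * 1"
    by (rule mult_left_mono[OF v(2) hnorm_nonneg[OF mult_mem[OF A_diff[OF f gA] wV]]])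
  also have "\<dots> \<le> op_norm H (vectors H) ?T * hnorm H w"
    using hnorm_mult_le_op_norm[OF A_diff[OF f gA] wV, of ?T]
    by (simp add: mult_op_eq left_diff_distrib)
  finally have *: "hnorm H w * hnorm H w \<le> op_norm H (vectors H) ?T * hnorm H w"
    by (simp add: power2_eq_square)
  have "0 \<le> op_norm H (vectors H) ?T"
    by (rule op_norm_nonneg[OF A_diff[OF f gA]]) (simp add: mult_op_eq left_diff_distrib)
  then have "hnorm H w \<le> op_norm H (vectors H) ?T"
    using * hnorm_nonneg[OF wV] by (cases "hnorm H w = 0") auto
  then show ?thesis by (simp add: w_def)
qed

text \<open>The vector \<open>v\<close> is the projection of \<open>y\<close> to $L = A[x]$; it lies in the defect space $N$ since
$\langle g a x, y \rangle = 0$ for $g \in J_E$ and $a \in A$. The space $N$ is invariant under the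
compression of $M_f^*$ to $L$, because $J_E$ is an ideal; so projecting $M_f^* v$ to $N$ or to $L$ gives
the same vector.\<close>

lemma functional_le_compression:
  assumes f: "f \<in> A" and x: "x \<in> vectors H" and y: "y \<in> vectors H"
    and vanish: "\<And>g. g \<in> vanishing_ideal A E \<Longrightarrow> inner_prod H (\<lambda>z. g z * x z) y = 0"
  obtains v where "v \<in> defect_space H A E (cyclic_space H A x)" "hnorm H v \<le> hnorm H y"
    "cmod (inner_prod H (\<lambda>z. f z * x z) y) \<le>
      hnorm H x * hnorm H (proj H (defect_space H A E (cyclic_space H A x)) (hadjoint H (mult_op H f) v))"
proof -
  let ?L = "cyclic_space H A x" and ?N = "defect_space H A E (cyclic_space H A x)"
  have L: "closed_subspace ?L" by (rule cyclic_closed[OF x])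
  have LV: "?L \<subseteq> vectors H" by (rule closed_subspaceD(1)[OF L])
  have N: "closed_subspace ?N" by (rule defect_space_closed[OF x])
  have NL: "?N \<subseteq> ?L" by (auto simp: defect_space_iff[OF LV])
  define v where "v = proj H ?L y"
  have vL: "v \<in> ?L" unfolding v_def by (rule proj_mem[OF L y])
  have vV: "v \<in> vectors H" using vL LV by auto
  have ipv: "inner_prod H u v = inner_prod H u y" if "u \<in> ?L" for u
    unfolding v_def by (rule proj_ip(2)[OF L y that])
  have gu0: "inner_prod H (\<lambda>z. g z * u z) v = 0" if g: "g \<in> vanishing_ideal A E" and u: "u \<in> ?L" for g u
  proof -
    have gA: "g \<in> A" using g vanishing_ideal_subset by auto
    have guL: "(\<lambda>z. g z * u z) \<in> ?L" by (rule cyclic_invariant[OF x gA u])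
    obtain a where uV: "u \<in> vectors H" and a: "\<And>n. a n \<in> A"
      and lim: "(\<lambda>n. hnorm H (\<lambda>z. a n z * x z - u z)) \<longlonglongrightarrow> 0"
      using u unfolding cyclic_space_seq[OF x order_refl] by auto
    have "(\<lambda>n. inner_prod H (\<lambda>z. g z * (a n z * x z)) y) \<longlonglongrightarrow> inner_prod H (\<lambda>z. g z * u z) y"
      by (rule tendsto_ip_left[OF _ _ y tendsto_mult_op[OF gA mult_mem[OF a x] uV lim]])
        (intro mult_mem gA a x uV)+
    moreover have "inner_prod H (\<lambda>z. g z * (a n z * x z)) y = 0" for n
      using vanish[OF vanishing_ideal_mult[OF a g], of n] by (simp add: mult_ac)
    ultimately show ?thesis using ipv[OF guL] by (simp add: LIMSEQ_const_iff)
  qed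
  have vN: "v \<in> ?N"
    unfolding defect_space_iff[OF LV]
  proof (intro conjI ballI vL)
    fix g u assume g: "g \<in> vanishing_ideal A E" and u: "u \<in> ?L"
    have gA: "g \<in> A" using g vanishing_ideal_subset by auto
    have uV: "u \<in> vectors H" using u LV by auto
    show "inner_prod H v (\<lambda>x. g x * u x) = 0"
      using gu0[OF g u] ip_cnj[OF mult_mem[OF gA uV] vV] by simp
  qed
  let ?a = "hadjoint H (mult_op H f) v"
  have aV: "?a \<in> vectors H" by (rule hadjoint_mult_mem[OF f vV])
  define q where "q = proj H ?L ?a"
  have qL: "q \<in> ?L" unfolding q_def by (rule proj_mem[OF L aV])
  have qV: "q \<in> vectors H" using qL LV by auto
  have qN: "q \<in> ?N"
    unfolding defect_space_iff[OF LV]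
  proof (intro conjI ballI qL)
    fix g u assume g: "g \<in> vanishing_ideal A E" and u: "u \<in> ?L"
    have gA: "g \<in> A" using g vanishing_ideal_subset by auto
    have guL: "(\<lambda>z. g z * u z) \<in> ?L" by (rule cyclic_invariant[OF x gA u])
    have guV: "(\<lambda>z. g z * u z) \<in> vectors H" using guL LV by auto
    have "inner_prod H (\<lambda>z. g z * u z) q = inner_prod H (\<lambda>z. f z * (g z * u z)) v"
      unfolding q_def proj_ip(2)[OF L aV guL] by (rule ip_hadjoint_mult[OF f guV vV])
    also have "\<dots> = 0"
      using gu0[OF vanishing_ideal_mult[OF f g] u] by (simp add: mult_ac)
    finally show "inner_prod H q (\<lambda>x. g x * u x) = 0"
      using ip_cnj[OF guV qV] by simp
  qed
  have "proj H ?N ?a = q"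
  proof (rule proj_eqI[OF N aV qN])
    fix u assume "u \<in> ?N"
    then show "inner_prod H (\<lambda>x. ?a x - q x) u = 0"
      unfolding q_def using NL by (intro proj_orth[OF L aV]) auto
  qed
  moreover have "cmod (inner_prod H (\<lambda>z. f z * x z) y) \<le> hnorm H x * hnorm H q"
  proof -
    have xL: "x \<in> ?L" by (rule cyclic_self[OF x])
    have "inner_prod H (\<lambda>z. f z * x z) y = inner_prod H (\<lambda>z. f z * x z) v"
      by (rule ipv[OF cyclic_invariant[OF x f xL], symmetric])
    also have "\<dots> = inner_prod H x ?a" by (rule ip_hadjoint_mult[OF f x vV, symmetric])
    also have "\<dots> = inner_prod H x q" unfolding q_def by (rule proj_ip(2)[OF L aV xL, symmetric])
    finally show ?thesis using Cauchy_Schwarz[OF x qV] by simp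
  qed
  moreover have "hnorm H v \<le> hnorm H y" unfolding v_def by (rule hnorm_proj_le[OF L y])
  ultimately show ?thesis using that[OF vN] by simp
qed

lemma vanishing_ideal_nonempty: "vanishing_ideal A E \<noteq> {}"
  using A_zero by (auto simp: vanishing_ideal_def)

text \<open>The distance formula follows from factorizations of functionals that vanish on the ideal and nearly
norm the class of \<open>f\<close>. The estimates from both sides agree as \<open>\<epsilon>\<close> tends to \<open>0\<close>.\<close>

theorem nevanlinna_pick_familyI:
  assumes k: "cyclic_kernels H A k"
    and factor: "\<And>E f \<epsilon>. \<lbrakk>finite E; E \<subseteq> points H; f \<in> A; \<epsilon> > 0\<rbrakk> \<Longrightarrow>
      \<exists>x\<in>vectors H. \<exists>y\<in>vectors H. hnorm H x \<le> 1 + \<epsilon> \<and> hnorm H y \<le> 1 + \<epsilon> \<and>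
        (\<forall>g\<in>vanishing_ideal A E. inner_prod H (\<lambda>z. g z * x z) y = 0) \<and>
        ideal_dist H A E f \<le> cmod (inner_prod H (\<lambda>z. f z * x z) y)"
  shows "nevanlinna_pick_family H A k"
  unfolding nevanlinna_pick_family_def
proof (intro conjI allI impI k)
  fix E f assume E: "finite E" "E \<subseteq> points H" and f: "f \<in> A"
  define d where "d = ideal_dist H A E f"
  define T where "T N v = proj H N (hadjoint H (mult_op H f) v)" for N v
  define nrm where "nrm L = op_norm H (defect_space H A E L) (T (defect_space H A E L))" for L
  have bound: "hnorm H (T (defect_space H A E (cyclic_space H A h)) v) \<le> d"
    if h: "h \<in> vectors H" and v: "v \<in> defect_space H A E (cyclic_space H A h)" "hnorm H v \<le> 1" for h v
    unfolding d_def ideal_dist_def T_def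
    by (rule cINF_greatest[OF vanishing_ideal_nonempty]) (rule compression_le_quotient_norm[OF h f _ v])
  have zero_N: "(\<lambda>_. 0) \<in> defect_space H A E (cyclic_space H A h)" if "h \<in> vectors H" for h
    by (rule closed_subspaceD(2)[OF defect_space_closed[OF that]])
  have nrm_le: "nrm (cyclic_space H A h) \<le> d" if h: "h \<in> vectors H" for h
    unfolding nrm_def op_norm_def
  proof (rule cSUP_least)
    show "{v \<in> defect_space H A E (cyclic_space H A h). hnorm H v \<le> 1} \<noteq> {}"
      using zero_N[OF h] by (auto simp: hnorm_zero)
  qed (use bound[OF h] in auto)
  have le_nrm: "hnorm H (T (defect_space H A E (cyclic_space H A h)) v) \<le> nrm (cyclic_space H A h)"
    if h: "h \<in> vectors H" and v: "v \<in> defect_space H A E (cyclic_space H A h)" "hnorm H v \<le> 1" for h v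
    unfolding nrm_def op_norm_def
    by (rule cSUP_upper[OF _ bdd_aboveI2[of _ _ d]]) (use v bound[OF h] in auto)
  have bdd: "bdd_above (nrm ` CycLat H A)"
    by (rule bdd_aboveI2[of _ _ d]) (auto simp: CycLat_def nrm_le)
  define s where "s = (SUP L\<in>CycLat H A. nrm L)"
  have "s \<le> d"
    unfolding s_def by (rule cSUP_least) (use zero_mem nrm_le in \<open>auto simp: CycLat_def\<close>)
  have nrm_s: "nrm (cyclic_space H A h) \<le> s" if "h \<in> vectors H" for h
    unfolding s_def by (rule cSUP_upper[OF _ bdd]) (use that in \<open>auto simp: CycLat_def\<close>)
  have "d \<le> (1 + \<epsilon>) * (1 + \<epsilon>) * s" if \<epsilon>: "\<epsilon> > 0" for \<epsilon>
  proof -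
    obtain x y where xy: "x \<in> vectors H" "y \<in> vectors H" "hnorm H x \<le> 1 + \<epsilon>" "hnorm H y \<le> 1 + \<epsilon>"
      and van: "\<And>g. g \<in> vanishing_ideal A E \<Longrightarrow> inner_prod H (\<lambda>z. g z * x z) y = 0"
      and d: "d \<le> cmod (inner_prod H (\<lambda>z. f z * x z) y)"
      using factor[OF E f \<epsilon>] unfolding d_def by auto
    \<comment> \<open>shrink \<open>y\<close> so that its projection is admissible in the operator norm\<close>
    define c where "c = complex_of_real (1 / (1 + \<epsilon>))"
    have cmc: "cmod c = 1 / (1 + \<epsilon>)" unfolding c_def norm_of_real using \<epsilon> by simp
    define y' where "y' = (\<lambda>z. c * y z)"
    have y'V: "y' \<in> vectors H" unfolding y'_def by (rule scale_mem[OF xy(2)])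
    have ipy': "cmod (inner_prod H u y') = cmod (inner_prod H u y) / (1 + \<epsilon>)" if "u \<in> vectors H" for u
      unfolding y'_def ip_scale_right[OF xy(2) that] by (simp add: norm_mult cmc)
    have "inner_prod H (\<lambda>z. g z * x z) y' = 0" if "g \<in> vanishing_ideal A E" for g
      using ipy'[OF mult_mem[OF _ xy(1)], of g] van[OF that] that vanishing_ideal_subset by auto
    from functional_le_compression[OF f xy(1) y'V this]
    obtain v where v: "v \<in> defect_space H A E (cyclic_space H A x)" "hnorm H v \<le> hnorm H y'"
      and le: "cmod (inner_prod H (\<lambda>z. f z * x z) y') \<le>
        hnorm H x * hnorm H (T (defect_space H A E (cyclic_space H A x)) v)"
      unfolding T_def by blast
    have "hnorm H y' \<le> 1"
      unfolding y'_def hnorm_scale[OF xy(2)] cmc using xy(4) \<epsilon> by (simp add: field_simps)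
    then have "hnorm H v \<le> 1" using v(2) by simp
    from le_nrm[OF xy(1) v(1) this] nrm_s[OF xy(1)]
    have Ts: "hnorm H (T (defect_space H A E (cyclic_space H A x)) v) \<le> s" by simp
    have "T (defect_space H A E (cyclic_space H A x)) v \<in> vectors H"
      using proj_mem[OF defect_space_closed[OF xy(1)] hadjoint_mult_mem[OF f], of v E] v(1)
        closed_subspaceD(1)[OF defect_space_closed[OF xy(1)], of E] by (auto simp: T_def)
    then have Tnn: "0 \<le> hnorm H (T (defect_space H A E (cyclic_space H A x)) v)" by (rule hnorm_nonneg)
    have s0: "0 \<le> s" using Tnn Ts by simp
    have "d \<le> (1 + \<epsilon>) * cmod (inner_prod H (\<lambda>z. f z * x z) y')"
      using d \<epsilon> unfolding ipy'[OF mult_mem[OF f xy(1)]] by simp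
    also have "\<dots> \<le> (1 + \<epsilon>) * (hnorm H x * hnorm H (T (defect_space H A E (cyclic_space H A x)) v))"
      using le \<epsilon> by (intro mult_left_mono) auto
    also have "\<dots> \<le> (1 + \<epsilon>) * ((1 + \<epsilon>) * s)"
      using xy(3) Ts Tnn \<epsilon> hnorm_nonneg[OF xy(1)]
      by (intro mult_left_mono mult_mono') auto
    finally show ?thesis by simp
  qed
  moreover have "((\<lambda>\<epsilon>. (1 + \<epsilon>) * (1 + \<epsilon>) * s) \<longlongrightarrow> (1 + 0) * (1 + 0) * s) (at_right 0)"
    by (intro tendsto_intros)
  ultimately have "d \<le> (1 + 0) * (1 + 0) * s"
    by (intro tendsto_lowerbound) (auto simp: eventually_at_right_less trivial_limit_at_right_real
        intro: eventually_mono[OF eventually_at_right_less])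
  then have "d = s" using \<open>s \<le> d\<close> by simp
  then show "ideal_dist H A E f =
      (SUP L\<in>CycLat H A. let N = defect_space H A E L
        in op_norm H N (\<lambda>v. proj H N (hadjoint H (mult_op H f) v)))"
    unfolding d_def s_def nrm_def T_def Let_def .
qed

end

section \<open>Sublinear functionals on finitely supported functions\<close>

definition sublinear :: "(('x \<Rightarrow> complex) \<Rightarrow> real) \<Rightarrow> bool" where
  "sublinear p \<longleftrightarrow> (\<forall>v w. p (\<lambda>x. v x + w x) \<le> p v + p w) \<and>
     (\<forall>c v. c > 0 \<longrightarrow> p (\<lambda>x. of_real c * v x) = c * p v)"

lemma sublinear_add: "sublinear p \<Longrightarrow> p (\<lambda>x. v x + w x) \<le> p v + p w"
  and sublinear_scale: "sublinear p \<Longrightarrow> c > 0 \<Longrightarrow> p (\<lambda>x. of_real c * v x) = c * p v"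
  by (simp_all add: sublinear_def)

lemma sublinearI:
  assumes add: "\<And>v w. p (\<lambda>x. v x + w x) \<le> p v + p w"
    and scale: "\<And>c v. c > 0 \<Longrightarrow> p (\<lambda>x. of_real c * v x) \<le> c * p v"
  shows "sublinear p"
proof -
  have "c * p v \<le> p (\<lambda>x. of_real c * v x)" if c: "c > 0" for c v
  proof -
    have "p (\<lambda>x. of_real (1 / c) * (of_real c * v x)) \<le> 1 / c * p (\<lambda>x. of_real c * v x)"
      by (rule scale) (use c in simp)
    moreover have "(\<lambda>x. of_real (1 / c) * (of_real c * v x)) = v" using c by auto
    ultimately show ?thesis using c by (simp add: field_simps)
  qed
  then show ?thesis using add scale by (auto simp: sublinear_def intro: antisym)
qed

lemma sublinear_zero:
  assumes "sublinear p" shows "p (\<lambda>_. 0) = 0"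
  using sublinear_scale[OF assms, of 2 "\<lambda>_. 0"] by simp

lemma sublinear_minus:
  assumes "sublinear p" shows "0 \<le> p v + p (\<lambda>x. - v x)"
  using sublinear_add[OF assms, of v "\<lambda>x. - v x"] by (simp add: sublinear_zero[OF assms])

text \<open>The one-dimensional step of the Hahn-Banach theorem, carried out on the sublinear functional instead
of extending a linear one: $q(x) = \inf_{t \ge 0} (p(x + t v) - t\, p(v))$. Since $q(v) + q(-v) \ge 0$
always holds, the last conclusion makes $q$ linear along $v$, with $q(v) = p(v)$.\<close>

lemma sublinear_linearize:
  assumes p: "sublinear p"
  shows "\<exists>q. sublinear q \<and> (\<forall>x. q x \<le> p x) \<and> q (\<lambda>x. - v x) \<le> - p v"
proof -
  define F where "F x t = p (\<lambda>z. x z + of_real t * v z) - t * p v" for x and t :: real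
  define q where "q x = (INF t\<in>{0..}. F x t)" for x
  have lower: "- p (\<lambda>z. - x z) \<le> F x t" if t: "t \<ge> 0" for x t
  proof -
    have "p (\<lambda>z. of_real t * v z) = t * p v"
      using sublinear_scale[OF p, of t v] t sublinear_zero[OF p] by (cases "t = 0") auto
    moreover have "p (\<lambda>z. of_real t * v z) \<le> p (\<lambda>z. x z + of_real t * v z) + p (\<lambda>z. - x z)"
      using sublinear_add[OF p, of "\<lambda>z. x z + of_real t * v z" "\<lambda>z. - x z"] by simp
    ultimately show ?thesis by (simp add: F_def)
  qed
  have q_le: "q x \<le> F x t" if "t \<ge> 0" for x t
    unfolding q_def by (rule cINF_lower[OF bdd_belowI2[of _ "- p (\<lambda>z. - x z)"]]) (use lower that in auto)
  have q_ge: "m \<le> q x" if "\<And>t. t \<ge> 0 \<Longrightarrow> m \<le> F x t" for x m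
    unfolding q_def by (rule cINF_greatest) (use that in auto)
  have add: "q (\<lambda>z. x z + y z) \<le> q x + q y" for x y
  proof -
    have *: "q (\<lambda>z. x z + y z) \<le> F x s + F y t" if "s \<ge> 0" "t \<ge> 0" for s t
    proof -
      have "p (\<lambda>z. (x z + y z) + of_real (s + t) * v z) \<le>
          p (\<lambda>z. x z + of_real s * v z) + p (\<lambda>z. y z + of_real t * v z)"
        using sublinear_add[OF p, of "\<lambda>z. x z + of_real s * v z" "\<lambda>z. y z + of_real t * v z"]
        by (simp add: algebra_simps)
      then show ?thesis
        using q_le[of "s + t" "\<lambda>z. x z + y z"] that by (simp add: F_def algebra_simps)
    qed
    have "q (\<lambda>z. x z + y z) - F y t \<le> q x" if "t \<ge> 0" for t
      by (rule q_ge) (use *[OF _ that] in \<open>simp add: algebra_simps\<close>)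
    then have "q (\<lambda>z. x z + y z) - q x \<le> F y t" if "t \<ge> 0" for t
      using that by (simp add: algebra_simps)
    then have "q (\<lambda>z. x z + y z) - q x \<le> q y" by (rule q_ge)
    then show ?thesis by simp
  qed
  have scale: "q (\<lambda>z. of_real c * x z) \<le> c * q x" if c: "c > 0" for c x
  proof -
    have "q (\<lambda>z. of_real c * x z) / c \<le> F x t" if t: "t \<ge> 0" for t
    proof -
      have "p (\<lambda>z. of_real c * x z + of_real (c * t) * v z) = c * p (\<lambda>z. x z + of_real t * v z)"
        using sublinear_scale[OF p c, of "\<lambda>z. x z + of_real t * v z"] by (simp add: algebra_simps)
      then have "F (\<lambda>z. of_real c * x z) (c * t) = c * F x t" by (simp add: F_def algebra_simps)
      then show ?thesis
        using q_le[of "c * t" "\<lambda>z. of_real c * x z"] c t by (simp add: field_simps)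
    qed
    then have "q (\<lambda>z. of_real c * x z) / c \<le> q x" by (rule q_ge)
    then show ?thesis using c by (simp add: field_simps)
  qed
  from add scale have "sublinear q" by (rule sublinearI)
  moreover have "q x \<le> p x" for x using q_le[of 0 x] by (simp add: F_def)
  moreover have "q (\<lambda>x. - v x) \<le> - p v"
    using q_le[of 1 "\<lambda>x. - v x"] by (simp add: F_def sublinear_zero[OF p])
  ultimately show ?thesis by blast
qed

text \<open>Linearity along a vector persists when a sublinear functional is replaced by a smaller one, so the
vectors can be treated one after the other.\<close>

lemma sublinear_linearize_list:
  assumes "sublinear p"
  shows "\<exists>q. sublinear q \<and> (\<forall>x. q x \<le> p x) \<and> (\<forall>v\<in>set vs. q v + q (\<lambda>x. - v x) = 0)"
  using assms
proof (induction vs arbitrary: p)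
  case Nil
  then show ?case by auto
next
  case (Cons v vs)
  obtain p' where p': "sublinear p'" "\<And>x. p' x \<le> p x" "p' (\<lambda>x. - v x) \<le> - p v"
    using sublinear_linearize[OF Cons.prems, of v] by auto
  obtain q where q: "sublinear q" "\<And>x. q x \<le> p' x" "\<And>v. v \<in> set vs \<Longrightarrow> q v + q (\<lambda>x. - v x) = 0"
    using Cons.IH[OF p'(1)] by auto
  have "q v + q (\<lambda>x. - v x) = 0"
    using sublinear_minus[OF q(1), of v] q(2)[of v] q(2)[of "\<lambda>x. - v x"] p'(2)[of v] p'(3) by linarith
  moreover have "q x \<le> p x" for x using q(2)[of x] p'(2)[of x] by linarith
  ultimately show ?case using q(1,3) by (intro exI[of _ q]) auto
qed

text \<open>The functions that vanish off the finite set $Z$ are spanned over the reals by the point masses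
and their multiples by $\mathrm{i}$. Once $p$ has been made linear along all of these it is the real
part of a complex linear functional. Linearizing along \<open>v0\<close> first keeps the value there.\<close>

lemma sublinear_dominates_linear:
  fixes p :: "('x \<Rightarrow> complex) \<Rightarrow> real"
  assumes p: "sublinear p" and Z: "finite Z"
  shows "\<exists>d. (\<forall>v. Re (\<Sum>x\<in>Z. d x * v x) \<le> p (\<lambda>x. if x \<in> Z then v x else 0)) \<and>
    Re (\<Sum>x\<in>Z. d x * v0 x) = p (\<lambda>x. if x \<in> Z then v0 x else 0)"
proof -
  let ?r = "\<lambda>Z v x. if x \<in> Z then v x else (0::complex)"
  obtain p' where p': "sublinear p'" "\<And>x. p' x \<le> p x" "p' (\<lambda>x. - ?r Z v0 x) \<le> - p (?r Z v0)"
    using sublinear_linearize[OF p, of "?r Z v0"] by auto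
  define e :: "complex \<Rightarrow> 'x \<Rightarrow> 'x \<Rightarrow> complex" where "e c z = (\<lambda>x. if x = z then c else 0)" for c z
  obtain zs where zs: "set zs = Z" using finite_list[OF Z] by auto
  obtain q where q: "sublinear q" "\<And>x. q x \<le> p' x"
    and qlin: "\<And>v. v \<in> set (map (e 1) zs @ map (e \<i>) zs) \<Longrightarrow> q v + q (\<lambda>x. - v x) = 0"
    using sublinear_linearize_list[OF p'(1), of "map (e 1) zs @ map (e \<i>) zs"] by auto
  have lin: "q (\<lambda>x. w x + of_real t * v x) \<le> q w + t * q v" if v: "q v + q (\<lambda>x. - v x) = 0" for v w t
  proof -
    have "q (\<lambda>x. of_real t * v x) = t * q v"
    proof (cases t "0 :: real" rule: linorder_cases)
      case less
      have "q (\<lambda>x. of_real (- t) * (- v x)) = - t * q (\<lambda>x. - v x)"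
        by (rule sublinear_scale[OF q(1)]) (use less in simp)
      also have "q (\<lambda>x. - v x) = - q v" using v by simp
      finally show ?thesis by simp
    qed (use sublinear_scale[OF q(1)] sublinear_zero[OF q(1)] in auto)
    then show ?thesis using sublinear_add[OF q(1), of w "\<lambda>x. of_real t * v x"] by simp
  qed
  define d where "d z = of_real (q (e 1 z)) - \<i> * of_real (q (e \<i> z))" for z
  have le: "q (?r Y v) \<le> Re (\<Sum>x\<in>Y. d x * v x)" if "Y \<subseteq> Z" for Y v
    using finite_subset[OF that Z] that
  proof (induction Y rule: finite_induct)
    case empty
    then show ?case using sublinear_zero[OF q(1)] by simp
  next
    case (insert z Y)
    have mem: "e 1 z \<in> set (map (e 1) zs @ map (e \<i>) zs)" "e \<i> z \<in> set (map (e 1) zs @ map (e \<i>) zs)"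
      using insert.prems zs by auto
    have "?r (insert z Y) v = (\<lambda>x. (?r Y v x + of_real (Re (v z)) * e 1 z x) + of_real (Im (v z)) * e \<i> z x)"
      using insert.hyps by (auto simp: e_def complex_eq_iff)
    then have "q (?r (insert z Y) v) \<le> q (?r Y v) + Re (v z) * q (e 1 z) + Im (v z) * q (e \<i> z)"
      using lin[OF qlin[OF mem(2)], of "\<lambda>x. ?r Y v x + of_real (Re (v z)) * e 1 z x" "Im (v z)"]
        lin[OF qlin[OF mem(1)], of "?r Y v" "Re (v z)"] by simp
    also have "\<dots> \<le> Re (\<Sum>x\<in>Y. d x * v x) + Re (d z * v z)"
      using insert by (simp add: d_def)
    finally show ?case using insert.hyps by simp
  qed
  have eq: "q (?r Z v) = Re (\<Sum>x\<in>Z. d x * v x)" for v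
  proof (rule antisym[OF le[OF order_refl]])
    have "0 \<le> q (?r Z v) + q (\<lambda>x. - ?r Z v x)" by (rule sublinear_minus[OF q(1)])
    moreover have "(\<lambda>x. - ?r Z v x) = ?r Z (\<lambda>x. - v x)" by auto
    ultimately show "Re (\<Sum>x\<in>Z. d x * v x) \<le> q (?r Z v)"
      using le[OF order_refl, of "\<lambda>x. - v x"] by (simp add: sum_negf)
  qed
  show ?thesis
  proof (intro exI[of _ d] conjI allI)
    show "Re (\<Sum>x\<in>Z. d x * v x) \<le> p (?r Z v)" for v
      using eq[of v] q(2)[of "?r Z v"] p'(2)[of "?r Z v"] by linarith
    have "(\<lambda>x. - ?r Z v0 x) = ?r Z (\<lambda>x. - v0 x)" by auto
    then have "- Re (\<Sum>x\<in>Z. d x * v0 x) \<le> - p (?r Z v0)"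
      using eq[of "\<lambda>x. - v0 x"] q(2)[of "?r Z (\<lambda>x. - v0 x)"] p'(3) by (simp add: sum_negf)
    moreover have "Re (\<Sum>x\<in>Z. d x * v0 x) \<le> p (?r Z v0)"
      using eq[of v0] q(2)[of "?r Z v0"] p'(2)[of "?r Z v0"] by linarith
    ultimately show "Re (\<Sum>x\<in>Z. d x * v0 x) = p (?r Z v0)" by simp
  qed
qed

lemma mult_cnj_sgn: "w * cnj (sgn w) = complex_of_real (cmod w)"
proof (cases "w = 0")
  case False
  have "w * cnj (sgn w) = w * cnj w / of_real (cmod w)" by (simp add: sgn_eq)
  also have "w * cnj w = of_real (cmod w) * of_real (cmod w)"
    by (simp add: complex_norm_square[symmetric] power2_eq_square)
  finally show ?thesis using False by simp
qed simp

text \<open>Hahn-Banach for the sum of two seminorms, the supremum over $Z$ with weight \<open>\<delta>\<close> and the supremum over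
$D$ with weight \<open>\<eta>\<close>: a functional dominated by the sum is a combination of evaluations on $Z$ of norm
at most \<open>\<delta>\<close> plus a functional of norm at most \<open>\<eta>\<close>. The function \<open>f0\<close> and the number \<open>s\<close> allow one to ask in
addition for a large value at a given function.\<close>

lemma functional_near_point_evaluations:
  fixes A :: "('x \<Rightarrow> complex) set" and \<psi> :: "('x \<Rightarrow> complex) \<Rightarrow> complex"
  assumes A0: "(\<lambda>_. 0) \<in> A"
    and A_add: "\<And>f g. \<lbrakk>f \<in> A; g \<in> A\<rbrakk> \<Longrightarrow> (\<lambda>x. f x + g x) \<in> A"
    and A_scale: "\<And>c f. f \<in> A \<Longrightarrow> (\<lambda>x. c * f x) \<in> A"
    and \<psi>_add: "\<And>f g. \<lbrakk>f \<in> A; g \<in> A\<rbrakk> \<Longrightarrow> \<psi> (\<lambda>x. f x + g x) = \<psi> f + \<psi> g"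
    and \<psi>_scale: "\<And>c f. f \<in> A \<Longrightarrow> \<psi> (\<lambda>x. c * f x) = c * \<psi> f"
    and Z: "finite Z" and \<delta>: "\<delta> \<ge> 0" and \<eta>: "\<eta> \<ge> 0"
    and dom: "\<And>f m t. \<lbrakk>f \<in> A; 0 \<le> m; 0 \<le> t; \<forall>x\<in>D. cmod (f x) \<le> t; \<forall>x\<in>Z. cmod (f x) \<le> m\<rbrakk> \<Longrightarrow>
      cmod (\<psi> f) \<le> \<delta> * m + \<eta> * t"
    and s: "\<And>f m t. \<lbrakk>f \<in> A; 0 \<le> m; 0 \<le> t; \<forall>x\<in>D. cmod (f x) \<le> t; \<forall>x\<in>Z. cmod (f0 x - f x) \<le> m\<rbrakk> \<Longrightarrow>
      s \<le> \<delta> * m + \<eta> * t + Re (\<psi> f)"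
  shows "\<exists>d. (\<Sum>x\<in>Z. cmod (d x)) \<le> \<delta> \<and> s \<le> Re (\<Sum>x\<in>Z. d x * f0 x) \<and>
    (\<forall>f\<in>A. \<forall>t\<ge>0. (\<forall>x\<in>D. cmod (f x) \<le> t) \<longrightarrow> cmod ((\<Sum>x\<in>Z. d x * f x) - \<psi> f) \<le> \<eta> * t)"
proof -
  define P where "P v m t f \<longleftrightarrow> f \<in> A \<and> 0 \<le> m \<and> 0 \<le> t \<and> (\<forall>x\<in>D. cmod (f x) \<le> t) \<and>
    (\<forall>x\<in>Z. cmod (v x - f x) \<le> m)" for v f :: "'x \<Rightarrow> complex" and m t :: real
  \<comment> \<open>\<open>p\<close> is the largest sublinear functional below \<open>\<delta>\<close> times the supremum over \<open>Z\<close>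
    that is at most \<open>Re \<psi>\<close> plus \<open>\<eta>\<close> times the supremum over \<open>D\<close> on the algebra\<close>
  define S where "S v = {\<delta> * m + \<eta> * t + Re (\<psi> f) | m t f. P v m t f}" for v
  define p where "p v = Inf (S v)" for v
  define M where "M v = (\<Sum>x\<in>Z. cmod (v x))" for v :: "'x \<Rightarrow> complex"
  have M: "cmod (v x) \<le> M v" if "x \<in> Z" for v x
    unfolding M_def by (rule member_le_sum[OF that]) (use Z in auto)
  have M0: "0 \<le> M v" for v unfolding M_def by (rule sum_nonneg) simp
  have \<psi>0: "\<psi> (\<lambda>_. 0) = 0" using \<psi>_scale[OF A0, of 0] by simp
  have S_ne: "S v \<noteq> {}" for v
  proof -
    have "P v (M v) 0 (\<lambda>_. 0)" using A0 M[of _ v] M0 by (simp add: P_def)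
    then show ?thesis unfolding S_def by blast
  qed
  have lower: "- \<delta> * M v \<le> a" if "a \<in> S v" for a v
  proof -
    obtain m t f where a: "a = \<delta> * m + \<eta> * t + Re (\<psi> f)" and P: "P v m t f"
      using \<open>a \<in> S v\<close> unfolding S_def by blast
    have "cmod (f x) \<le> m + M v" if "x \<in> Z" for x
    proof -
      have "cmod (f x) \<le> cmod (v x) + cmod (v x - f x)"
        using norm_triangle_ineq4[of "v x" "v x - f x"] by simp
      then show ?thesis using M[OF that, of v] P that by (fastforce simp: P_def)
    qed
    then have "cmod (\<psi> f) \<le> \<delta> * (m + M v) + \<eta> * t"
      using P M0[of v] by (intro dom) (auto simp: P_def)
    then have "- (\<delta> * (m + M v) + \<eta> * t) \<le> Re (\<psi> f)"
      using abs_Re_le_cmod[of "\<psi> f"] by linarith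
    then show ?thesis unfolding a by (simp add: algebra_simps)
  qed
  have p_le: "p v \<le> \<delta> * m + \<eta> * t + Re (\<psi> f)" if "P v m t f" for v m t f
    unfolding p_def by (rule cInf_lower[OF _ bdd_belowI[OF lower]]) (use that in \<open>auto simp: S_def\<close>)
  have p_ge: "c \<le> p v" if "\<And>m t f. P v m t f \<Longrightarrow> c \<le> \<delta> * m + \<eta> * t + Re (\<psi> f)" for c v
    unfolding p_def by (rule cInf_greatest[OF S_ne]) (use that in \<open>auto simp: S_def\<close>)
  have add: "p (\<lambda>x. v x + w x) \<le> p v + p w" for v w
  proof -
    have *: "p (\<lambda>x. v x + w x) \<le> (\<delta> * m + \<eta> * t + Re (\<psi> f)) + (\<delta> * m' + \<eta> * t' + Re (\<psi> g))"
      if "P v m t f" "P w m' t' g" for m t f m' t' g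
    proof -
      have "P (\<lambda>x. v x + w x) (m + m') (t + t') (\<lambda>x. f x + g x)"
        using that A_add unfolding P_def
        by (auto intro!: order_trans[OF norm_triangle_ineq] order_trans[OF norm_diff_triangle_ineq] add_mono)
      from p_le[OF this] show ?thesis
        using that \<psi>_add[of f g] by (simp add: P_def algebra_simps)
    qed
    have "p (\<lambda>x. v x + w x) - (\<delta> * m' + \<eta> * t' + Re (\<psi> g)) \<le> p v" if "P w m' t' g" for m' t' g
      by (rule p_ge) (use *[OF _ that] in \<open>simp add: algebra_simps\<close>)
    then have "p (\<lambda>x. v x + w x) - p v \<le> p w"
      by (intro p_ge) (simp add: algebra_simps)
    then show ?thesis by simp
  qed
  have scale: "p (\<lambda>x. of_real c * v x) \<le> c * p v" if c: "c > 0" for c v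
  proof -
    have "p (\<lambda>x. of_real c * v x) / c \<le> \<delta> * m + \<eta> * t + Re (\<psi> f)" if P: "P v m t f" for m t f
    proof -
      have "P (\<lambda>x. of_real c * v x) (c * m) (c * t) (\<lambda>x. of_real c * f x)"
        using P c A_scale unfolding P_def by (auto simp: norm_mult simp flip: right_diff_distrib)
      from p_le[OF this] show ?thesis
        using P c \<psi>_scale[of f "of_real c"] by (simp add: P_def field_simps)
    qed
    then have "p (\<lambda>x. of_real c * v x) / c \<le> p v" by (rule p_ge)
    then show ?thesis using c by (simp add: field_simps)
  qed
  from add scale have sub: "sublinear p" by (rule sublinearI)
  have restrict: "p (\<lambda>x. if x \<in> Z then v x else 0) = p v" for v
    unfolding p_def S_def P_def by simp
  obtain d where d: "\<And>v. Re (\<Sum>x\<in>Z. d x * v x) \<le> p v" and d0: "Re (\<Sum>x\<in>Z. d x * f0 x) = p f0"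
    using sublinear_dominates_linear[OF sub Z, of f0] unfolding restrict by auto
  have "(\<Sum>x\<in>Z. cmod (d x)) \<le> \<delta>"
  proof -
    have "(\<Sum>x\<in>Z. cmod (d x)) = Re (\<Sum>x\<in>Z. d x * cnj (sgn (d x)))"
      by (simp only: mult_cnj_sgn Re_sum Re_complex_of_real)
    also have "\<dots> \<le> p (\<lambda>x. cnj (sgn (d x)))" by (rule d)
    also have "\<dots> \<le> \<delta> * 1 + \<eta> * 0 + Re (\<psi> (\<lambda>_. 0))"
      by (rule p_le) (use A0 in \<open>simp add: P_def norm_sgn\<close>)
    finally show ?thesis by (simp add: \<psi>0)
  qed
  moreover have "s \<le> Re (\<Sum>x\<in>Z. d x * f0 x)"
    unfolding d0 by (rule p_ge) (use s in \<open>auto simp: P_def\<close>)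
  moreover have "cmod ((\<Sum>x\<in>Z. d x * f x) - \<psi> f) \<le> \<eta> * t"
    if f: "f \<in> A" and t: "t \<ge> 0" "\<forall>x\<in>D. cmod (f x) \<le> t" for f t
  proof -
    define w where "w = (\<Sum>x\<in>Z. d x * f x) - \<psi> f"
    define c where "c = cnj (sgn w)"
    have c1: "cmod c \<le> 1" by (simp add: c_def norm_sgn)
    have "Re (\<Sum>x\<in>Z. d x * (c * f x)) \<le> \<delta> * 0 + \<eta> * t + Re (\<psi> (\<lambda>x. c * f x))"
    proof (rule order_trans[OF d p_le])
      have "cmod (c * f x) \<le> t" if "x \<in> D" for x
        using mult_mono[OF c1, of "cmod (f x)" t] t that by (simp add: norm_mult)
      then show "P (\<lambda>x. c * f x) 0 t (\<lambda>x. c * f x)" using f t A_scale by (simp add: P_def)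
    qed
    then have "Re (c * w) \<le> \<eta> * t"
      by (simp add: w_def \<psi>_scale[OF f] algebra_simps sum_distrib_left)
    moreover have "c * w = of_real (cmod w)"
      using mult_cnj_sgn[of w] by (simp only: c_def mult.commute)
    ultimately show ?thesis unfolding w_def[symmetric] by simp
  qed
  ultimately show ?thesis by blast
qed

section \<open>Square integrable functions\<close>

abbreviation L2_space :: "complex measure \<Rightarrow> complex function_space" where
  "L2_space \<mu> \<equiv> \<lparr>points = space \<mu>, vectors = L2 \<mu>, inner_prod = L2_inner \<mu>\<rparr>"

lemma L2_I:
  "\<lbrakk>f \<in> borel_measurable \<mu>; integrable \<mu> (\<lambda>z. (cmod (f z))\<^sup>2)\<rbrakk> \<Longrightarrow> f \<in> L2 \<mu>"
  by (simp add: L2_def)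

lemma L2_D:
  assumes "f \<in> L2 \<mu>"
  shows "f \<in> borel_measurable \<mu>" "integrable \<mu> (\<lambda>z. (cmod (f z))\<^sup>2)"
  using assms by (simp_all add: L2_def)

lemma L2_dominated:
  assumes f: "f \<in> borel_measurable \<mu>" and g: "g \<in> L2 \<mu>" and C: "0 \<le> C"
    and le: "\<And>z. z \<in> space \<mu> \<Longrightarrow> cmod (f z) \<le> C * cmod (g z)"
  shows "f \<in> L2 \<mu>"
proof (rule L2_I[OF f])
  show "integrable \<mu> (\<lambda>z. (cmod (f z))\<^sup>2)"
  proof (rule Bochner_Integration.integrable_bound)
    show "integrable \<mu> (\<lambda>z. C\<^sup>2 * (cmod (g z))\<^sup>2)" using L2_D(2)[OF g] by simp
    show "AE z in \<mu>. norm ((cmod (f z))\<^sup>2) \<le> norm (C\<^sup>2 * (cmod (g z))\<^sup>2)"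
      using le power_mono[OF le norm_ge_zero, of _ 2] by (intro AE_I2) (simp add: power_mult_distrib)
  qed (use f in measurable)
qed

lemma L2_integrable_mult:
  assumes f: "f \<in> L2 \<mu>" and g: "g \<in> L2 \<mu>"
  shows "integrable \<mu> (\<lambda>z. f z * cnj (g z))"
proof (rule Bochner_Integration.integrable_bound)
  show "integrable \<mu> (\<lambda>z. (cmod (f z))\<^sup>2 + (cmod (g z))\<^sup>2)"
    using L2_D(2)[OF f] L2_D(2)[OF g] by simp
  have "a * b \<le> a\<^sup>2 + b\<^sup>2" for a b :: real
    using sum_squares_bound[of a b] zero_le_power2[of a] zero_le_power2[of b] by linarith
  then show "AE z in \<mu>. norm (f z * cnj (g z)) \<le> norm ((cmod (f z))\<^sup>2 + (cmod (g z))\<^sup>2)"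
    by (intro AE_I2) (simp add: norm_mult)
  have "(\<lambda>z. cnj (g z)) \<in> borel_measurable \<mu>"
    by (rule measurable_compose[OF L2_D(1)[OF g] borel_measurable_continuous_onI])
      (intro continuous_intros)
  then show "(\<lambda>z. f z * cnj (g z)) \<in> borel_measurable \<mu>"
    using L2_D(1)[OF f] by (intro borel_measurable_times)
qed

lemma L2_inner_self: "L2_inner \<mu> f f = of_real (LINT z|\<mu>. (cmod (f z))\<^sup>2)"
proof -
  have "L2_inner \<mu> f f = (LINT z|\<mu>. of_real ((cmod (f z))\<^sup>2))"
    unfolding L2_inner_def by (simp only: complex_norm_square)
  then show ?thesis by (simp only: integral_complex_of_real)
qed

lemma hnorm_eq_L2_norm: "inner_prod H = L2_inner \<mu> \<Longrightarrow> hnorm H f = L2_norm \<mu> f"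
  by (simp add: hnorm_def L2_norm_def L2_inner_self)

interpretation L2: semi_inner_space "L2_space \<mu>" for \<mu>
proof
  show "(\<lambda>_. 0) \<in> vectors (L2_space \<mu>)" by (simp add: L2_def)
next
  fix a c assume a: "a \<in> vectors (L2_space \<mu>)"
  then show "(\<lambda>x. c * a x) \<in> vectors (L2_space \<mu>)"
    using L2_dominated[of "\<lambda>x. c * a x" \<mu> a "cmod c"] L2_D(1)[of a \<mu>] by (simp add: norm_mult)
  show "0 \<le> Re (inner_prod (L2_space \<mu>) a a)"
    by (simp add: L2_inner_self)
  fix b assume b: "b \<in> vectors (L2_space \<mu>)"
  show "(\<lambda>x. a x + b x) \<in> vectors (L2_space \<mu>)"
  proof -
    have le: "(cmod (x + y))\<^sup>2 \<le> 2 * (cmod x)\<^sup>2 + 2 * (cmod y)\<^sup>2" for x y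
    proof -
      have "(cmod (x + y))\<^sup>2 \<le> (cmod x + cmod y)\<^sup>2"
        by (rule power_mono[OF norm_triangle_ineq]) simp
      also have "\<dots> \<le> 2 * (cmod x)\<^sup>2 + 2 * (cmod y)\<^sup>2"
        using sum_squares_bound[of "cmod x" "cmod y"] by (simp add: power2_sum)
      finally show ?thesis .
    qed
    have m: "a \<in> borel_measurable \<mu>" "b \<in> borel_measurable \<mu>" using a b L2_D by auto
    have "integrable \<mu> (\<lambda>z. (cmod (a z + b z))\<^sup>2)"
    proof (rule Bochner_Integration.integrable_bound)
      show "integrable \<mu> (\<lambda>z. 2 * (cmod (a z))\<^sup>2 + 2 * (cmod (b z))\<^sup>2)"
        using L2_D(2)[of a \<mu>] L2_D(2)[of b \<mu>] a b by simp
    qed (use m le in \<open>auto intro!: AE_I2\<close>)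
    then show ?thesis using m by (simp add: L2_def)
  qed
  have ab: "integrable \<mu> (\<lambda>z. a z * cnj (b z))" using a b by (simp add: L2_integrable_mult)
  show "inner_prod (L2_space \<mu>) (\<lambda>x. c * a x) b = c * inner_prod (L2_space \<mu>) a b"
    by (simp add: L2_inner_def mult.assoc)
  show "cnj (inner_prod (L2_space \<mu>) a b) = inner_prod (L2_space \<mu>) b a"
    unfolding function_space.simps L2_inner_def Bochner_Integration.integral_cnj[symmetric]
    by (simp only: complex_cnj_mult complex_cnj_cnj mult.commute)
  fix u assume u: "u \<in> vectors (L2_space \<mu>)"
  show "inner_prod (L2_space \<mu>) (\<lambda>x. a x + b x) u =
      inner_prod (L2_space \<mu>) a u + inner_prod (L2_space \<mu>) b u"
    using a b u L2_integrable_mult[of a \<mu> u] L2_integrable_mult[of b \<mu> u]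
    by (simp add: L2_inner_def distrib_right)
qed

lemma hnorm_L2_space: "hnorm (L2_space \<mu>) f = L2_norm \<mu> f"
  by (rule hnorm_eq_L2_norm) simp

lemma L2_norm_nonneg: "0 \<le> L2_norm \<mu> f"
  by (simp add: L2_norm_def)

lemma L2_Cauchy_Schwarz:
  "\<lbrakk>f \<in> L2 \<mu>; g \<in> L2 \<mu>\<rbrakk> \<Longrightarrow> cmod (L2_inner \<mu> f g) \<le> L2_norm \<mu> f * L2_norm \<mu> g"
  using L2.Cauchy_Schwarz[of f \<mu> g] by (simp add: hnorm_L2_space)

lemma L2_norm_mono:
  assumes g: "g \<in> L2 \<mu>" and f: "f \<in> borel_measurable \<mu>" and C: "0 \<le> C"
    and le: "\<And>z. z \<in> space \<mu> \<Longrightarrow> cmod (f z) \<le> C * cmod (g z)"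
  shows "L2_norm \<mu> f \<le> C * L2_norm \<mu> g"
proof -
  have fL: "f \<in> L2 \<mu>" by (rule L2_dominated[OF f g C le])
  have "(LINT z|\<mu>. (cmod (f z))\<^sup>2) \<le> (LINT z|\<mu>. C\<^sup>2 * (cmod (g z))\<^sup>2)"
  proof (rule integral_mono)
    show "(cmod (f z))\<^sup>2 \<le> C\<^sup>2 * (cmod (g z))\<^sup>2" if "z \<in> space \<mu>" for z
      using power_mono[OF le[OF that] norm_ge_zero, of 2] by (simp add: power_mult_distrib)
  qed (use L2_D(2)[OF fL] L2_D(2)[OF g] in auto)
  then have "L2_norm \<mu> f \<le> sqrt (C\<^sup>2 * (LINT z|\<mu>. (cmod (g z))\<^sup>2))"
    unfolding L2_norm_def by simp
  also have "\<dots> = C * L2_norm \<mu> g" using C by (simp add: real_sqrt_mult L2_norm_def)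
  finally show ?thesis .
qed

lemma L2_dominated_convergence:
  assumes h: "h \<in> L2 \<mu>" and f: "\<And>n. f n \<in> borel_measurable \<mu>" and C: "0 \<le> C"
    and le: "\<And>n z. z \<in> space \<mu> \<Longrightarrow> cmod (f n z) \<le> C * cmod (h z)"
    and lim: "\<And>z. z \<in> space \<mu> \<Longrightarrow> (\<lambda>n. f n z) \<longlonglongrightarrow> 0"
  shows "(\<lambda>n. L2_norm \<mu> (f n)) \<longlonglongrightarrow> 0"
proof -
  have "(\<lambda>n. LINT z|\<mu>. (cmod (f n z))\<^sup>2) \<longlonglongrightarrow> (LINT z|\<mu>. (0::real))"
  proof (rule integral_dominated_convergence)
    show "integrable \<mu> (\<lambda>z. C\<^sup>2 * (cmod (h z))\<^sup>2)" using L2_D(2)[OF h] by simp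
    show "AE z in \<mu>. (\<lambda>n. (cmod (f n z))\<^sup>2) \<longlonglongrightarrow> 0"
    proof (rule AE_I2)
      fix z assume "z \<in> space \<mu>"
      from tendsto_power[OF tendsto_norm[OF lim[OF this]], of 2]
      show "(\<lambda>n. (cmod (f n z))\<^sup>2) \<longlonglongrightarrow> 0" by simp
    qed
    show "AE z in \<mu>. norm ((cmod (f n z))\<^sup>2) \<le> C\<^sup>2 * (cmod (h z))\<^sup>2" for n
    proof (rule AE_I2)
      fix z assume z: "z \<in> space \<mu>"
      show "norm ((cmod (f n z))\<^sup>2) \<le> C\<^sup>2 * (cmod (h z))\<^sup>2"
        using power_mono[OF le[OF z, of n] norm_ge_zero, of 2] by (simp add: power_mult_distrib)
    qed
  qed (use f in measurable)
  then have "(\<lambda>n. sqrt (LINT z|\<mu>. (cmod (f n z))\<^sup>2)) \<longlonglongrightarrow> sqrt 0"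
    by (intro tendsto_real_sqrt) simp
  then show ?thesis by (simp add: L2_norm_def)
qed

text \<open>This takes the place of the completeness of $L^2(\mu)$: the Cauchy sequences of polynomials
considered below converge at every point, so no almost everywhere convergent subsequences are needed.\<close>

lemma L2_Fatou:
  assumes u: "\<And>n. u n \<in> L2 \<mu>" and le: "\<And>n. L2_norm \<mu> (u n) \<le> c"
    and lim: "\<And>z. z \<in> space \<mu> \<Longrightarrow> (\<lambda>n. u n z) \<longlonglongrightarrow> v z"
  shows "v \<in> L2 \<mu>" "L2_norm \<mu> v \<le> c"
proof -
  have c0: "0 \<le> c" using le[of 0] L2_norm_nonneg order_trans by blast
  have um: "u n \<in> borel_measurable \<mu>" for n by (rule L2_D(1)[OF u])
  have vm: "v \<in> borel_measurable \<mu>"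
    by (rule borel_measurable_LIMSEQ_metric[OF um lim])
  have int: "(\<integral>\<^sup>+z. ennreal ((cmod (u n z))\<^sup>2) \<partial>\<mu>) \<le> ennreal (c\<^sup>2)" for n
  proof -
    have "(\<integral>\<^sup>+z. ennreal ((cmod (u n z))\<^sup>2) \<partial>\<mu>) = ennreal (LINT z|\<mu>. (cmod (u n z))\<^sup>2)"
      by (rule nn_integral_eq_integral[OF L2_D(2)[OF u]]) simp
    also have "(LINT z|\<mu>. (cmod (u n z))\<^sup>2) = (L2_norm \<mu> (u n))\<^sup>2"
      by (simp add: L2_norm_def)
    also have "\<dots> \<le> c\<^sup>2" by (rule power_mono[OF le L2_norm_nonneg])
    finally show ?thesis by (simp add: ennreal_leI)
  qed
  have "(\<integral>\<^sup>+z. ennreal ((cmod (v z))\<^sup>2) \<partial>\<mu>) = (\<integral>\<^sup>+z. liminf (\<lambda>n. ennreal ((cmod (u n z))\<^sup>2)) \<partial>\<mu>)"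
  proof (rule nn_integral_cong)
    fix z assume z: "z \<in> space \<mu>"
    have "(\<lambda>n. ennreal ((cmod (u n z))\<^sup>2)) \<longlonglongrightarrow> ennreal ((cmod (v z))\<^sup>2)"
      by (intro tendsto_intros lim z)
    from lim_imp_Liminf[OF sequentially_bot this]
    show "ennreal ((cmod (v z))\<^sup>2) = liminf (\<lambda>n. ennreal ((cmod (u n z))\<^sup>2))"
      by (rule sym)
  qed
  also have "\<dots> \<le> liminf (\<lambda>n. \<integral>\<^sup>+z. ennreal ((cmod (u n z))\<^sup>2) \<partial>\<mu>)"
    by (rule nn_integral_liminf) (use um in measurable)
  also have "\<dots> \<le> ennreal (c\<^sup>2)"
    by (rule Liminf_le) (use int in \<open>auto intro: always_eventually\<close>)
  finally have le': "(\<integral>\<^sup>+z. ennreal ((cmod (v z))\<^sup>2) \<partial>\<mu>) \<le> ennreal (c\<^sup>2)" .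
  have int_v: "integrable \<mu> (\<lambda>z. (cmod (v z))\<^sup>2)"
    by (rule integrableI_bounded) (use vm le' in \<open>auto simp: le_less_trans\<close>)
  then show "v \<in> L2 \<mu>" using vm by (simp add: L2_def)
  have "ennreal (LINT z|\<mu>. (cmod (v z))\<^sup>2) \<le> ennreal (c\<^sup>2)"
    using le' nn_integral_eq_integral[OF int_v] by simp
  then have "(LINT z|\<mu>. (cmod (v z))\<^sup>2) \<le> c\<^sup>2" by simp
  then show "L2_norm \<mu> v \<le> c" using c0 by (simp add: L2_norm_def real_le_lsqrt)
qed

section \<open>Multiplier algebras of analytic functions\<close>

text \<open>The properties of $P^2(\mu)$ and of a dual subalgebra that the factorization of functionals rests
on. The last one is the part of weak-* closedness that is used: closedness under bounded pointwise
limits.\<close>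

locale analytic_multiplier_algebra = multiplier_algebra H A
  for H :: "complex function_space" and A +
  fixes \<mu> :: "complex measure"
  assumes open_points: "open (points H)" and points_nonempty: "points H \<noteq> {}"
    and space_eq: "space \<mu> = points H"
    and inner_eq: "inner_prod H = L2_inner \<mu>"
    and vectors_L2: "vectors H \<subseteq> L2 \<mu>"
    and holomorphic: "h \<in> vectors H \<Longrightarrow> h holomorphic_on points H"
    and evaluation_bounded: "z \<in> points H \<Longrightarrow> \<exists>C. \<forall>h\<in>vectors H. cmod (h z) \<le> C * hnorm H h"
    and powers_mem: "w \<in> points H \<Longrightarrow> (\<lambda>z. if z \<in> points H then (z - w) ^ n else 0) \<in> vectors H"
    and A_functions_on: "A \<subseteq> functions_on (points H)"
    and bounded_limits_mem: "\<lbrakk>\<And>n. f n \<in> A; \<And>n z. z \<in> points H \<Longrightarrow> cmod (f n z) \<le> 1;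
      \<And>z. z \<in> points H \<Longrightarrow> (\<lambda>n. f n z) \<longlonglongrightarrow> g z; g \<in> functions_on (points H)\<rbrakk> \<Longrightarrow> g \<in> A"
begin

lemma unit_vector: "(\<lambda>z. if z \<in> points H then 1 else 0) \<in> vectors H"
  using points_nonempty powers_mem[of _ 0] by (auto cong: if_cong)

lemma A_vector:
  assumes "f \<in> A" shows "f \<in> vectors H"
proof -
  have "(\<lambda>z. f z * (if z \<in> points H then 1 else 0)) = f"
    using assms A_functions_on by (fastforce simp: functions_on_def)
  then show ?thesis using mult_mem[OF assms unit_vector] by simp
qed

lemma A_holomorphic: "f \<in> A \<Longrightarrow> f holomorphic_on points H"
  by (rule holomorphic[OF A_vector])

text \<open>The representing vector $k$ of the evaluation at $z$ satisfies
$f(z) \|k\|^2 = \langle f k, k \rangle$, so $|f(z)|$ is bounded by the norm of the operator.\<close>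

lemma A_bounded:
  assumes f: "f \<in> A"
  shows "\<exists>t\<ge>0. \<forall>z\<in>points H. cmod (f z) \<le> t"
proof -
  obtain C where C0: "C \<ge> 0" and C: "\<forall>h\<in>vectors H. hnorm H (\<lambda>x. f x * h x) \<le> C * hnorm H h"
    using mult_bound[OF f] by auto
  have "cmod (f z) \<le> C" if z: "z \<in> points H" for z
  proof -
    let ?e = "\<lambda>h::complex \<Rightarrow> complex. h z"
    obtain B where B: "\<forall>h\<in>vectors H. cmod (h z) \<le> B * hnorm H h" using evaluation_bounded[OF z] by auto
    obtain k where k: "k \<in> vectors H" "\<forall>h\<in>vectors H. h z = inner_prod H h k"
      using Riesz_representation[of ?e B] B by auto
    have "inner_prod H (\<lambda>z. if z \<in> points H then 1 else 0) k = 1"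
      using k(2) unit_vector z by fastforce
    then have "hnorm H k \<noteq> 0"
      using Cauchy_Schwarz[OF unit_vector k(1)] by auto
    then have pos: "hnorm H k > 0" using hnorm_nonneg[OF k(1)] by simp
    have "f z * k z = inner_prod H (\<lambda>z. f z * k z) k"
      using bspec[OF k(2) mult_mem[OF f k(1)]] by simp
    then have "cmod (f z) * cmod (k z) \<le> hnorm H (\<lambda>z. f z * k z) * hnorm H k"
      using Cauchy_Schwarz[OF mult_mem[OF f k(1)] k(1)] by (simp add: norm_mult[symmetric])
    also have "\<dots> \<le> (C * hnorm H k) * hnorm H k"
      using C k(1) pos by (intro mult_right_mono) auto
    also have "cmod (k z) = hnorm H k * hnorm H k"
      using bspec[OF k(2) k(1)] ip_self[OF k(1)] by (simp add: power2_eq_square norm_mult)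
    finally have "cmod (f z) * (hnorm H k * hnorm H k) \<le> C * (hnorm H k * hnorm H k)" by (simp add: mult_ac)
    then show ?thesis using pos by simp
  qed
  then show ?thesis using C0 by auto
qed

lemma hnorm_L2: "hnorm H h = L2_norm \<mu> h"
  by (rule hnorm_eq_L2_norm[OF inner_eq])

lemma A_measurable: "f \<in> A \<Longrightarrow> f \<in> borel_measurable \<mu>"
  using A_vector vectors_L2 L2_D(1) by blast

lemma vector_L2: "h \<in> vectors H \<Longrightarrow> h \<in> L2 \<mu>"
  using vectors_L2 by blast

lemma hnorm_mult_le:
  assumes f: "f \<in> A" and t: "0 \<le> t" "\<And>z. z \<in> points H \<Longrightarrow> cmod (f z) \<le> t" and h: "h \<in> vectors H"
  shows "hnorm H (\<lambda>z. f z * h z) \<le> t * hnorm H h"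
  unfolding hnorm_L2
  by (rule L2_norm_mono[OF vector_L2[OF h] _ t(1)])
    (use t L2_D(1)[OF vector_L2[OF mult_mem[OF f h]]] in \<open>auto simp: space_eq norm_mult mult_right_mono\<close>)

definition unit_ball :: "(complex \<Rightarrow> complex) set" where
  "unit_ball = {f \<in> A. \<forall>z\<in>points H. cmod (f z) \<le> 1}"

lemma unit_ball_A: "f \<in> unit_ball \<Longrightarrow> f \<in> A"
  and unit_ball_le: "\<lbrakk>f \<in> unit_ball; z \<in> points H\<rbrakk> \<Longrightarrow> cmod (f z) \<le> 1"
  by (auto simp: unit_ball_def)

lemma unit_ball_compact:
  assumes f: "\<And>n::nat. f n \<in> unit_ball"
  shows "\<exists>g\<in>unit_ball. \<exists>r. strict_mono r \<and> (\<forall>z\<in>points H. (\<lambda>n. f (r n) z) \<longlonglongrightarrow> g z)"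
proof -
  obtain g r where g: "strict_mono (r :: nat \<Rightarrow> nat)"
    "\<And>z. z \<in> points H \<Longrightarrow> (\<lambda>n. f (r n) z) \<longlonglongrightarrow> g z"
  proof (rule Montel[of "points H" unit_ball f])
    show "\<exists>B. \<forall>h\<in>unit_ball. \<forall>z\<in>K. cmod (h z) \<le> B" if "compact K" "K \<subseteq> points H" for K
      using that unit_ball_le by (intro exI[of _ 1]) auto
  qed (use open_points f unit_ball_A A_holomorphic in auto)
  define g' where "g' z = (if z \<in> points H then g z else 0)" for z
  have lim: "(\<lambda>n. f (r n) z) \<longlonglongrightarrow> g' z" if "z \<in> points H" for z
    using g(2)[OF that] that by (simp add: g'_def)
  have le1: "cmod (g' z) \<le> 1" if z: "z \<in> points H" for z
    by (rule LIMSEQ_le_const2[OF tendsto_norm[OF lim[OF z]]]) (use unit_ball_le[OF f z] in auto)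
  have "g' \<in> A"
    by (rule bounded_limits_mem[of "\<lambda>n. f (r n)"])
      (use f unit_ball_A unit_ball_le lim in \<open>auto simp: functions_on_def g'_def\<close>)
  then have "g' \<in> unit_ball" using le1 by (simp add: unit_ball_def)
  then show ?thesis using g(1) lim by blast
qed

lemma unit_ball_limit:
  assumes f: "\<And>n. f n \<in> unit_ball" "g \<in> unit_ball" and h: "h \<in> vectors H"
    and lim: "\<And>z. z \<in> points H \<Longrightarrow> (\<lambda>n. f n z) \<longlonglongrightarrow> g z"
  shows "(\<lambda>n. L2_norm \<mu> (\<lambda>z. (f n z - g z) * h z)) \<longlonglongrightarrow> 0"
proof (rule L2_dominated_convergence[OF vector_L2[OF h], of _ 2])
  fix n
  show "(\<lambda>z. (f n z - g z) * h z) \<in> borel_measurable \<mu>"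
    using A_measurable[OF unit_ball_A[OF f(1)], of n] A_measurable[OF unit_ball_A[OF f(2)]]
      L2_D(1)[OF vector_L2[OF h]] by simp
  fix z assume "z \<in> space \<mu>"
  then have z: "z \<in> points H" by (simp add: space_eq)
  have "cmod (f n z - g z) \<le> 2"
    using norm_triangle_ineq4[of "f n z" "g z"] unit_ball_le[OF f(1) z, of n] unit_ball_le[OF f(2) z]
    by linarith
  then show "cmod ((f n z - g z) * h z) \<le> 2 * cmod (h z)"
    by (simp add: norm_mult mult_right_mono)
next
  fix z assume "z \<in> space \<mu>"
  then have z: "z \<in> points H" by (simp add: space_eq)
  have "(\<lambda>n. (f n z - g z) * h z) \<longlonglongrightarrow> (g z - g z) * h z"
    by (intro tendsto_intros lim z)
  then show "(\<lambda>n. (f n z - g z) * h z) \<longlonglongrightarrow> 0" by simp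
qed simp

text \<open>If uniformity failed, there would be bad functions $f_k$ in the unit ball for arbitrarily late indices;
by compactness they converge pointwise to some $g$ along a subsequence. For $g$ alone the inner products
tend to \<open>0\<close>, and the contribution of $f_k - g$ is at most the $L^2$ norm of $(f_k - g) h$. In
$\langle (f_k - g) v, h \rangle$ the factor $f_k - g$ is moved, conjugated, to $h$; this leaves the
space \<open>vectors H\<close> but not $L^2(\mu)$.\<close>

lemma weakly_null_uniform:
  assumes v: "\<And>n. v n \<in> vectors H" "\<And>n. hnorm H (v n) = 1"
    and weak: "\<And>h. h \<in> vectors H \<Longrightarrow> (\<lambda>n. inner_prod H h (v n)) \<longlonglongrightarrow> 0"
    and h: "h \<in> vectors H" and \<eta>: "\<eta> > 0"
  shows "\<exists>N. \<forall>n\<ge>N. \<forall>f\<in>unit_ball. cmod (inner_prod H (\<lambda>z. f z * h z) (v n)) \<le> \<eta> \<and>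
    cmod (inner_prod H (\<lambda>z. f z * v n z) h) \<le> \<eta>"
proof (rule ccontr)
  define bad where "bad n f \<longleftrightarrow> cmod (inner_prod H (\<lambda>z. f z * h z) (v n)) > \<eta> \<or>
    cmod (inner_prod H (\<lambda>z. f z * v n z) h) > \<eta>" for n f
  assume "\<not> ?thesis"
  then have "\<forall>N. \<exists>n f. n \<ge> N \<and> f \<in> unit_ball \<and> bad n f"
    unfolding bad_def by (metis not_le)
  then obtain n f where n: "\<And>N. n N \<ge> N" and f: "\<And>N. f N \<in> unit_ball" and bad: "\<And>N. bad (n N) (f N)"
    by metis
  obtain g r where g: "g \<in> unit_ball" and r: "strict_mono (r::nat \<Rightarrow> nat)"
    and lim: "\<And>z. z \<in> points H \<Longrightarrow> (\<lambda>k. f (r k) z) \<longlonglongrightarrow> g z"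
    using unit_ball_compact[of f, OF f] by auto
  define m where "m k = n (r k)" for k
  have gA: "g \<in> A" and fA: "f k \<in> A" for k using f g unit_ball_A by auto
  have m: "filterlim m at_top sequentially"
    by (rule filterlim_at_top_mono[OF filterlim_ident])
      (use n seq_suble[OF r] order_trans in \<open>fastforce intro!: always_eventually simp: m_def\<close>)
  let ?e = "\<lambda>k. L2_norm \<mu> (\<lambda>z. (f (r k) z - g z) * h z)"
  have e: "?e \<longlonglongrightarrow> 0" by (rule unit_ball_limit[OF f g h lim])
  have V: "(\<lambda>z. (f (r k) z - g z) * h z) \<in> vectors H" for k
    by (rule mult_mem[OF A_diff[OF fA gA] h])
  have tri: "cmod a \<le> e + cmod c" if "a = b + c" "cmod b \<le> e" for a b c :: complex and e
    using norm_triangle_ineq[of b c] that by simp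
  have 1: "cmod (inner_prod H (\<lambda>z. f (r k) z * h z) (v (m k))) \<le>
      ?e k + cmod (inner_prod H (\<lambda>z. g z * h z) (v (m k)))" for k
  proof -
    have "inner_prod H (\<lambda>z. f (r k) z * h z) (v (m k)) =
        inner_prod H (\<lambda>z. (f (r k) z - g z) * h z) (v (m k)) + inner_prod H (\<lambda>z. g z * h z) (v (m k))"
      using ip_add_left[OF V mult_mem[OF gA h] v(1), of k "m k"] by (simp add: algebra_simps)
    moreover have "cmod (inner_prod H (\<lambda>z. (f (r k) z - g z) * h z) (v (m k))) \<le> ?e k"
      using Cauchy_Schwarz[OF V v(1), of k "m k"] by (simp add: v(2) hnorm_L2[of "\<lambda>z. _ z * _ z"])
    ultimately show ?thesis by (rule tri)
  qed
  have 2: "cmod (inner_prod H (\<lambda>z. f (r k) z * v (m k) z) h) \<le>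
      ?e k + cmod (inner_prod H (hadjoint H (mult_op H g) h) (v (m k)))" for k
  proof -
    have vV: "v (m k) \<in> vectors H" by (rule v)
    have dA: "(\<lambda>z. f (r k) z - g z) \<in> A" by (rule A_diff[OF fA gA])
    have "inner_prod H (\<lambda>z. f (r k) z * v (m k) z) h =
        inner_prod H (\<lambda>z. (f (r k) z - g z) * v (m k) z) h + inner_prod H (\<lambda>z. g z * v (m k) z) h"
      using ip_add_left[OF mult_mem[OF dA vV] mult_mem[OF gA vV] h] by (simp add: algebra_simps)
    moreover have "cmod (inner_prod H (\<lambda>z. (f (r k) z - g z) * v (m k) z) h) \<le> ?e k"
    proof -
      let ?c = "\<lambda>z. cnj (f (r k) z - g z) * h z"
      have meas: "?c \<in> borel_measurable \<mu>"
      proof -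
        have "(\<lambda>z. cnj (f (r k) z - g z)) \<in> borel_measurable \<mu>"
          by (rule measurable_compose[OF A_measurable[OF dA] borel_measurable_continuous_onI])
            (intro continuous_intros)
        then show ?thesis using L2_D(1)[OF vector_L2[OF h]] by (rule borel_measurable_times)
      qed
      have cm: "cmod (?c z) \<le> 1 * cmod ((f (r k) z - g z) * h z)" for z
        by (simp only: norm_mult complex_mod_cnj mult_1)
      have cL: "?c \<in> L2 \<mu>" by (rule L2_dominated[OF meas vector_L2[OF V] zero_le_one cm])
      have "inner_prod H (\<lambda>z. (f (r k) z - g z) * v (m k) z) h = L2_inner \<mu> (v (m k)) ?c"
        by (simp add: inner_eq L2_inner_def mult_ac)
      then have "cmod (inner_prod H (\<lambda>z. (f (r k) z - g z) * v (m k) z) h) \<le> L2_norm \<mu> (v (m k)) * L2_norm \<mu> ?c"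
        using L2_Cauchy_Schwarz[OF vector_L2[OF vV] cL] by simp
      also have "\<dots> = L2_norm \<mu> ?c" using v(2)[of "m k"] by (simp add: hnorm_L2)
      also have "\<dots> \<le> 1 * ?e k" by (rule L2_norm_mono[OF vector_L2[OF V] meas zero_le_one cm])
      finally show ?thesis by simp
    qed
    moreover have "cmod (inner_prod H (\<lambda>z. g z * v (m k) z) h) =
        cmod (inner_prod H (hadjoint H (mult_op H g) h) (v (m k)))"
      unfolding ip_cnj[OF vV hadjoint_mult_mem[OF gA h], symmetric] complex_mod_cnj
      by (simp only: ip_hadjoint_mult[OF gA vV h])
    ultimately show ?thesis using tri[of _ _ "inner_prod H (\<lambda>z. g z * v (m k) z) h"] by simp
  qed
  have "(\<lambda>k. ?e k + cmod (inner_prod H (\<lambda>z. g z * h z) (v (m k)))) \<longlonglongrightarrow> 0"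
    by (intro tendsto_add_zero e tendsto_norm_zero filterlim_compose[OF weak m] mult_mem gA h)
  from order_tendstoD(2)[OF this \<eta>]
  have ev1: "\<forall>\<^sub>F k in sequentially. ?e k + cmod (inner_prod H (\<lambda>z. g z * h z) (v (m k))) < \<eta>" .
  have "(\<lambda>k. ?e k + cmod (inner_prod H (hadjoint H (mult_op H g) h) (v (m k)))) \<longlonglongrightarrow> 0"
    by (intro tendsto_add_zero e tendsto_norm_zero filterlim_compose[OF weak m] hadjoint_mult_mem gA h)
  from order_tendstoD(2)[OF this \<eta>]
  have "\<forall>\<^sub>F k in sequentially. ?e k + cmod (inner_prod H (hadjoint H (mult_op H g) h) (v (m k))) < \<eta>" .
  with ev1 have "\<forall>\<^sub>F k in sequentially. False"
  proof eventually_elim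
    case (elim k)
    then show ?case using bad[of "r k"] 1[of k] 2[of k] by (auto simp: bad_def m_def)
  qed
  then show False by simp
qed

end

section \<open>Vectors that represent a point evaluation\<close>

context analytic_multiplier_algebra
begin

text \<open>Near these points, convergence in norm implies uniform convergence, and with it convergence of all
derivatives.\<close>

definition tame_points :: "complex set" where
  "tame_points = {w \<in> points H. \<exists>r>0. \<exists>C. ball w r \<subseteq> points H \<and>
     (\<forall>z\<in>ball w r. \<forall>h\<in>vectors H. cmod (h z) \<le> C * hnorm H h)}"

text \<open>A closed disk is the union over $n$ of the closed sets on which all evaluations have norm at most $n$.
By Baire's theorem one of them has interior points.\<close>

lemma tame_points_dense: "points H \<subseteq> closure tame_points"
proof (rule subsetI, unfold closure_approachable, intro allI impI)
  fix w and e :: real assume w: "w \<in> points H" and e: "e > 0"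
  obtain r0 where r0: "r0 > 0" "cball w r0 \<subseteq> points H"
    using open_contains_cball[THEN iffD1, OF open_points] w by auto
  define r where "r = min r0 (e / 2)"
  have r: "r > 0" "r < e" using r0 e by (auto simp: r_def)
  have sub: "cball w r \<subseteq> points H"
    using r0(2) by (auto simp: r_def)
  \<comment> \<open>the open sets where some evaluation has norm above \<open>n\<close>; they cannot all be dense\<close>
  define T where "T n = {z \<in> cball w r. \<exists>h\<in>vectors H. real n * hnorm H h < cmod (h z)}" for n :: nat
  have T_open: "openin (top_of_set (cball w r)) (T n)" for n
  proof -
    have "openin (top_of_set (cball w r)) {z \<in> cball w r. real n * hnorm H h < cmod (h z)}"
      if "h \<in> vectors H" for h
    proof -
      have "continuous_on (cball w r) (\<lambda>z. cmod (h z))"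
        using continuous_on_subset[OF holomorphic_on_imp_continuous_on[OF holomorphic[OF that]] sub]
        by (intro continuous_intros)
      from continuous_openin_preimage_gen[OF this open_greaterThan, of "real n * hnorm H h"]
      moreover have "cball w r \<inter> (\<lambda>z. cmod (h z)) -` {real n * hnorm H h<..} =
          {z \<in> cball w r. real n * hnorm H h < cmod (h z)}" by auto
      ultimately show ?thesis by (simp only:)
    qed
    moreover have "T n = (\<Union>h\<in>vectors H. {z \<in> cball w r. real n * hnorm H h < cmod (h z)})"
      by (auto simp: T_def)
    ultimately show ?thesis by (simp add: openin_clauses(3))
  qed
  have "\<exists>n. \<not> cball w r \<subseteq> closure (T n)"
  proof (rule ccontr)
    assume "\<not> ?thesis"
    then have "cball w r \<subseteq> closure (\<Inter> (range T))"
      using T_open by (intro Baire) auto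
    moreover have "\<Inter> (range T) = {}"
    proof (rule ccontr)
      assume "\<Inter> (range T) \<noteq> {}"
      then obtain z where z: "\<And>n. z \<in> T n" by auto
      then have "z \<in> points H" using sub by (auto simp: T_def)
      then obtain C where C: "\<forall>h\<in>vectors H. cmod (h z) \<le> C * hnorm H h"
        using evaluation_bounded by auto
      obtain n where n: "C \<le> real n" using real_arch_simple by auto
      obtain h where h: "h \<in> vectors H" "real n * hnorm H h < cmod (h z)"
        using z[of n] by (auto simp: T_def)
      have "C * hnorm H h \<le> real n * hnorm H h"
        by (rule mult_right_mono[OF n hnorm_nonneg[OF h(1)]])
      then show False using C h by fastforce
    qed
    ultimately show False using r(1) by simp
  qed
  then obtain n where "\<not> cball w r \<subseteq> closure (T n)" by (elim exE)
  then obtain z where z: "z \<in> cball w r" "z \<notin> closure (T n)" by blast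
  then obtain s where s: "s > 0" "\<And>y. y \<in> T n \<Longrightarrow> s \<le> dist y z"
    unfolding closure_approachable by (auto simp: not_less)
  have "z \<in> closure (ball w r)" using z(1) r(1) by simp
  then obtain y where y: "y \<in> ball w r" "dist y z < s"
    using s(1) unfolding closure_approachable by auto
  have "open (ball w r \<inter> ball z s)" by (intro open_Int open_ball)
  moreover have "y \<in> ball w r \<inter> ball z s" using y by (auto simp: dist_commute)
  ultimately obtain t where t: "t > 0" "ball y t \<subseteq> ball w r \<inter> ball z s"
    using open_contains_ball by metis
  have sub_y: "ball y t \<subseteq> points H" using t(2) sub ball_subset_cball by blast
  have bound: "cmod (h x) \<le> real n * hnorm H h" if x: "x \<in> ball y t" and h: "h \<in> vectors H" for x h
  proof -
    have xwz: "x \<in> ball w r" "x \<in> ball z s" using x t(2) by blast+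
    have "x \<notin> T n" using s(2)[of x] xwz(2) by (auto simp: dist_commute)
    then show ?thesis using xwz(1) h by (auto simp: T_def not_less)
  qed
  have "y \<in> points H" using sub_y t(1) by auto
  then have "y \<in> tame_points"
    unfolding tame_points_def using t(1) sub_y bound by blast
  then show "\<exists>y\<in>tame_points. dist y w < e"
    using y(1) r(2) by (intro bexI[of _ y]) (auto simp: dist_commute)
qed

lemma tame_points_subset: "tame_points \<subseteq> points H"
  by (auto simp: tame_points_def)

lemma tame_deriv_bound:
  assumes w: "w \<in> tame_points"
  shows "\<exists>B. \<forall>h\<in>vectors H. cmod ((deriv ^^ n) h w) \<le> B * hnorm H h"
proof -
  obtain r C where r: "r > 0" "ball w r \<subseteq> points H"
    and C: "\<forall>z\<in>ball w r. \<forall>h\<in>vectors H. cmod (h z) \<le> C * hnorm H h"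
    using w unfolding tame_points_def by blast
  have sub: "cball w (r/2) \<subseteq> ball w r" using r(1) by auto
  have "cmod ((deriv ^^ n) h w) \<le> (fact n * C / (r/2)^n) * hnorm H h" if h: "h \<in> vectors H" for h
  proof -
    have "cmod ((deriv ^^ n) h w) \<le> fact n * (C * hnorm H h) / (r/2)^n"
    proof (rule Cauchy_inequality)
      show "h holomorphic_on ball w (r/2)"
        by (rule holomorphic_on_subset[OF holomorphic[OF h]]) (use r in auto)
      show "continuous_on (cball w (r/2)) h"
        by (rule continuous_on_subset[OF holomorphic_on_imp_continuous_on[OF holomorphic[OF h]]])
          (use sub r in auto)
      show "cmod (h x) \<le> C * hnorm H h" if "cmod (w - x) = r/2" for x
        by (rule C[rule_format, OF _ h]) (use that sub r in \<open>auto simp: dist_norm\<close>)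
    qed (use r in simp)
    then show ?thesis by (simp add: field_simps)
  qed
  then show ?thesis by blast
qed

text \<open>The functions that vanish at \<open>w\<close> to order at least \<open>n\<close>.\<close>

definition vanishing_order :: "complex \<Rightarrow> nat \<Rightarrow> (complex \<Rightarrow> complex) set" where
  "vanishing_order w n = {h \<in> vectors H. \<forall>j<n. (deriv ^^ j) h w = 0}"

lemma vanishing_order_closed:
  assumes w: "w \<in> tame_points"
  shows "closed_subspace (vanishing_order w n)"
proof -
  have wp: "w \<in> points H" using w tame_points_subset by auto
  have sub: "vanishing_order w n \<subseteq> vectors H" by (auto simp: vanishing_order_def)
  have cl: "h \<in> vanishing_order w n" if hcl: "h \<in> hclosure H (vanishing_order w n)" for h
  proof -
    obtain s where h: "h \<in> vectors H" and s: "\<And>k. s k \<in> vanishing_order w n"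
      and lim: "(\<lambda>k. hnorm H (\<lambda>x. s k x - h x)) \<longlonglongrightarrow> 0"
      using hcl hclosure_iff_seq[OF sub] by auto
    have sV: "s k \<in> vectors H" for k using s sub by auto
    have "(deriv ^^ j) h w = 0" if j: "j < n" for j
    proof -
      obtain B where B: "\<And>h. h \<in> vectors H \<Longrightarrow> cmod ((deriv ^^ j) h w) \<le> B * hnorm H h"
        using tame_deriv_bound[OF w, of j] by auto
      have "cmod ((deriv ^^ j) h w) \<le> B * hnorm H (\<lambda>x. s k x - h x)" for k
      proof -
        have "(deriv ^^ j) (\<lambda>x. s k x - h x) w = - (deriv ^^ j) h w"
          using higher_deriv_diff[OF holomorphic[OF sV] holomorphic[OF h] open_points wp, of j k] s j
          by (simp add: vanishing_order_def)
        then show ?thesis using B[OF diff_mem[OF sV h], of k] by simp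
      qed
      moreover have "(\<lambda>k. B * hnorm H (\<lambda>x. s k x - h x)) \<longlonglongrightarrow> 0"
        by (rule tendsto_mult_right_zero[OF lim])
      ultimately have "cmod ((deriv ^^ j) h w) \<le> 0"
        by (intro LIMSEQ_le_const) auto
      then show ?thesis by simp
    qed
    then show ?thesis using h by (simp add: vanishing_order_def)
  qed
  show ?thesis
    unfolding closed_subspace_def
  proof (intro conjI ballI allI subsetI)
    have "(deriv ^^ j) (\<lambda>x. 0) w = (0::complex)" for j
      by simp
    then show "(\<lambda>_. 0) \<in> vanishing_order w n" by (simp add: vanishing_order_def zero_mem)
  next
    fix a b assume ab: "a \<in> vanishing_order w n" "b \<in> vanishing_order w n"
    then have V: "a \<in> vectors H" "b \<in> vectors H" using sub by auto
    show "(\<lambda>x. a x + b x) \<in> vanishing_order w n"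
      using ab V add_mem higher_deriv_add[OF holomorphic[OF V(1)] holomorphic[OF V(2)] open_points wp]
      by (simp add: vanishing_order_def)
  next
    fix a c assume a: "a \<in> vanishing_order w n"
    then have V: "a \<in> vectors H" using sub by auto
    show "(\<lambda>x. c * a x) \<in> vanishing_order w n"
      using a V scale_mem higher_deriv_cmult[OF holomorphic[OF V] wp open_points]
      by (simp add: vanishing_order_def)
  next
    show "a \<in> vectors H" if "a \<in> vanishing_order w n" for a using that sub by auto
  qed (rule cl)
qed

lemma vanishing_order_antimono: "m \<le> n \<Longrightarrow> vanishing_order w n \<subseteq> vanishing_order w m"
  by (auto simp: vanishing_order_def)

lemma mult_vanishing_order:
  assumes w: "w \<in> points H" and f: "f \<in> A" "f w = 0" and h: "h \<in> vanishing_order w n"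
  shows "(\<lambda>z. f z * h z) \<in> vanishing_order w (Suc n)"
  unfolding vanishing_order_def
proof (intro CollectI conjI allI impI)
  have hV: "h \<in> vectors H" using h by (simp add: vanishing_order_def)
  show "(\<lambda>z. f z * h z) \<in> vectors H" by (rule mult_mem[OF f(1) hV])
  fix j assume j: "j < Suc n"
  have "of_nat (j choose i) * (deriv ^^ i) f w * (deriv ^^ (j - i)) h w = 0" if "i \<in> {0..j}" for i
  proof (cases "i = 0")
    case False
    then have "j - i < n" using j that by auto
    then show ?thesis using h by (simp add: vanishing_order_def)
  qed (simp add: f(2))
  then have "(deriv ^^ j) (\<lambda>z. f z * h z) w = 0"
    unfolding higher_deriv_mult[OF A_holomorphic[OF f(1)] holomorphic[OF hV] open_points w]
    by (rule sum.neutral[OF ballI])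
  then show "(deriv ^^ j) (\<lambda>z. f z * h z) w = 0" .
qed

lemma power_vanishing_order:
  assumes w: "w \<in> points H"
  shows "(\<lambda>z. if z \<in> points H then (z - w) ^ n else 0) \<in> vanishing_order w n - vanishing_order w (Suc n)"
proof -
  let ?e = "\<lambda>z. if z \<in> points H then (z - w) ^ n else 0"
  have eV: "?e \<in> vectors H" by (rule powers_mem[OF w])
  have d: "(deriv ^^ j) ?e w = pochhammer (of_nat (Suc n - j)) j * (w - w) ^ (n - j)" for j
  proof -
    have "(deriv ^^ j) ?e w = (deriv ^^ j) (\<lambda>z. (z - w) ^ n) w"
      by (rule higher_deriv_transform_within_open[OF holomorphic[OF eV] _ open_points w])
        (auto intro!: holomorphic_intros)
    then show ?thesis by (simp only: higher_deriv_power)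
  qed
  have "pochhammer (1::complex) n \<noteq> 0" by (simp add: pochhammer_fact[symmetric])
  then show ?thesis using eV by (auto simp: vanishing_order_def d zero_power intro!: exI[of _ n])
qed

text \<open>The vector $v_n$ is a unit vector of $H_n \ominus H_{n+1}$, where $H_n$ is the space of functions
that vanish at $w$ to order $n$; it exists because $(z - w)^n$ lies in $H_n$ but not in $H_{n+1}$. Since $(f - f(w)) v_n$ lies in
$H_{n+1}$, it is orthogonal to $v_n$.\<close>

lemma null_sequence:
  assumes w: "w \<in> tame_points"
  shows "\<exists>v :: nat \<Rightarrow> complex \<Rightarrow> complex. (\<forall>n. v n \<in> vectors H \<and> hnorm H (v n) = 1) \<and>
    (\<forall>m n. m \<noteq> n \<longrightarrow> inner_prod H (v m) (v n) = 0) \<and>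
    (\<forall>n. \<forall>f\<in>A. inner_prod H (\<lambda>z. f z * v n z) (v n) = f w)"
proof -
  have wp: "w \<in> points H" using w tame_points_subset by auto
  note cs = vanishing_order_closed[OF w]
  have "\<exists>v\<in>vanishing_order w n. hnorm H v = 1 \<and>
      (\<forall>u\<in>vanishing_order w (Suc n). inner_prod H v u = 0)" for n
    using power_vanishing_order[OF wp, of n] vanishing_order_antimono[of n "Suc n" w]
    by (intro orthogonal_unit_vector[OF cs cs]) auto
  then obtain v where v: "\<And>n. v n \<in> vanishing_order w n" "\<And>n. hnorm H (v n) = 1"
    and orth: "\<And>n u. u \<in> vanishing_order w (Suc n) \<Longrightarrow> inner_prod H (v n) u = 0"
    by metis
  have vV: "v n \<in> vectors H" for n using v(1)[of n] by (simp add: vanishing_order_def)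
  have less: "inner_prod H (v m) (v n) = 0" if "m < n" for m n
    using orth vanishing_order_antimono[of "Suc m" n w] v(1)[of n] that by auto
  have orthogonal: "inner_prod H (v m) (v n) = 0" if "m \<noteq> n" for m n
  proof (cases "m < n")
    case False
    then have "inner_prod H (v n) (v m) = 0" using that less by simp
    then show ?thesis using ip_cnj[OF vV vV, of n m] by simp
  qed (rule less)
  have eval: "inner_prod H (\<lambda>z. f z * v n z) (v n) = f w" if f: "f \<in> A" for f n
  proof -
    let ?one = "\<lambda>z. if z \<in> points H then 1 else (0::complex)"
    let ?g = "\<lambda>z. f z - f w * ?one z"
    have gA: "?g \<in> A" by (intro A_diff A_scale f unit_mem)
    have gv: "(\<lambda>z. ?g z * v n z) \<in> vanishing_order w (Suc n)"
      by (rule mult_vanishing_order[OF wp gA _ v(1)]) (use wp in simp)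
    have gvV: "(\<lambda>z. ?g z * v n z) \<in> vectors H" using gv by (simp add: vanishing_order_def)
    have "(\<lambda>z. f z * v n z) = (\<lambda>z. ?g z * v n z + f w * v n z)"
    proof
      fix z show "f z * v n z = ?g z * v n z + f w * v n z"
        using fun_cong[OF unit_mult[OF vV[of n]], of z] by (auto simp: algebra_simps)
    qed
    then have "inner_prod H (\<lambda>z. f z * v n z) (v n) =
        inner_prod H (\<lambda>z. ?g z * v n z) (v n) + f w * inner_prod H (v n) (v n)"
      using ip_add_left[OF gvV scale_mem[OF vV] vV] ip_scale_left[OF vV vV] by simp
    also have "inner_prod H (\<lambda>z. ?g z * v n z) (v n) = 0"
      unfolding ip_cnj[OF vV gvV, symmetric] orth[OF gv] by simp
    also have "inner_prod H (v n) (v n) = 1" using ip_self[OF vV] v(2) by simp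
    finally show ?thesis by simp
  qed
  show ?thesis
    by (intro exI[of _ v] conjI allI impI ballI) (simp_all add: vV v(2) orthogonal eval)
qed

text \<open>A vector that behaves like the evaluation at \<open>w\<close> on the diagonal and is, uniformly over the unit ball
of the algebra, almost orthogonal to finitely many given vectors.\<close>

lemma null_vector:
  assumes w: "w \<in> tame_points" and S: "finite S" "S \<subseteq> vectors H" and \<eta>: "\<eta> > 0"
  shows "\<exists>v\<in>vectors H. hnorm H v = 1 \<and> (\<forall>f\<in>A. inner_prod H (\<lambda>z. f z * v z) v = f w) \<and>
    (\<forall>h\<in>S. \<forall>f\<in>unit_ball. cmod (inner_prod H (\<lambda>z. f z * h z) v) \<le> \<eta> \<and>
      cmod (inner_prod H (\<lambda>z. f z * v z) h) \<le> \<eta>)"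
proof -
  obtain v where v1: "\<forall>n::nat. v n \<in> vectors H \<and> hnorm H (v n) = 1"
    and orth': "\<forall>m n. m \<noteq> n \<longrightarrow> inner_prod H (v m) (v n) = 0"
    and ev: "\<forall>n. \<forall>f\<in>A. inner_prod H (\<lambda>z. f z * v n z) (v n) = f w"
    using null_sequence[OF w] by (elim exE conjE)
  have v: "v n \<in> vectors H" "hnorm H (v n) = 1" for n using v1 by auto
  have orth: "inner_prod H (v m) (v n) = 0" if "m \<noteq> n" for m n using orth' that by simp
  have "\<forall>\<^sub>F n in sequentially. \<forall>f\<in>unit_ball. cmod (inner_prod H (\<lambda>z. f z * h z) (v n)) \<le> \<eta> \<and>
      cmod (inner_prod H (\<lambda>z. f z * v n z) h) \<le> \<eta>" if "h \<in> S" for h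
    unfolding eventually_sequentially
    by (rule weakly_null_uniform[OF v orthonormal_weakly_null[OF v orth] _ \<eta>]) (use that S in auto)
  then have "\<forall>\<^sub>F n in sequentially. \<forall>h\<in>S. \<forall>f\<in>unit_ball. cmod (inner_prod H (\<lambda>z. f z * h z) (v n)) \<le> \<eta> \<and>
      cmod (inner_prod H (\<lambda>z. f z * v n z) h) \<le> \<eta>"
    using S(1) by (simp add: eventually_ball_finite)
  then obtain n where "\<forall>h\<in>S. \<forall>f\<in>unit_ball. cmod (inner_prod H (\<lambda>z. f z * h z) (v n)) \<le> \<eta> \<and>
      cmod (inner_prod H (\<lambda>z. f z * v n z) h) \<le> \<eta>"
    unfolding eventually_sequentially by auto
  then show ?thesis using v ev by (intro bexI[of _ "v n"]) auto
qed

end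

section \<open>Functionals as limits of combinations of point evaluations\<close>

context analytic_multiplier_algebra
begin

lemma unit_in_unit_ball: "(\<lambda>z. if z \<in> points H then 1 else 0) \<in> unit_ball"
  by (simp add: unit_ball_def unit_mem)

lemma scale_into_unit_ball:
  assumes f: "f \<in> A" and t: "t > 0" "\<forall>z\<in>points H. cmod (f z) \<le> t"
  shows "(\<lambda>z. of_real (1 / t) * f z) \<in> unit_ball"
proof -
  have "(\<lambda>z. of_real (1 / t) * f z) \<in> A" by (rule A_scale[OF f])
  moreover have "cmod (of_real (1 / t) * f z) \<le> 1" if "z \<in> points H" for z
    using t that unfolding norm_mult norm_of_real by simp
  ultimately show ?thesis by (simp add: unit_ball_def)
qed

lemma A_eq_zero:
  assumes "f \<in> A" "\<forall>z\<in>points H. f z = 0"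
  shows "f = (\<lambda>_. 0)"
  using assms A_functions_on by (fastforce simp: functions_on_def)

text \<open>Linear functionals on the algebra that are continuous for bounded pointwise convergence. The scale
of the bound does not matter, by linearity.\<close>

definition normal_functional :: "((complex \<Rightarrow> complex) \<Rightarrow> complex) \<Rightarrow> bool" where
  "normal_functional \<psi> \<longleftrightarrow> (\<forall>f\<in>A. \<forall>g\<in>A. \<psi> (\<lambda>z. f z + g z) = \<psi> f + \<psi> g) \<and>
    (\<forall>c. \<forall>f\<in>A. \<psi> (\<lambda>z. c * f z) = c * \<psi> f) \<and>
    (\<forall>f g. (\<forall>n. f n \<in> unit_ball) \<longrightarrow> g \<in> unit_ball \<longrightarrow>
      (\<forall>z\<in>points H. (\<lambda>n. f n z) \<longlonglongrightarrow> g z) \<longrightarrow> (\<lambda>n. \<psi> (f n)) \<longlonglongrightarrow> \<psi> g)"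

lemma normal_functionalD:
  assumes "normal_functional \<psi>"
  shows "\<lbrakk>f \<in> A; g \<in> A\<rbrakk> \<Longrightarrow> \<psi> (\<lambda>z. f z + g z) = \<psi> f + \<psi> g"
    and "f \<in> A \<Longrightarrow> \<psi> (\<lambda>z. c * f z) = c * \<psi> f"
    and "\<lbrakk>\<And>n. F n \<in> unit_ball; g \<in> unit_ball; \<And>z. z \<in> points H \<Longrightarrow> (\<lambda>n. F n z) \<longlonglongrightarrow> g z\<rbrakk> \<Longrightarrow>
      (\<lambda>n. \<psi> (F n)) \<longlonglongrightarrow> \<psi> g"
  using assms by (auto simp: normal_functional_def)

lemma normal_functional_bound:
  assumes \<psi>: "normal_functional \<psi>" and \<delta>: "\<And>f. f \<in> unit_ball \<Longrightarrow> cmod (\<psi> f) \<le> \<delta>"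
    and f: "f \<in> A" and t: "t \<ge> 0" "\<forall>z\<in>points H. cmod (f z) \<le> t"
  shows "cmod (\<psi> f) \<le> \<delta> * t"
proof (cases "t = 0")
  case True
  then have "f = (\<lambda>_. 0)" using A_eq_zero[OF f] t by simp
  then have "\<psi> f = 0" using normal_functionalD(2)[OF \<psi> f, of 0] by simp
  then show ?thesis using True by simp
next
  case False
  then have pos: "t > 0" using t by simp
  have "cmod (\<psi> (\<lambda>z. of_real (1 / t) * f z)) \<le> \<delta>"
    by (rule \<delta>[OF scale_into_unit_ball[OF f pos t(2)]])
  then have "1 / t * cmod (\<psi> f) \<le> \<delta>"
    unfolding normal_functionalD(2)[OF \<psi> f] norm_mult norm_of_real using pos by simp
  then show ?thesis using pos by (simp add: field_simps)
qed

text \<open>Otherwise, along an increasing sequence of finite sets with dense union, there are functions $f_n$ in the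
unit ball whose values on the $n$-th set are too small. A pointwise limit $g$ of a subsequence is
then small on a dense set, hence everywhere, but $\psi(g)$ is too large for that.\<close>

lemma finite_norming_set:
  assumes \<psi>: "normal_functional \<psi>" and \<delta>: "\<delta> > 0" "\<And>f. f \<in> unit_ball \<Longrightarrow> cmod (\<psi> f) \<le> \<delta>"
    and \<eta>: "\<eta> > 0"
  shows "\<exists>Z. finite Z \<and> Z \<subseteq> tame_points \<and>
    (\<forall>f\<in>unit_ball. \<forall>m\<ge>0. (\<forall>z\<in>Z. cmod (f z) \<le> m) \<longrightarrow> cmod (\<psi> f) \<le> \<delta> * m + \<eta>)"
proof (rule ccontr)
  assume no: "\<not> ?thesis"
  obtain T where T: "countable T" "T \<subseteq> tame_points" "tame_points \<subseteq> closure T"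
    by (rule separable)
  have Tp: "T \<subseteq> points H" using T(2) tame_points_subset by auto
  have dense: "points H \<subseteq> closure T"
    using tame_points_dense closure_minimal[OF T(3) closed_closure] by auto
  then have Tne: "T \<noteq> {}" using points_nonempty by auto
  define q where "q = from_nat_into T"
  have q: "range q = T" unfolding q_def by (rule range_from_nat_into[OF Tne T(1)])
  have "\<exists>f m. f \<in> unit_ball \<and> m \<ge> 0 \<and> (\<forall>z\<in>q ` {..n}. cmod (f z) \<le> m) \<and> \<delta> * m + \<eta> < cmod (\<psi> f)" for n
  proof (rule ccontr)
    assume "\<not> ?thesis"
    then have "\<forall>f\<in>unit_ball. \<forall>m\<ge>0. (\<forall>z\<in>q ` {..n}. cmod (f z) \<le> m) \<longrightarrow> cmod (\<psi> f) \<le> \<delta> * m + \<eta>"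
      by (meson not_le)
    moreover have "q ` {..n} \<subseteq> tame_points" using q T(2) by auto
    moreover have "finite (q ` {..n})" by simp
    ultimately show False using no by (simp only: not_ex de_Morgan_conj) blast
  qed
  then obtain f m where f: "\<And>n. f n \<in> unit_ball" and m: "\<And>n z. z \<in> q ` {..n} \<Longrightarrow> cmod (f n z) \<le> m n"
    and big: "\<And>n. \<delta> * m n + \<eta> < cmod (\<psi> (f n))" by metis
  obtain g r where g: "g \<in> unit_ball" and r: "strict_mono (r::nat \<Rightarrow> nat)"
    and lim: "\<And>z. z \<in> points H \<Longrightarrow> (\<lambda>k. f (r k) z) \<longlonglongrightarrow> g z"
    using unit_ball_compact[of f, OF f] by auto
  have \<psi>lim: "(\<lambda>k. \<psi> (f (r k))) \<longlonglongrightarrow> \<psi> g"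
    by (rule normal_functionalD(3)[OF \<psi> f g lim])
  \<comment> \<open>the bound for \<open>g\<close> that the failing inequalities leave in the limit\<close>
  define M where "M = (cmod (\<psi> g) - \<eta>) / \<delta>"
  have le_T: "cmod (g z) \<le> M" if z: "z \<in> T" for z
  proof -
    obtain j where j: "z = q j" using z q by auto
    have zp: "z \<in> points H" using z Tp by auto
    have "(\<lambda>k. (cmod (\<psi> (f (r k))) - \<eta>) / \<delta>) \<longlonglongrightarrow> M"
      unfolding M_def by (intro tendsto_intros \<psi>lim) (use \<delta> in simp)
    moreover have "\<forall>\<^sub>F k in sequentially. cmod (f (r k) z) \<le> (cmod (\<psi> (f (r k))) - \<eta>) / \<delta>"
      unfolding eventually_sequentially
    proof (intro exI[of _ j] allI impI)
      fix k assume "j \<le> k"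
      then have "z \<in> q ` {..r k}" using j seq_suble[OF r, of k] by auto
      from m[OF this] have "\<delta> * cmod (f (r k) z) \<le> \<delta> * m (r k)" using \<delta>(1) by simp
      then show "cmod (f (r k) z) \<le> (cmod (\<psi> (f (r k))) - \<eta>) / \<delta>"
        using big[of "r k"] \<delta>(1) unfolding pos_le_divide_eq[OF \<delta>(1)] by (simp only: mult.commute)
    qed
    ultimately show ?thesis
      using tendsto_le[OF trivial_limit_sequentially _ tendsto_norm[OF lim[OF zp]]] by blast
  qed
  have le_p: "cmod (g z) \<le> M" if z: "z \<in> points H" for z
  proof -
    obtain s where s: "\<And>n. s n \<in> T" "s \<longlonglongrightarrow> z"
      using dense z closure_sequential by blast
    have "isCont g z"
      using A_holomorphic[OF unit_ball_A[OF g]] open_points z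
        continuous_on_interior holomorphic_on_imp_continuous_on interior_open by metis
    then have "(\<lambda>n. g (s n)) \<longlonglongrightarrow> g z" using s(2) isCont_tendsto_compose by blast
    from LIMSEQ_le_const2[OF tendsto_norm[OF this]] show ?thesis using le_T s(1) by auto
  qed
  obtain z where "z \<in> points H" using points_nonempty by auto
  then have M0: "0 \<le> M" using le_p[of z] norm_ge_zero order_trans by blast
  have "cmod (\<psi> g) \<le> \<delta> * M"
    by (rule normal_functional_bound[OF \<psi> \<delta>(2) unit_ball_A[OF g] M0]) (use le_p in auto)
  then show False using \<delta>(1) \<eta> by (simp add: M_def)
qed

lemma normal_functional_approximation:
  assumes \<psi>: "normal_functional \<psi>" and \<delta>: "\<delta> > 0" "\<And>f. f \<in> unit_ball \<Longrightarrow> cmod (\<psi> f) \<le> \<delta>"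
    and \<eta>: "\<eta> > 0"
  shows "\<exists>Z d. finite Z \<and> Z \<subseteq> tame_points \<and> (\<Sum>z\<in>Z. cmod (d z)) \<le> \<delta> \<and>
    (\<forall>f\<in>unit_ball. cmod ((\<Sum>z\<in>Z. d z * f z) - \<psi> f) \<le> \<eta>)"
proof -
  obtain Z where Z: "finite Z" "Z \<subseteq> tame_points"
    and norming: "\<And>f m. \<lbrakk>f \<in> unit_ball; m \<ge> 0; \<forall>z\<in>Z. cmod (f z) \<le> m\<rbrakk> \<Longrightarrow> cmod (\<psi> f) \<le> \<delta> * m + \<eta>"
    using finite_norming_set[OF \<psi> \<delta> \<eta>] by auto
  have dom: "cmod (\<psi> f) \<le> \<delta> * m + \<eta> * t"
    if f: "f \<in> A" and m: "0 \<le> m" and t: "0 \<le> t" "\<forall>z\<in>points H. cmod (f z) \<le> t"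
      and mZ: "\<forall>z\<in>Z. cmod (f z) \<le> m" for f m t
  proof (cases "t = 0")
    case True
    then show ?thesis using normal_functional_bound[OF \<psi> \<delta>(2) f t] m \<delta>(1) by simp
  next
    case False
    then have pos: "t > 0" using t by simp
    have "cmod (\<psi> (\<lambda>z. of_real (1 / t) * f z)) \<le> \<delta> * (m / t) + \<eta>"
    proof (rule norming[OF scale_into_unit_ball[OF f pos t(2)]])
      show "0 \<le> m / t" using m pos by simp
      show "\<forall>z\<in>Z. cmod (of_real (1 / t) * f z) \<le> m / t"
        using mZ pos unfolding norm_mult norm_of_real by (simp add: divide_right_mono)
    qed
    then have "1 / t * cmod (\<psi> f) \<le> \<delta> * (m / t) + \<eta>"
      unfolding normal_functionalD(2)[OF \<psi> f] norm_mult norm_of_real using pos by simp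
    then show ?thesis using pos by (simp add: field_simps)
  qed
  have "\<exists>d. (\<Sum>x\<in>Z. cmod (d x)) \<le> \<delta> \<and> 0 \<le> Re (\<Sum>x\<in>Z. d x * 0) \<and>
    (\<forall>f\<in>A. \<forall>t\<ge>0. (\<forall>x\<in>points H. cmod (f x) \<le> t) \<longrightarrow> cmod ((\<Sum>x\<in>Z. d x * f x) - \<psi> f) \<le> \<eta> * t)"
  proof (rule functional_near_point_evaluations[OF A_zero A_add A_scale
        normal_functionalD(1)[OF \<psi>] normal_functionalD(2)[OF \<psi>] Z(1)])
    fix f m t assume *: "f \<in> A" "0 \<le> m" "0 \<le> t" "\<forall>x\<in>points H. cmod (f x) \<le> t"
      "\<forall>x\<in>Z. cmod (0 - f x) \<le> m"
    have "cmod (\<psi> f) \<le> \<delta> * m + \<eta> * t" by (rule dom) (use * in auto)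
    then show "0 \<le> \<delta> * m + \<eta> * t + Re (\<psi> f)"
      using abs_Re_le_cmod[of "\<psi> f"] by linarith
  qed (use \<delta>(1) \<eta> dom in auto)
  then obtain d where d: "(\<Sum>x\<in>Z. cmod (d x)) \<le> \<delta>"
    "\<And>f t. \<lbrakk>f \<in> A; t \<ge> 0; \<forall>x\<in>points H. cmod (f x) \<le> t\<rbrakk> \<Longrightarrow> cmod ((\<Sum>x\<in>Z. d x * f x) - \<psi> f) \<le> \<eta> * t"
    by auto
  have "cmod ((\<Sum>x\<in>Z. d x * f x) - \<psi> f) \<le> \<eta>" if "f \<in> unit_ball" for f
    using d(2)[of f 1] that by (simp add: unit_ball_def)
  then show ?thesis using Z d(1) by blast
qed

end

section \<open>Factorization of functionals\<close>

context analytic_multiplier_algebra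
begin

text \<open>The last term is where the point evaluation appears; the two terms before it are the errors.\<close>

lemma ip_rank_one_perturbation:
  assumes f: "f \<in> A" and V: "X \<in> vectors H" "Y \<in> vectors H" "v \<in> vectors H"
  shows "inner_prod H (\<lambda>z. f z * (X z + a * v z)) (\<lambda>z. Y z + b * v z) =
    inner_prod H (\<lambda>z. f z * X z) Y + cnj b * inner_prod H (\<lambda>z. f z * X z) v +
    a * inner_prod H (\<lambda>z. f z * v z) Y + a * cnj b * inner_prod H (\<lambda>z. f z * v z) v"
proof -
  have eq: "(\<lambda>z. f z * (X z + a * v z)) = (\<lambda>z. f z * X z + a * (f z * v z))"
    by (simp add: algebra_simps)
  have fX: "(\<lambda>z. f z * X z) \<in> vectors H" and fv: "(\<lambda>z. f z * v z) \<in> vectors H"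
    by (intro mult_mem f V)+
  have left: "inner_prod H (\<lambda>z. f z * X z + a * (f z * v z)) u =
      inner_prod H (\<lambda>z. f z * X z) u + a * inner_prod H (\<lambda>z. f z * v z) u" if "u \<in> vectors H" for u
    unfolding ip_add_left[OF fX scale_mem[OF fv] that] ip_scale_left[OF fv that] ..
  have "inner_prod H (\<lambda>z. f z * X z + a * (f z * v z)) (\<lambda>z. Y z + b * v z) =
      inner_prod H (\<lambda>z. f z * X z + a * (f z * v z)) Y +
      cnj b * inner_prod H (\<lambda>z. f z * X z + a * (f z * v z)) v"
    unfolding ip_add_right[OF V(2) scale_mem[OF V(3)] add_mem[OF fX scale_mem[OF fv]]]
      ip_scale_right[OF V(3) add_mem[OF fX scale_mem[OF fv]]] ..
  then show ?thesis unfolding eq left[OF V(2)] left[OF V(3)] by (simp add: algebra_simps)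
qed

lemma norm_add_scaled_le:
  assumes V: "x \<in> vectors H" "v \<in> vectors H" and v: "hnorm H v = 1"
    and small: "cmod (inner_prod H x v) \<le> \<eta>" and a: "(cmod a)\<^sup>2 = D"
  shows "(hnorm H (\<lambda>z. x z + a * v z))\<^sup>2 \<le> (hnorm H x)\<^sup>2 + D + 2 * sqrt D * \<eta>"
proof -
  have ca: "cmod a = sqrt D" using a by (metis norm_ge_zero real_sqrt_unique)
  have "Re (inner_prod H x (\<lambda>z. a * v z)) \<le> cmod (cnj a * inner_prod H x v)"
    unfolding ip_scale_right[OF V(2,1)] by (rule complex_Re_le_cmod)
  also have "\<dots> \<le> sqrt D * \<eta>"
    unfolding norm_mult complex_mod_cnj ca using small a by (intro mult_left_mono) auto
  finally show ?thesis
    unfolding hnorm_add_sq[OF V(1) scale_mem[OF V(2)]] hnorm_scale[OF V(2)] using a v by simp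
qed

text \<open>The points are added one at a time, each with a vector from \<open>null_vector\<close> that is chosen almost
orthogonal to everything constructed so far. Splitting the coefficient as $a \overline{b}$ with
$|a|^2 = |b|^2 = |d_w|$ keeps both norms under control.\<close>

lemma add_point_evaluations:
  assumes Z: "finite Z" "Z \<subseteq> tame_points" and x0: "x0 \<in> vectors H" and y0: "y0 \<in> vectors H"
    and \<eta>: "\<eta> > 0"
  shows "\<exists>x\<in>vectors H. \<exists>y\<in>vectors H.
    (hnorm H x)\<^sup>2 \<le> (\<Sum>z\<in>Z. cmod (d z)) + \<eta> \<and> (hnorm H y)\<^sup>2 \<le> (\<Sum>z\<in>Z. cmod (d z)) + \<eta> \<and>
    (\<forall>f\<in>unit_ball. cmod ((\<Sum>z\<in>Z. d z * f z) -
      (inner_prod H (\<lambda>z. f z * (x0 z + x z)) (\<lambda>z. y0 z + y z) - inner_prod H (\<lambda>z. f z * x0 z) y0)) \<le> \<eta>)"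
  using Z \<eta>
proof (induction Z arbitrary: \<eta> rule: finite_induct)
  case empty
  then show ?case
    by (intro bexI[of _ "\<lambda>_. 0"] conjI ballI) (auto simp: hnorm_zero zero_mem)
next
  case (insert w Z)
  have w: "w \<in> tame_points" and Zs: "Z \<subseteq> tame_points" using insert.prems by auto
  have wp: "w \<in> points H" using w tame_points_subset by auto
  from insert.IH[OF Zs, of "\<eta>/2"] insert.prems
  obtain x1 y1 where V1: "x1 \<in> vectors H" "y1 \<in> vectors H"
    and n1: "(hnorm H x1)\<^sup>2 \<le> (\<Sum>z\<in>Z. cmod (d z)) + \<eta>/2" "(hnorm H y1)\<^sup>2 \<le> (\<Sum>z\<in>Z. cmod (d z)) + \<eta>/2"
    and e1: "\<forall>f\<in>unit_ball. cmod ((\<Sum>z\<in>Z. d z * f z) -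
      (inner_prod H (\<lambda>z. f z * (x0 z + x1 z)) (\<lambda>z. y0 z + y1 z) - inner_prod H (\<lambda>z. f z * x0 z) y0)) \<le> \<eta>/2"
    by auto
  define D where "D = cmod (d w)"
  have D0: "D \<ge> 0" by (simp add: D_def)
  define \<sigma> where "\<sigma> = sqrt D + 1"
  have s1: "\<sigma> > 0" using real_sqrt_ge_zero[OF D0] unfolding \<sigma>_def by linarith
  \<comment> \<open>two error terms of size \<open>sqrt D * \<eta>'\<close> have to fit into \<open>\<eta> / 2\<close>\<close>
  define \<eta>' where "\<eta>' = \<eta> / (4 * \<sigma>)"
  have \<eta>': "\<eta>' > 0" using insert.prems s1 by (simp add: \<eta>'_def)
  have "sqrt D * \<eta>' \<le> \<sigma> * \<eta>'" using \<eta>' by (intro mult_right_mono) (auto simp: \<sigma>_def)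
  also have "\<dots> = \<eta> / 4" using s1 by (simp add: \<eta>'_def)
  finally have small: "2 * sqrt D * \<eta>' \<le> \<eta> / 2" by simp
  let ?X = "\<lambda>z. x0 z + x1 z" and ?Y = "\<lambda>z. y0 z + y1 z"
  have XV: "?X \<in> vectors H" and YV: "?Y \<in> vectors H"
    using add_mem[OF x0 V1(1)] add_mem[OF y0 V1(2)] by auto
  obtain v where vV: "v \<in> vectors H" and v1: "hnorm H v = 1"
    and ev: "\<forall>f\<in>A. inner_prod H (\<lambda>z. f z * v z) v = f w"
    and nul: "\<forall>h\<in>{?X, ?Y, x1, y1}. \<forall>f\<in>unit_ball. cmod (inner_prod H (\<lambda>z. f z * h z) v) \<le> \<eta>' \<and>
      cmod (inner_prod H (\<lambda>z. f z * v z) h) \<le> \<eta>'"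
    using null_vector[OF w, of "{?X, ?Y, x1, y1}" \<eta>'] XV YV V1 \<eta>' by auto
  have nul1: "cmod (inner_prod H x1 v) \<le> \<eta>'" "cmod (inner_prod H y1 v) \<le> \<eta>'"
    using nul unit_in_unit_ball unit_mult[OF V1(1)] unit_mult[OF V1(2)] by fastforce+
  define a where "a = complex_of_real (sqrt D)"
  define b where "b = complex_of_real (sqrt D) * cnj (sgn (d w))"
  have ca: "cmod a = sqrt D" unfolding a_def norm_of_real using D0 by simp
  have a2: "(cmod a)\<^sup>2 = D" unfolding ca using D0 by simp
  have cb: "cmod b = sqrt D"
    unfolding b_def norm_mult norm_of_real complex_mod_cnj norm_sgn using D0 by (simp add: D_def)
  have b2: "(cmod b)\<^sup>2 = D" unfolding cb using D0 by simp
  have ab: "a * cnj b = d w"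
  proof -
    have "a * cnj b = complex_of_real (sqrt D * sqrt D) * sgn (d w)"
      by (simp only: a_def b_def complex_cnj_mult complex_cnj_complex_of_real complex_cnj_cnj of_real_mult mult.assoc)
    also have "sqrt D * sqrt D = cmod (d w)" using D0 by (simp add: D_def)
    finally show ?thesis by (simp add: sgn_eq)
  qed
  let ?x = "\<lambda>z. x1 z + a * v z" and ?y = "\<lambda>z. y1 z + b * v z"
  have assoc: "(\<lambda>z. f z * (x0 z + ?x z)) = (\<lambda>z. f z * (?X z + a * v z))"
    "(\<lambda>z. y0 z + ?y z) = (\<lambda>z. ?Y z + b * v z)" for f by (simp_all add: add.assoc)
  show ?case
  proof (rule bexI[of _ ?x], rule bexI[of _ ?y], intro conjI ballI)
    show "(hnorm H ?x)\<^sup>2 \<le> (\<Sum>z\<in>insert w Z. cmod (d z)) + \<eta>"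
      using norm_add_scaled_le[OF V1(1) vV v1 nul1(1) a2] n1(1) small insert.hyps by (simp add: D_def)
    show "(hnorm H ?y)\<^sup>2 \<le> (\<Sum>z\<in>insert w Z. cmod (d z)) + \<eta>"
      using norm_add_scaled_le[OF V1(2) vV v1 nul1(2) b2] n1(2) small insert.hyps by (simp add: D_def)
    fix f assume f: "f \<in> unit_ball"
    have fA: "f \<in> A" by (rule unit_ball_A[OF f])
    define p where "p = cnj b * inner_prod H (\<lambda>z. f z * ?X z) v"
    define q where "q = a * inner_prod H (\<lambda>z. f z * v z) ?Y"
    define r where "r = (\<Sum>z\<in>Z. d z * f z) -
      (inner_prod H (\<lambda>z. f z * ?X z) ?Y - inner_prod H (\<lambda>z. f z * x0 z) y0)"
    have "cmod p \<le> sqrt D * \<eta>'"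
      unfolding p_def norm_mult complex_mod_cnj cb using nul f D0 by (intro mult_left_mono) auto
    moreover have "cmod q \<le> sqrt D * \<eta>'"
      unfolding q_def norm_mult ca using nul f D0 by (intro mult_left_mono) auto
    moreover have "cmod r \<le> \<eta> / 2" using e1 f by (simp add: r_def)
    moreover have "cmod (r - p - q) \<le> cmod r + cmod p + cmod q"
      using norm_triangle_ineq4[of "r - p" q] norm_triangle_ineq4[of r p] by linarith
    ultimately have "cmod (r - p - q) \<le> \<eta>" using small by linarith
    moreover have "(\<Sum>z\<in>insert w Z. d z * f z) -
        (inner_prod H (\<lambda>z. f z * (x0 z + ?x z)) (\<lambda>z. y0 z + ?y z) - inner_prod H (\<lambda>z. f z * x0 z) y0) = r - p - q"
      unfolding assoc ip_rank_one_perturbation[OF fA XV YV vV] bspec[OF ev fA] ab r_def p_def q_def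
      using insert.hyps by simp
    ultimately show "cmod ((\<Sum>z\<in>insert w Z. d z * f z) -
        (inner_prod H (\<lambda>z. f z * (x0 z + ?x z)) (\<lambda>z. y0 z + ?y z) - inner_prod H (\<lambda>z. f z * x0 z) y0)) \<le> \<eta>"
      by simp
  qed (intro add_mem scale_mem V1 vV)+
qed

text \<open>The functional may be added to the one given by a pair $(x_0, y_0)$ that is already there, so that the
lemma can be applied repeatedly.\<close>

lemma approximate_factorization:
  assumes \<psi>: "normal_functional \<psi>" and \<delta>: "\<delta> > 0" "\<And>f. f \<in> unit_ball \<Longrightarrow> cmod (\<psi> f) \<le> \<delta>"
    and x0: "x0 \<in> vectors H" and y0: "y0 \<in> vectors H" and \<eta>: "\<eta> > 0"
  shows "\<exists>x\<in>vectors H. \<exists>y\<in>vectors H. (hnorm H x)\<^sup>2 \<le> \<delta> + \<eta> \<and> (hnorm H y)\<^sup>2 \<le> \<delta> + \<eta> \<and>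
    (\<forall>f\<in>unit_ball. cmod (\<psi> f -
      (inner_prod H (\<lambda>z. f z * (x0 z + x z)) (\<lambda>z. y0 z + y z) - inner_prod H (\<lambda>z. f z * x0 z) y0)) \<le> \<eta>)"
proof -
  have \<eta>2: "\<eta> / 2 > 0" using \<eta> by simp
  have "\<exists>Z d. finite Z \<and> Z \<subseteq> tame_points \<and> (\<Sum>z\<in>Z. cmod (d z)) \<le> \<delta> \<and>
      (\<forall>f\<in>unit_ball. cmod ((\<Sum>z\<in>Z. d z * f z) - \<psi> f) \<le> \<eta> / 2)"
    by (rule normal_functional_approximation[OF \<psi> \<delta>(1) _ \<eta>2]) (rule \<delta>(2))
  then obtain Z d where Z: "finite Z" "Z \<subseteq> tame_points" and d: "(\<Sum>z\<in>Z. cmod (d z)) \<le> \<delta>"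
    and ap: "\<forall>f\<in>unit_ball. cmod ((\<Sum>z\<in>Z. d z * f z) - \<psi> f) \<le> \<eta>/2"
    by (elim exE conjE)
  obtain x y where V: "x \<in> vectors H" "y \<in> vectors H"
    and n: "(hnorm H x)\<^sup>2 \<le> (\<Sum>z\<in>Z. cmod (d z)) + \<eta>/2" "(hnorm H y)\<^sup>2 \<le> (\<Sum>z\<in>Z. cmod (d z)) + \<eta>/2"
    and e: "\<forall>f\<in>unit_ball. cmod ((\<Sum>z\<in>Z. d z * f z) -
      (inner_prod H (\<lambda>z. f z * (x0 z + x z)) (\<lambda>z. y0 z + y z) - inner_prod H (\<lambda>z. f z * x0 z) y0)) \<le> \<eta>/2"
    using add_point_evaluations[OF Z x0 y0 \<eta>2, of d] by (elim bexE conjE)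
  have tri: "cmod (p - r) \<le> \<eta>" if "cmod (q - p) \<le> \<eta>/2" "cmod (q - r) \<le> \<eta>/2" for p q r
    using norm_triangle_ineq4[of "q - r" "q - p"] that by simp
  show ?thesis
  proof (rule bexI[OF _ V(1)], rule bexI[OF _ V(2)], intro conjI ballI)
    fix f assume f: "f \<in> unit_ball"
    show "cmod (\<psi> f - (inner_prod H (\<lambda>z. f z * (x0 z + x z)) (\<lambda>z. y0 z + y z) -
        inner_prod H (\<lambda>z. f z * x0 z) y0)) \<le> \<eta>"
      by (rule tri[OF bspec[OF ap f] bspec[OF e f]])
  qed (use n d \<eta> in linarith)+
qed

lemma tendsto_unit_ball_ip:
  assumes V: "x \<in> vectors H" "y \<in> vectors H" and F: "\<And>n. F n \<in> unit_ball" "g \<in> unit_ball"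
    and lim: "\<And>z. z \<in> points H \<Longrightarrow> (\<lambda>n. F n z) \<longlonglongrightarrow> g z"
  shows "(\<lambda>n. inner_prod H (\<lambda>z. F n z * x z) y) \<longlonglongrightarrow> inner_prod H (\<lambda>z. g z * x z) y"
proof (rule tendsto_ip_left)
  show "(\<lambda>n. hnorm H (\<lambda>z. F n z * x z - g z * x z)) \<longlonglongrightarrow> 0"
    using unit_ball_limit[OF F V(1) lim] by (simp add: hnorm_L2 left_diff_distrib)
qed (intro mult_mem unit_ball_A F V)+

lemma normal_functional_diff_ip:
  assumes \<phi>: "normal_functional \<phi>" and V: "x \<in> vectors H" "y \<in> vectors H"
  shows "normal_functional (\<lambda>f. \<phi> f - inner_prod H (\<lambda>z. f z * x z) y)"
  unfolding normal_functional_def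
proof (intro conjI ballI allI impI)
  fix f g assume fg: "f \<in> A" "g \<in> A"
  have "(\<lambda>z. (f z + g z) * x z) = (\<lambda>z. f z * x z + g z * x z)" by (simp add: distrib_right)
  then show "\<phi> (\<lambda>z. f z + g z) - inner_prod H (\<lambda>z. (f z + g z) * x z) y =
      \<phi> f - inner_prod H (\<lambda>z. f z * x z) y + (\<phi> g - inner_prod H (\<lambda>z. g z * x z) y)"
    using ip_add_left[OF mult_mem[OF fg(1) V(1)] mult_mem[OF fg(2) V(1)] V(2)]
      normal_functionalD(1)[OF \<phi> fg] by simp
next
  fix c f assume f: "f \<in> A"
  have "(\<lambda>z. c * f z * x z) = (\<lambda>z. c * (f z * x z))" by (simp add: mult.assoc)
  then show "\<phi> (\<lambda>z. c * f z) - inner_prod H (\<lambda>z. c * f z * x z) y = c * (\<phi> f - inner_prod H (\<lambda>z. f z * x z) y)"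
    using ip_scale_left[OF mult_mem[OF f V(1)] V(2)] normal_functionalD(2)[OF \<phi> f]
    by (simp add: right_diff_distrib)
next
  fix F g assume "\<forall>n::nat. F n \<in> unit_ball" "g \<in> unit_ball" "\<forall>z\<in>points H. (\<lambda>n. F n z) \<longlonglongrightarrow> g z"
  then show "(\<lambda>n. \<phi> (F n) - inner_prod H (\<lambda>z. F n z * x z) y) \<longlonglongrightarrow> \<phi> g - inner_prod H (\<lambda>z. g z * x z) y"
    by (intro tendsto_diff normal_functionalD(3)[OF \<phi>] tendsto_unit_ball_ip V) auto
qed

text \<open>The first application of \<open>approximate_factorization\<close> costs norm \<open>1\<close>; each later one only has to repair
the error that is left, and costs about the square root of this error.\<close>

theorem factorization:
  assumes \<phi>: "normal_functional \<phi>" and \<phi>1: "\<And>f. f \<in> unit_ball \<Longrightarrow> cmod (\<phi> f) \<le> 1" and \<epsilon>: "\<epsilon> > 0"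
  shows "\<exists>x\<in>vectors H. \<exists>y\<in>vectors H. hnorm H x \<le> 1 + \<epsilon> \<and> hnorm H y \<le> 1 + \<epsilon> \<and>
    (\<forall>f\<in>A. \<phi> f = inner_prod H (\<lambda>z. f z * x z) y)"
proof -
  \<comment> \<open>\<open>c n\<close> bounds the \<open>n\<close>-th step, and \<open>e n\<close> the error before it: \<open>e n + e (Suc n) \<le> (c n)\<^sup>2\<close>\<close>
  define c where "c n = \<epsilon> / 2 / 2 ^ Suc n" for n :: nat
  define e where "e n = (c n)\<^sup>2 / 2" for n
  have c0: "c n > 0" for n using \<epsilon> by (simp add: c_def)
  have e0: "e n > 0" for n using c0[of n] by (simp add: e_def)
  have e_Suc: "e (Suc n) \<le> e n" for n
  proof -
    have "c (Suc n) \<le> c n" using \<epsilon> by (simp add: c_def field_simps)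
    then show ?thesis using power_mono[of "c (Suc n)" "c n" 2] c0[of "Suc n"] by (simp add: e_def)
  qed
  define P where "P n xy \<longleftrightarrow> fst xy \<in> vectors H \<and> snd xy \<in> vectors H \<and>
    (\<forall>f\<in>unit_ball. cmod (\<phi> f - inner_prod H (\<lambda>z. f z * fst xy z) (snd xy)) \<le> e n) \<and>
    (n = 0 \<longrightarrow> hnorm H (fst xy) \<le> 1 + \<epsilon> / 2 \<and> hnorm H (snd xy) \<le> 1 + \<epsilon> / 2)"
    for n and xy :: "(complex \<Rightarrow> complex) \<times> (complex \<Rightarrow> complex)"
  define Q where "Q n xy xy' \<longleftrightarrow> hnorm H (\<lambda>z. fst xy' z - fst xy z) \<le> c n \<and>
    hnorm H (\<lambda>z. snd xy' z - snd xy z) \<le> c n"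
    for n and xy xy' :: "(complex \<Rightarrow> complex) \<times> (complex \<Rightarrow> complex)"
  have "\<exists>s. \<forall>n. P n (s n) \<and> Q n (s n) (s (Suc n))"
  proof (rule dependent_nat_choice)
    define \<eta> where "\<eta> = min (e 0) \<epsilon>"
    have \<eta>: "\<eta> > 0" "\<eta> \<le> e 0" "\<eta> \<le> \<epsilon>" using e0 \<epsilon> by (auto simp: \<eta>_def)
    have "\<exists>x\<in>vectors H. \<exists>y\<in>vectors H. (hnorm H x)\<^sup>2 \<le> 1 + \<eta> \<and> (hnorm H y)\<^sup>2 \<le> 1 + \<eta> \<and>
        (\<forall>f\<in>unit_ball. cmod (\<phi> f - (inner_prod H (\<lambda>z. f z * (0 + x z)) (\<lambda>z. 0 + y z) -
          inner_prod H (\<lambda>z. f z * 0) (\<lambda>_. 0))) \<le> \<eta>)"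
      by (rule approximate_factorization[OF \<phi> zero_less_one _ zero_mem zero_mem \<eta>(1)]) (rule \<phi>1)
    then obtain x y where V: "x \<in> vectors H" "y \<in> vectors H"
      and n: "(hnorm H x)\<^sup>2 \<le> 1 + \<eta>" "(hnorm H y)\<^sup>2 \<le> 1 + \<eta>"
      and ap: "\<forall>f\<in>unit_ball. cmod (\<phi> f - (inner_prod H (\<lambda>z. f z * (0 + x z)) (\<lambda>z. 0 + y z) -
        inner_prod H (\<lambda>z. f z * 0) (\<lambda>_. 0))) \<le> \<eta>"
      by (elim bexE conjE)
    have sq: "t \<le> 1 + \<epsilon> / 2" if "t\<^sup>2 \<le> 1 + \<eta>" for t
    proof (rule power2_le_imp_le)
      have "(1 + \<epsilon> / 2)\<^sup>2 = 1 + \<epsilon> + (\<epsilon> / 2)\<^sup>2" by (simp add: power2_sum)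
      then show "t\<^sup>2 \<le> (1 + \<epsilon> / 2)\<^sup>2"
        using that \<eta>(3) zero_le_power2[of "\<epsilon> / 2"] by linarith
    qed (use \<epsilon> in simp)
    have "P 0 (x, y)"
      using V ap \<eta>(2) sq[OF n(1)] sq[OF n(2)] by (force simp: P_def ip_zero_left zero_mem)
    then show "\<exists>xy. P 0 xy" by blast
  next
    fix xy n assume P: "P n xy"
    obtain x y where xy: "xy = (x, y)" by (cases xy)
    have V: "x \<in> vectors H" "y \<in> vectors H" using P by (auto simp: P_def xy)
    obtain x' y' where V': "x' \<in> vectors H" "y' \<in> vectors H"
      and n: "(hnorm H x')\<^sup>2 \<le> e n + e (Suc n)" "(hnorm H y')\<^sup>2 \<le> e n + e (Suc n)"
      and ap: "\<forall>f\<in>unit_ball. cmod (\<phi> f - inner_prod H (\<lambda>z. f z * x z) y -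
        (inner_prod H (\<lambda>z. f z * (x z + x' z)) (\<lambda>z. y z + y' z) - inner_prod H (\<lambda>z. f z * x z) y)) \<le> e (Suc n)"
      using approximate_factorization[OF normal_functional_diff_ip[OF \<phi> V] e0[of n] _ V e0[of "Suc n"]] P
      by (auto simp: P_def xy)
    have sq: "t \<le> c n" if "t\<^sup>2 \<le> e n + e (Suc n)" for t
    proof (rule power2_le_imp_le)
      show "t\<^sup>2 \<le> (c n)\<^sup>2" using that e_Suc[of n] by (simp add: e_def)
    qed (use c0[of n] in simp)
    have "P (Suc n) (\<lambda>z. x z + x' z, \<lambda>z. y z + y' z)"
      using ap add_mem[OF V(1) V'(1)] add_mem[OF V(2) V'(2)] by (simp add: P_def)
    moreover have "Q n xy (\<lambda>z. x z + x' z, \<lambda>z. y z + y' z)"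
      using sq[OF n(1)] sq[OF n(2)] by (simp add: Q_def xy)
    ultimately show "\<exists>xy'. P (Suc n) xy' \<and> Q n xy xy'" by blast
  qed
  then obtain s where P: "\<And>n. P n (s n)" and Q: "\<And>n. Q n (s n) (s (Suc n))" by auto
  have sV: "fst (s n) \<in> vectors H" "snd (s n) \<in> vectors H" for n using P[of n] by (auto simp: P_def)
  have lim: "\<exists>l\<in>vectors H. (\<lambda>n. hnorm H (\<lambda>z. fst (s n) z - l z)) \<longlonglongrightarrow> 0 \<and>
      hnorm H (\<lambda>z. l z - fst (s 0) z) \<le> \<epsilon> / 2"
    by (rule geometric_limit[OF sV(1)]) (use Q in \<open>simp add: Q_def c_def\<close>)
  then obtain x where xV: "x \<in> vectors H" and xlim: "(\<lambda>n. hnorm H (\<lambda>z. fst (s n) z - x z)) \<longlonglongrightarrow> 0"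
    and x0: "hnorm H (\<lambda>z. x z - fst (s 0) z) \<le> \<epsilon> / 2" by auto
  have lim: "\<exists>l\<in>vectors H. (\<lambda>n. hnorm H (\<lambda>z. snd (s n) z - l z)) \<longlonglongrightarrow> 0 \<and>
      hnorm H (\<lambda>z. l z - snd (s 0) z) \<le> \<epsilon> / 2"
    by (rule geometric_limit[OF sV(2)]) (use Q in \<open>simp add: Q_def c_def\<close>)
  then obtain y where yV: "y \<in> vectors H" and ylim: "(\<lambda>n. hnorm H (\<lambda>z. snd (s n) z - y z)) \<longlonglongrightarrow> 0"
    and y0: "hnorm H (\<lambda>z. y z - snd (s 0) z) \<le> \<epsilon> / 2" by auto
  have nx: "hnorm H x \<le> 1 + \<epsilon>"
    using hnorm_le_add_diff[OF xV sV(1)[of 0]] x0 P[of 0] by (simp add: P_def)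
  have ny: "hnorm H y \<le> 1 + \<epsilon>"
    using hnorm_le_add_diff[OF yV sV(2)[of 0]] y0 P[of 0] by (simp add: P_def)
  have e_lim: "e \<longlonglongrightarrow> 0"
  proof -
    have "(\<lambda>n. ((\<epsilon> / 4) * (1 / 2) ^ n)\<^sup>2 / 2) \<longlonglongrightarrow> ((\<epsilon> / 4) * 0)\<^sup>2 / 2"
      by (intro tendsto_intros LIMSEQ_realpow_zero) auto
    then show ?thesis by (simp add: e_def[abs_def] c_def power_divide field_simps)
  qed
  have eq_ball: "\<phi> f = inner_prod H (\<lambda>z. f z * x z) y" if f: "f \<in> unit_ball" for f
  proof -
    have fA: "f \<in> A" by (rule unit_ball_A[OF f])
    have 1: "(\<lambda>n. inner_prod H (\<lambda>z. f z * fst (s n) z) (snd (s n))) \<longlonglongrightarrow> inner_prod H (\<lambda>z. f z * x z) y"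
      by (rule tendsto_ip[OF _ _ _ _ tendsto_mult_op[OF fA sV(1) xV xlim] ylim])
        (intro mult_mem fA sV xV yV)+
    have "(\<lambda>n. \<phi> f - inner_prod H (\<lambda>z. f z * fst (s n) z) (snd (s n))) \<longlonglongrightarrow> 0"
      by (rule Lim_null_comparison[OF _ e_lim]) (use P f in \<open>auto simp: P_def\<close>)
    from tendsto_diff[OF tendsto_const[of "\<phi> f"] this]
    have "(\<lambda>n. inner_prod H (\<lambda>z. f z * fst (s n) z) (snd (s n))) \<longlonglongrightarrow> \<phi> f" by simp
    then show ?thesis using 1 by (rule LIMSEQ_unique)
  qed
  have "\<phi> f = inner_prod H (\<lambda>z. f z * x z) y" if f: "f \<in> A" for f
  proof -
    obtain t0 where t0: "t0 \<ge> 0" "\<forall>z\<in>points H. cmod (f z) \<le> t0" using A_bounded[OF f] by auto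
    define t where "t = t0 + 1"
    have t: "t > 0" "\<forall>z\<in>points H. cmod (f z) \<le> t" using t0 by (auto simp: t_def)
    have "\<phi> (\<lambda>z. of_real (1 / t) * f z) - inner_prod H (\<lambda>z. of_real (1 / t) * f z * x z) y = 0"
      using eq_ball[OF scale_into_unit_ball[OF f t]] by simp
    then have "of_real (1 / t) * (\<phi> f - inner_prod H (\<lambda>z. f z * x z) y) = 0"
      unfolding normal_functionalD(2)[OF normal_functional_diff_ip[OF \<phi> xV yV] f, of "of_real (1 / t)"] .
    then show ?thesis using t(1) by simp
  qed
  then show ?thesis using xV yV nx ny by blast
qed

end

section \<open>The distance to the ideal of a finite set\<close>

text \<open>The values on a finite set of the functions in a linear space form a finite dimensional space, so
they can be attained with a linear bound for the supremum norm. The induction passes to the subspace of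
functions that vanish at one of the points.\<close>

lemma bounded_interpolation:
  fixes B :: "('x \<Rightarrow> complex) set"
  assumes "finite E"
    and "\<And>f g. \<lbrakk>f \<in> B; g \<in> B\<rbrakk> \<Longrightarrow> (\<lambda>x. f x + g x) \<in> B"
    and "\<And>c f. f \<in> B \<Longrightarrow> (\<lambda>x. c * f x) \<in> B"
    and "\<And>f. f \<in> B \<Longrightarrow> \<exists>t\<ge>0. \<forall>x\<in>D. cmod (f x) \<le> t"
  shows "\<exists>C\<ge>0. \<forall>h\<in>B. \<forall>m\<ge>0. (\<forall>x\<in>E. cmod (h x) \<le> m) \<longrightarrow>
    (\<exists>h'\<in>B. (\<forall>x\<in>E. h' x = h x) \<and> (\<forall>x\<in>D. cmod (h' x) \<le> C * m))"
  using assms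
proof (induction E arbitrary: B rule: finite_induct)
  case empty
  have "\<exists>h'\<in>B. \<forall>x\<in>D. cmod (h' x) \<le> 0 * m" if "h \<in> B" for h m
    using empty(2)[OF that, of 0] by (intro bexI[of _ "\<lambda>x. 0 * h x"]) auto
  then show ?case by (intro exI[of _ 0]) auto
next
  case (insert w E)
  note add = insert.prems(1) and scale = insert.prems(2) and bdd = insert.prems(3)
  define B0 where "B0 = {h \<in> B. h w = 0}"
  have "\<exists>C\<ge>0. \<forall>h\<in>B0. \<forall>m\<ge>0. (\<forall>x\<in>E. cmod (h x) \<le> m) \<longrightarrow>
      (\<exists>h'\<in>B0. (\<forall>x\<in>E. h' x = h x) \<and> (\<forall>x\<in>D. cmod (h' x) \<le> C * m))"
    by (rule insert.IH) (auto simp: B0_def intro: add scale bdd)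
  then obtain C where C0: "C \<ge> 0" and C: "\<And>h m. \<lbrakk>h \<in> B0; m \<ge> 0; \<forall>x\<in>E. cmod (h x) \<le> m\<rbrakk> \<Longrightarrow>
      \<exists>h'\<in>B0. (\<forall>x\<in>E. h' x = h x) \<and> (\<forall>x\<in>D. cmod (h' x) \<le> C * m)"
    by blast
  show ?case
  proof (cases "\<forall>h\<in>B. h w = 0")
    case True
    then have "B0 = B" by (auto simp: B0_def)
    show ?thesis
    proof (intro exI[of _ C] conjI ballI allI impI C0)
      fix h m assume *: "h \<in> B" "0 \<le> m" "\<forall>x\<in>insert w E. cmod (h x) \<le> m"
      then obtain h' where h': "h' \<in> B0" "\<forall>x\<in>E. h' x = h x" "\<forall>x\<in>D. cmod (h' x) \<le> C * m"
        using C[of h m] \<open>B0 = B\<close> by auto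
      then show "\<exists>h'\<in>B. (\<forall>x\<in>insert w E. h' x = h x) \<and> (\<forall>x\<in>D. cmod (h' x) \<le> C * m)"
        using True *(1) by (intro bexI[of _ h']) (auto simp: B0_def)
    qed
  next
    case False
    then obtain g0 where g0: "g0 \<in> B" "g0 w \<noteq> 0" by auto
    define g where "g = (\<lambda>x. inverse (g0 w) * g0 x)"
    have g: "g \<in> B" "g w = 1" using g0 scale by (auto simp: g_def)
    obtain t where t: "t \<ge> 0" "\<forall>x\<in>D. cmod (g x) \<le> t" using bdd[OF g(1)] by auto
    define M where "M = (\<Sum>x\<in>E. cmod (g x))"
    have M: "cmod (g x) \<le> M" if "x \<in> E" for x
      unfolding M_def by (rule member_le_sum[OF that]) (use insert.hyps in auto)
    have M0: "M \<ge> 0" unfolding M_def by (rule sum_nonneg) simp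
    show ?thesis
    proof (intro exI[of _ "C * (1 + M) + t"] conjI ballI allI impI)
      show "0 \<le> C * (1 + M) + t" using C0 M0 t(1) by simp
      fix h m assume h: "h \<in> B" and m: "0 \<le> m" and hm: "\<forall>x\<in>insert w E. cmod (h x) \<le> m"
      define h0 where "h0 = (\<lambda>x. h x + (- h w) * g x)"
      have h0: "h0 \<in> B0" using add[OF h scale[OF g(1), of "- h w"]] g(2) by (simp add: B0_def h0_def)
      have hw: "cmod (h w) \<le> m" using hm by simp
      have "cmod (h0 x) \<le> m * (1 + M)" if x: "x \<in> E" for x
      proof -
        have "cmod (h0 x) \<le> cmod (h x) + cmod (h w) * cmod (g x)"
          unfolding h0_def using norm_triangle_ineq[of "h x" "- h w * g x"] by (simp add: norm_mult)
        also have "\<dots> \<le> m + m * M"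
          using hm hw x M[OF x] m M0 by (intro add_mono mult_mono) auto
        finally show ?thesis by (simp add: algebra_simps)
      qed
      then obtain h1 where h1: "h1 \<in> B0" "\<forall>x\<in>E. h1 x = h0 x" "\<forall>x\<in>D. cmod (h1 x) \<le> C * (m * (1 + M))"
        using C[OF h0, of "m * (1 + M)"] m M0 by auto
      show "\<exists>h'\<in>B. (\<forall>x\<in>insert w E. h' x = h x) \<and> (\<forall>x\<in>D. cmod (h' x) \<le> (C * (1 + M) + t) * m)"
      proof (intro bexI[of _ "\<lambda>x. h1 x + h w * g x"] conjI ballI)
        show "(\<lambda>x. h1 x + h w * g x) \<in> B" using h1(1) by (intro add scale g) (simp add: B0_def)
        show "h1 x + h w * g x = h x" if "x \<in> insert w E" for x
          using that h1 g(2) by (auto simp: B0_def h0_def)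
        fix x assume x: "x \<in> D"
        have "cmod (h1 x + h w * g x) \<le> C * (m * (1 + M)) + m * t"
          using norm_triangle_ineq[of "h1 x" "h w * g x"] h1(3) x mult_mono[OF hw, of "cmod (g x)" t] t m
          by (fastforce simp: norm_mult)
        then show "cmod (h1 x + h w * g x) \<le> (C * (1 + M) + t) * m" by (simp add: algebra_simps)
      qed
    qed
  qed
qed

context analytic_multiplier_algebra
begin

lemma ideal_dist_le:
  assumes f: "f \<in> A" and g: "g \<in> vanishing_ideal A E"
    and t: "0 \<le> t" "\<And>z. z \<in> points H \<Longrightarrow> cmod (f z - g z) \<le> t"
  shows "ideal_dist H A E f \<le> t"
proof -
  let ?T = "\<lambda>g h x. mult_op H f h x - mult_op H g h x"
  have T: "?T g h = (\<lambda>x. (f x - g x) * h x)" if "h \<in> vectors H" for g h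
    using that by (simp add: mult_op_eq left_diff_distrib)
  have dA: "(\<lambda>z. f z - g z) \<in> A" if "g \<in> vanishing_ideal A E" for g
    using A_diff[OF f] that vanishing_ideal_subset by auto
  have "0 \<le> op_norm H (vectors H) (?T g)" if g: "g \<in> vanishing_ideal A E" for g
    by (rule op_norm_nonneg[OF dA[OF g] T])
  then have "ideal_dist H A E f \<le> op_norm H (vectors H) (?T g)"
    unfolding ideal_dist_def by (intro cINF_lower[OF _ g] bdd_belowI2[of _ 0])
  also have "\<dots> \<le> t"
    unfolding op_norm_def
  proof (rule cSUP_least)
    show "{v \<in> vectors H. hnorm H v \<le> 1} \<noteq> {}" using zero_mem by (auto simp: hnorm_zero)
    fix v assume v: "v \<in> {v \<in> vectors H. hnorm H v \<le> 1}"
    then have "hnorm H (?T g v) \<le> t * hnorm H v"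
      using hnorm_mult_le[OF dA[OF g] t(1) t(2), of v] by (simp add: T)
    also have "\<dots> \<le> t * 1" using v t(1) by (intro mult_left_mono) auto
    finally show "hnorm H (?T g v) \<le> t" by simp
  qed
  finally show ?thesis .
qed

text \<open>The quotient norm is dominated by the supremum over $E$ times a constant, by
\<open>bounded_interpolation\<close>. So \<open>functional_near_point_evaluations\<close>, applied to the zero functional with the
point \<open>f\<close>, yields a combination of evaluations of norm at most \<open>1\<close> that is large at \<open>f\<close>.\<close>

lemma ideal_dist_functional:
  assumes E: "finite E" "E \<subseteq> points H" and f: "f \<in> A"
  shows "\<exists>c. (\<forall>h\<in>unit_ball. cmod (\<Sum>w\<in>E. c w * h w) \<le> 1) \<and>
    ideal_dist H A E f \<le> cmod (\<Sum>w\<in>E. c w * f w)"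
proof -
  define s where "s = ideal_dist H A E f"
  have "\<exists>C\<ge>0. \<forall>h\<in>A. \<forall>m\<ge>0. (\<forall>x\<in>E. cmod (h x) \<le> m) \<longrightarrow>
      (\<exists>h'\<in>A. (\<forall>x\<in>E. h' x = h x) \<and> (\<forall>x\<in>points H. cmod (h' x) \<le> C * m))"
    by (rule bounded_interpolation[OF E(1)]) (auto intro: A_add A_scale A_bounded)
  then obtain C where C0: "C \<ge> 0" and C: "\<And>h m. \<lbrakk>h \<in> A; m \<ge> 0; \<forall>x\<in>E. cmod (h x) \<le> m\<rbrakk> \<Longrightarrow>
      \<exists>h'\<in>A. (\<forall>x\<in>E. h' x = h x) \<and> (\<forall>x\<in>points H. cmod (h' x) \<le> C * m)" by blast
  have "\<exists>c. (\<Sum>x\<in>E. cmod (c x)) \<le> C \<and> s \<le> Re (\<Sum>x\<in>E. c x * f x) \<and>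
      (\<forall>h\<in>A. \<forall>t\<ge>0. (\<forall>x\<in>points H. cmod (h x) \<le> t) \<longrightarrow> cmod ((\<Sum>x\<in>E. c x * h x) - 0) \<le> 1 * t)"
  proof (rule functional_near_point_evaluations[OF A_zero A_add A_scale _ _ E(1) C0, of "\<lambda>_. 0"])
    fix h m t assume h: "h \<in> A" and m: "0 \<le> m" and t: "0 \<le> t" "\<forall>x\<in>points H. cmod (h x) \<le> t"
      and fh: "\<forall>x\<in>E. cmod (f x - h x) \<le> m"
    obtain h' where h': "h' \<in> A" "\<forall>x\<in>E. h' x = f x - h x" "\<forall>x\<in>points H. cmod (h' x) \<le> C * m"
      using C[OF A_diff[OF f h] m fh] by auto
    have "s \<le> C * m + 1 * t"
      unfolding s_def
    proof (rule ideal_dist_le[OF f])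
      show "(\<lambda>x. f x - (h x + h' x)) \<in> vanishing_ideal A E"
        using A_diff[OF f A_add[OF h h'(1)]] h'(2) by (simp add: vanishing_ideal_def)
      show "0 \<le> C * m + 1 * t" using C0 m t by simp
      show "cmod (f z - (f z - (h z + h' z))) \<le> C * m + 1 * t" if "z \<in> points H" for z
        using norm_triangle_ineq[of "h z" "h' z"] t(2) h'(3) that by fastforce
    qed
    then show "s \<le> C * m + 1 * t + Re 0" by simp
  qed (use C0 in auto)
  then obtain c where c: "s \<le> Re (\<Sum>x\<in>E. c x * f x)"
    "\<And>h t. \<lbrakk>h \<in> A; t \<ge> 0; \<forall>x\<in>points H. cmod (h x) \<le> t\<rbrakk> \<Longrightarrow> cmod (\<Sum>x\<in>E. c x * h x) \<le> t"
    by auto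
  have "cmod (\<Sum>x\<in>E. c x * h x) \<le> 1" if "h \<in> unit_ball" for h
    using c(2)[of h 1] that by (simp add: unit_ball_def)
  moreover have "s \<le> cmod (\<Sum>x\<in>E. c x * f x)"
    using c(1) complex_Re_le_cmod[of "\<Sum>x\<in>E. c x * f x"] by linarith
  ultimately show ?thesis unfolding s_def by blast
qed

lemma normal_point_evaluations:
  assumes E: "E \<subseteq> points H"
  shows "normal_functional (\<lambda>f. \<Sum>w\<in>E. c w * f w)"
  unfolding normal_functional_def
proof (intro conjI ballI allI impI)
  fix F :: "nat \<Rightarrow> complex \<Rightarrow> complex" and g
  assume "\<forall>z\<in>points H. (\<lambda>n. F n z) \<longlonglongrightarrow> g z"
  then show "(\<lambda>n. \<Sum>w\<in>E. c w * F n w) \<longlonglongrightarrow> (\<Sum>w\<in>E. c w * g w)"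
    using E by (intro tendsto_intros) auto
qed (simp_all add: distrib_left sum.distrib sum_distrib_left mult_ac)

theorem cyclic_kernels_nevanlinna_pick:
  assumes "cyclic_kernels H A k"
  shows "nevanlinna_pick_family H A k"
proof (rule nevanlinna_pick_familyI[OF assms])
  fix E f and \<epsilon> :: real
  assume E: "finite E" "E \<subseteq> points H" and f: "f \<in> A" and \<epsilon>: "\<epsilon> > 0"
  obtain c where c1: "\<And>h. h \<in> unit_ball \<Longrightarrow> cmod (\<Sum>w\<in>E. c w * h w) \<le> 1"
    and cf: "ideal_dist H A E f \<le> cmod (\<Sum>w\<in>E. c w * f w)"
    using ideal_dist_functional[OF E f] by auto
  have "\<exists>x\<in>vectors H. \<exists>y\<in>vectors H. hnorm H x \<le> 1 + \<epsilon> \<and> hnorm H y \<le> 1 + \<epsilon> \<and>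
      (\<forall>f\<in>A. (\<Sum>w\<in>E. c w * f w) = inner_prod H (\<lambda>z. f z * x z) y)"
    by (rule factorization[OF normal_point_evaluations[OF E(2)] _ \<epsilon>]) (rule c1)
  then obtain x y where V: "x \<in> vectors H" "y \<in> vectors H" "hnorm H x \<le> 1 + \<epsilon>" "hnorm H y \<le> 1 + \<epsilon>"
    and eq: "\<forall>f\<in>A. (\<Sum>w\<in>E. c w * f w) = inner_prod H (\<lambda>z. f z * x z) y" by (elim bexE conjE)
  have "inner_prod H (\<lambda>z. g z * x z) y = 0" if g: "g \<in> vanishing_ideal A E" for g
  proof -
    have gA: "g \<in> A" using g vanishing_ideal_subset by auto
    show ?thesis
      unfolding bspec[OF eq gA, symmetric] using g by (simp add: vanishing_ideal_def)
  qed
  moreover have "ideal_dist H A E f \<le> cmod (inner_prod H (\<lambda>z. f z * x z) y)"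
    using cf unfolding bspec[OF eq f] .
  ultimately show "\<exists>x\<in>vectors H. \<exists>y\<in>vectors H. hnorm H x \<le> 1 + \<epsilon> \<and> hnorm H y \<le> 1 + \<epsilon> \<and>
        (\<forall>g\<in>vanishing_ideal A E. inner_prod H (\<lambda>z. g z * x z) y = 0) \<and>
        ideal_dist H A E f \<le> cmod (inner_prod H (\<lambda>z. f z * x z) y)"
    using V by blast
qed

end

section \<open>The space $P^2(\mu)$ on the disk\<close>

locale disk_measure =
  fixes \<mu> :: "complex measure"
  assumes finite_measure: "finite_measure \<mu>"
    and sets_eq: "sets \<mu> = sets (restrict_space borel (ball 0 1))"
    and point_evaluations: "ball 0 1 \<subseteq> analytic_bounded_point_evaluations \<mu>"
begin

abbreviation D :: "complex set" where "D \<equiv> ball 0 1"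

lemma space_eq: "space \<mu> = D"
  using sets_eq_imp_space_eq[OF sets_eq] by (simp add: space_restrict_space)

lemma poly_L2: "poly p \<in> L2 \<mu>"
proof (rule L2_I)
  have "poly p \<in> borel_measurable borel"
    by (intro borel_measurable_continuous_onI continuous_intros)
  then show meas: "poly p \<in> borel_measurable \<mu>"
    unfolding measurable_cong_sets[OF sets_eq refl] by (rule measurable_restrict_space1)
  have "compact (poly p ` cball 0 1)"
    by (intro compact_continuous_image continuous_intros compact_cball)
  then have "bounded (poly p ` cball 0 1)" by (rule compact_imp_bounded)
  then obtain B where B: "\<forall>y\<in>poly p ` cball 0 1. cmod y \<le> B"
    unfolding bounded_iff by (elim exE)
  show "integrable \<mu> (\<lambda>z. (cmod (poly p z))\<^sup>2)"
  proof (rule finite_measure.integrable_const_bound[OF finite_measure, of _ "B\<^sup>2"])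
    show "AE z in \<mu>. norm ((cmod (poly p z))\<^sup>2) \<le> B\<^sup>2"
    proof (rule AE_I2)
      fix z assume "z \<in> space \<mu>"
      then have "cmod (poly p z) \<le> B" by (intro bspec[OF B] imageI) (simp add: space_eq)
      then show "norm ((cmod (poly p z))\<^sup>2) \<le> B\<^sup>2" by (simp add: power_mono)
    qed
  qed (use meas in measurable)
qed

lemma poly_evaluation_bound:
  assumes "z \<in> D"
  shows "\<exists>M. M > 0 \<and> (\<forall>p :: complex poly. cmod (poly p z) \<le> M * L2_norm \<mu> (poly p))"
proof -
  have "z \<in> interior (bounded_point_evaluations \<mu>)"
    using subsetD[OF point_evaluations assms] by (simp add: analytic_bounded_point_evaluations_def)
  then have "z \<in> bounded_point_evaluations \<mu>" by (rule subsetD[OF interior_subset])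
  then show ?thesis by (auto simp: bounded_point_evaluations_def)
qed

lemma poly_diff_fun: "(\<lambda>z. poly p z - poly q z) = poly (p - q)" for p q :: "complex poly"
  by (simp add: fun_eq_iff)

lemma L2_norm_cong: "(\<And>z. z \<in> D \<Longrightarrow> f z = g z) \<Longrightarrow> L2_norm \<mu> f = L2_norm \<mu> g"
  unfolding L2_norm_def by (intro arg_cong[of _ _ sqrt] Bochner_Integration.integral_cong) (auto simp: space_eq)

lemma L2_norm_triangle:
  "\<lbrakk>a \<in> L2 \<mu>; b \<in> L2 \<mu>; u \<in> L2 \<mu>\<rbrakk> \<Longrightarrow>
    L2_norm \<mu> (\<lambda>x. a x - u x) \<le> L2_norm \<mu> (\<lambda>x. a x - b x) + L2_norm \<mu> (\<lambda>x. b x - u x)"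
  using L2.hnorm_triangle_diff[of a \<mu> b u] by (simp add: hnorm_L2_space)

lemma L2_norm_commute:
  "\<lbrakk>a \<in> L2 \<mu>; b \<in> L2 \<mu>\<rbrakk> \<Longrightarrow> L2_norm \<mu> (\<lambda>x. a x - b x) = L2_norm \<mu> (\<lambda>x. b x - a x)"
  using L2.hnorm_commute[of a \<mu> b] by (simp add: hnorm_L2_space)

lemma L2_diff: "\<lbrakk>a \<in> L2 \<mu>; b \<in> L2 \<mu>\<rbrakk> \<Longrightarrow> (\<lambda>x. a x - b x) \<in> L2 \<mu>"
  using L2.diff_mem[of a \<mu> b] by simp

text \<open>Convergence in $L^2(\mu)$ and at every point of the disk at once. The pointwise part singles out one
representative of the limit.\<close>

definition polynomials_converge :: "(nat \<Rightarrow> complex poly) \<Rightarrow> (complex \<Rightarrow> complex) \<Rightarrow> bool" where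
  "polynomials_converge p g \<longleftrightarrow> (\<forall>z. z \<notin> D \<longrightarrow> g z = 0) \<and> g \<in> L2 \<mu> \<and>
    (\<lambda>n. L2_norm \<mu> (\<lambda>z. g z - poly (p n) z)) \<longlonglongrightarrow> 0 \<and>
    (\<forall>z\<in>D. (\<lambda>n. poly (p n) z) \<longlonglongrightarrow> g z)"

lemma polynomials_convergeD:
  assumes "polynomials_converge p g"
  shows "z \<notin> D \<Longrightarrow> g z = 0" "g \<in> L2 \<mu>" "(\<lambda>n. L2_norm \<mu> (\<lambda>z. g z - poly (p n) z)) \<longlonglongrightarrow> 0"
    "z \<in> D \<Longrightarrow> (\<lambda>n. poly (p n) z) \<longlonglongrightarrow> g z"
  using assms by (auto simp: polynomials_converge_def)

text \<open>A Cauchy sequence of polynomials converges at every point of the disk, since the points are bounded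
point evaluations. The pointwise limit is the limit in norm, by Fatou's lemma.\<close>

lemma polynomial_limit:
  fixes p :: "nat \<Rightarrow> complex poly"
  assumes cau: "\<And>e. e > 0 \<Longrightarrow> \<exists>N. \<forall>m\<ge>N. \<forall>n\<ge>N. L2_norm \<mu> (\<lambda>z. poly (p m) z - poly (p n) z) < e"
  shows "\<exists>g. polynomials_converge p g"
proof -
  have conv: "\<exists>l. (\<lambda>n. poly (p n) z) \<longlonglongrightarrow> l" if z: "z \<in> D" for z
  proof -
    obtain M where M: "M > 0" "\<And>p :: complex poly. cmod (poly p z) \<le> M * L2_norm \<mu> (poly p)"
      using poly_evaluation_bound[OF z] by auto
    have "Cauchy (\<lambda>n. poly (p n) z)"
    proof (rule metric_CauchyI)
      fix e :: real assume e: "e > 0"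
      obtain N where N: "\<forall>m\<ge>N. \<forall>n\<ge>N. L2_norm \<mu> (\<lambda>z. poly (p m) z - poly (p n) z) < e / M"
        using cau[of "e / M"] e M(1) by auto
      have "dist (poly (p m) z) (poly (p n) z) < e" if "m \<ge> N" "n \<ge> N" for m n
      proof -
        have "dist (poly (p m) z) (poly (p n) z) \<le> M * L2_norm \<mu> (poly (p m - p n))"
          using M(2)[of "p m - p n"] by (simp add: dist_norm)
        also have "L2_norm \<mu> (poly (p m - p n)) < e / M"
          using N that by (simp only: poly_diff_fun)
        finally show ?thesis using M(1) by (simp add: field_simps)
      qed
      then show "\<exists>N. \<forall>m\<ge>N. \<forall>n\<ge>N. dist (poly (p m) z) (poly (p n) z) < e" by blast
    qed
    then show ?thesis by (simp add: Cauchy_convergent_iff convergent_def)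
  qed
  define g where "g z = (if z \<in> D then lim (\<lambda>n. poly (p n) z) else 0)" for z
  have lim: "(\<lambda>n. poly (p n) z) \<longlonglongrightarrow> g z" if "z \<in> D" for z
    using conv[OF that] that limI by (fastforce simp: g_def)
  have fatou: "(\<lambda>z. poly (p n) z - g z) \<in> L2 \<mu> \<and> L2_norm \<mu> (\<lambda>z. poly (p n) z - g z) \<le> e"
    if N: "\<forall>m\<ge>N. \<forall>n\<ge>N. L2_norm \<mu> (\<lambda>z. poly (p m) z - poly (p n) z) < e" and n: "n \<ge> N" for n N e
  proof -
    have mem: "(\<lambda>z. poly (p n) z - poly (p (m + N)) z) \<in> L2 \<mu>" for m
      unfolding poly_diff_fun by (rule poly_L2)
    have le: "L2_norm \<mu> (\<lambda>z. poly (p n) z - poly (p (m + N)) z) \<le> e" for m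
      using N[rule_format, OF n, of "m + N"] by simp
    have "(\<lambda>m. poly (p n) z - poly (p (m + N)) z) \<longlonglongrightarrow> poly (p n) z - g z" if "z \<in> space \<mu>" for z
      by (intro tendsto_intros LIMSEQ_ignore_initial_segment lim) (use that in \<open>simp add: space_eq\<close>)
    from L2_Fatou[OF mem le this] show ?thesis by blast
  qed
  have "g \<in> L2 \<mu>"
  proof -
    obtain N where N: "\<forall>m\<ge>N. \<forall>n\<ge>N. L2_norm \<mu> (\<lambda>z. poly (p m) z - poly (p n) z) < 1"
      using cau[of 1] by auto
    have "(\<lambda>z. poly (p N) z - (poly (p N) z - g z)) \<in> L2 \<mu>"
      by (rule L2_diff[OF poly_L2 conjunct1[OF fatou[OF N order_refl]]])
    moreover have "(\<lambda>z. poly (p N) z - (poly (p N) z - g z)) = g" by simp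
    ultimately show ?thesis by (simp only:)
  qed
  moreover have "(\<lambda>n. L2_norm \<mu> (\<lambda>z. poly (p n) z - g z)) \<longlonglongrightarrow> 0"
  proof (rule LIMSEQ_I)
    fix e :: real assume e: "e > 0"
    obtain N where N: "\<forall>m\<ge>N. \<forall>n\<ge>N. L2_norm \<mu> (\<lambda>z. poly (p m) z - poly (p n) z) < e / 2"
      using cau[of "e / 2"] e by auto
    have "norm (L2_norm \<mu> (\<lambda>z. poly (p n) z - g z) - 0) < e" if "n \<ge> N" for n
      using fatou[OF N that] e L2_norm_nonneg[of \<mu> "\<lambda>z. poly (p n) z - g z"] by simp
    then show "\<exists>no. \<forall>n\<ge>no. norm (L2_norm \<mu> (\<lambda>z. poly (p n) z - g z) - 0) < e" by blast
  qed
  ultimately show ?thesis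
    unfolding polynomials_converge_def using lim L2_norm_commute[OF _ poly_L2, of g]
    by (intro exI[of _ g]) (auto simp: g_def)
qed

lemma close_polynomials_Cauchy:
  fixes p :: "nat \<Rightarrow> complex poly"
  assumes s: "\<And>n. s n \<in> L2 \<mu>"
    and cau: "\<And>e. e > 0 \<Longrightarrow> \<exists>N. \<forall>m\<ge>N. \<forall>n\<ge>N. L2_norm \<mu> (\<lambda>z. s m z - s n z) < e"
    and p: "(\<lambda>n. L2_norm \<mu> (\<lambda>z. s n z - poly (p n) z)) \<longlonglongrightarrow> 0" and e: "e > 0"
  shows "\<exists>N. \<forall>m\<ge>N. \<forall>n\<ge>N. L2_norm \<mu> (\<lambda>z. poly (p m) z - poly (p n) z) < e"
proof -
  obtain N1 where N1: "\<forall>m\<ge>N1. \<forall>n\<ge>N1. L2_norm \<mu> (\<lambda>z. s m z - s n z) < e / 3"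
    using cau[of "e / 3"] e by auto
  obtain N2 where N2: "\<forall>n\<ge>N2. L2_norm \<mu> (\<lambda>z. s n z - poly (p n) z) < e / 3"
    using order_tendstoD(2)[OF p, of "e / 3"] e by (auto simp: eventually_sequentially)
  have "L2_norm \<mu> (\<lambda>z. poly (p m) z - poly (p n) z) < e" if "m \<ge> max N1 N2" "n \<ge> max N1 N2" for m n
  proof -
    have "L2_norm \<mu> (\<lambda>z. poly (p m) z - poly (p n) z) \<le>
        L2_norm \<mu> (\<lambda>z. poly (p m) z - s m z) + L2_norm \<mu> (\<lambda>z. s m z - poly (p n) z)"
      by (rule L2_norm_triangle[OF poly_L2 s poly_L2])
    moreover have "L2_norm \<mu> (\<lambda>z. s m z - poly (p n) z) \<le>
        L2_norm \<mu> (\<lambda>z. s m z - s n z) + L2_norm \<mu> (\<lambda>z. s n z - poly (p n) z)"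
      by (rule L2_norm_triangle[OF s s poly_L2])
    moreover have "L2_norm \<mu> (\<lambda>z. poly (p m) z - s m z) = L2_norm \<mu> (\<lambda>z. s m z - poly (p m) z)"
      by (rule L2_norm_commute[OF poly_L2 s])
    moreover have "L2_norm \<mu> (\<lambda>z. s m z - s n z) < e / 3" "L2_norm \<mu> (\<lambda>z. s m z - poly (p m) z) < e / 3"
      "L2_norm \<mu> (\<lambda>z. s n z - poly (p n) z) < e / 3" using N1 N2 that by auto
    ultimately show ?thesis by linarith
  qed
  then show ?thesis by blast
qed

lemma polynomials_close_to:
  assumes s: "\<And>n. s n \<in> P2 \<mu>"
  shows "\<exists>p :: nat \<Rightarrow> complex poly. (\<lambda>n. L2_norm \<mu> (\<lambda>z. s n z - poly (p n) z)) \<longlonglongrightarrow> 0"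
proof -
  have "\<exists>p :: complex poly. L2_norm \<mu> (\<lambda>z. s n z - poly p z) < inverse (real (Suc n))" for n
    using s[of n] by (simp add: P2_def)
  then obtain p :: "nat \<Rightarrow> complex poly"
    where p: "\<And>n. L2_norm \<mu> (\<lambda>z. s n z - poly (p n) z) < inverse (real (Suc n))" by metis
  have "(\<lambda>n. L2_norm \<mu> (\<lambda>z. s n z - poly (p n) z)) \<longlonglongrightarrow> 0"
    by (rule tendsto_sandwich[OF always_eventually always_eventually tendsto_const LIMSEQ_inverse_real_of_nat])
      (rule allI, rule L2_norm_nonneg, rule allI, rule less_imp_le[OF p])
  then show ?thesis by blast
qed

lemma P2_iff: "f \<in> P2 \<mu> \<longleftrightarrow> f \<in> L2 \<mu> \<and>
    (\<exists>p :: nat \<Rightarrow> complex poly. (\<lambda>n. L2_norm \<mu> (\<lambda>z. f z - poly (p n) z)) \<longlonglongrightarrow> 0)"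
proof (intro iffI conjI)
  assume f: "f \<in> P2 \<mu>"
  then show "f \<in> L2 \<mu>" by (simp add: P2_def)
  show "\<exists>p :: nat \<Rightarrow> complex poly. (\<lambda>n. L2_norm \<mu> (\<lambda>z. f z - poly (p n) z)) \<longlonglongrightarrow> 0"
    by (rule polynomials_close_to[of "\<lambda>_. f", OF f])
next
  assume "f \<in> L2 \<mu> \<and> (\<exists>p :: nat \<Rightarrow> complex poly. (\<lambda>n. L2_norm \<mu> (\<lambda>z. f z - poly (p n) z)) \<longlonglongrightarrow> 0)"
  then obtain p :: "nat \<Rightarrow> complex poly" where f: "f \<in> L2 \<mu>"
    and p: "(\<lambda>n. L2_norm \<mu> (\<lambda>z. f z - poly (p n) z)) \<longlonglongrightarrow> 0" by auto
  have "\<exists>q :: complex poly. L2_norm \<mu> (\<lambda>z. f z - poly q z) < e" if "e > 0" for e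
    using order_tendstoD(2)[OF p that] by (auto simp: eventually_sequentially)
  then show "f \<in> P2 \<mu>" using f by (simp add: P2_def)
qed

lemma P2_add_seq:
  assumes L: "a \<in> L2 \<mu>" "b \<in> L2 \<mu>"
    and p: "(\<lambda>n. L2_norm \<mu> (\<lambda>z. a z - poly (p n) z)) \<longlonglongrightarrow> 0"
    and q: "(\<lambda>n. L2_norm \<mu> (\<lambda>z. b z - poly (q n) z)) \<longlonglongrightarrow> 0"
  shows "(\<lambda>n. L2_norm \<mu> (\<lambda>z. (a z + b z) - poly (p n + q n) z)) \<longlonglongrightarrow> 0"
proof (rule tendsto_sandwich[OF always_eventually always_eventually tendsto_const tendsto_add_zero[OF p q]])
  show "\<forall>n. L2_norm \<mu> (\<lambda>z. (a z + b z) - poly (p n + q n) z) \<le>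
      L2_norm \<mu> (\<lambda>z. a z - poly (p n) z) + L2_norm \<mu> (\<lambda>z. b z - poly (q n) z)"
  proof
    fix n
    have "(\<lambda>z. (a z + b z) - poly (p n + q n) z) = (\<lambda>z. (a z - poly (p n) z) + (b z - poly (q n) z))"
      by auto
    then show "L2_norm \<mu> (\<lambda>z. (a z + b z) - poly (p n + q n) z) \<le>
        L2_norm \<mu> (\<lambda>z. a z - poly (p n) z) + L2_norm \<mu> (\<lambda>z. b z - poly (q n) z)"
      using L2.hnorm_triangle[of "\<lambda>z. a z - poly (p n) z" \<mu> "\<lambda>z. b z - poly (q n) z"]
        L2_diff[OF L(1) poly_L2] L2_diff[OF L(2) poly_L2] by (simp add: hnorm_L2_space)
  qed
qed (simp add: L2_norm_nonneg)

lemma P2_scale_seq: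
  assumes L: "a \<in> L2 \<mu>" and p: "(\<lambda>n. L2_norm \<mu> (\<lambda>z. a z - poly (p n) z)) \<longlonglongrightarrow> 0"
  shows "(\<lambda>n. L2_norm \<mu> (\<lambda>z. c * a z - poly (smult c (p n)) z)) \<longlonglongrightarrow> 0"
proof -
  have "L2_norm \<mu> (\<lambda>z. c * a z - poly (smult c (p n)) z) = cmod c * L2_norm \<mu> (\<lambda>z. a z - poly (p n) z)" for n
    using L2.hnorm_scale[of "\<lambda>z. a z - poly (p n) z" \<mu> c] L2_diff[OF L poly_L2]
    by (simp add: hnorm_L2_space right_diff_distrib)
  then show ?thesis using tendsto_mult_right_zero[OF p] by simp
qed

lemma P2_Cauchy_limit:
  assumes s: "\<And>n. s n \<in> P2 \<mu>"
    and cau: "\<And>e. e > 0 \<Longrightarrow> \<exists>N. \<forall>m\<ge>N. \<forall>n\<ge>N. L2_norm \<mu> (\<lambda>z. s m z - s n z) < e"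
  shows "\<exists>g p. polynomials_converge p g \<and> (\<lambda>n. L2_norm \<mu> (\<lambda>z. s n z - g z)) \<longlonglongrightarrow> 0"
proof -
  have sL: "s n \<in> L2 \<mu>" for n using s[of n] by (simp add: P2_def)
  obtain p where p: "(\<lambda>n. L2_norm \<mu> (\<lambda>z. s n z - poly (p n) z)) \<longlonglongrightarrow> 0"
    using polynomials_close_to[of s, OF s] by (elim exE)
  have "\<exists>g. polynomials_converge p g"
    by (rule polynomial_limit[OF close_polynomials_Cauchy[OF sL cau p]])
  then obtain g where g: "polynomials_converge p g" by (elim exE)
  note gL = polynomials_convergeD(2)[OF g]
  have lim: "(\<lambda>n. L2_norm \<mu> (\<lambda>z. poly (p n) z - g z)) \<longlonglongrightarrow> 0"
    using polynomials_convergeD(3)[OF g] unfolding L2_norm_commute[OF gL poly_L2] .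
  have "(\<lambda>n. L2_norm \<mu> (\<lambda>z. s n z - g z)) \<longlonglongrightarrow> 0"
    by (rule tendsto_sandwich[OF always_eventually always_eventually tendsto_const tendsto_add_zero[OF p lim]])
      (auto simp: L2_norm_nonneg intro!: L2_norm_triangle sL gL poly_L2)
  then show ?thesis using g by blast
qed

end

context disk_measure
begin

text \<open>The space \<open>P2_space \<mu>\<close>, described without reference to the kernels. That the two agree can only be seen
once the kernels are known to exist, and for this the completeness of the present space is used.\<close>

definition H :: "complex function_space" where
  "H = \<lparr>points = D, vectors = {g. \<exists>p. polynomials_converge p g}, inner_prod = L2_inner \<mu>\<rparr>"

lemma H_simps: "points H = D" "inner_prod H = L2_inner \<mu>" "vectors H = {g. \<exists>p. polynomials_converge p g}"
  by (simp_all add: H_def)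

lemma hnorm_H: "hnorm H h = L2_norm \<mu> h"
  by (rule hnorm_eq_L2_norm) (simp add: H_simps)

lemma vectors_L2: "g \<in> vectors H \<Longrightarrow> g \<in> L2 \<mu>"
  and vectors_zero: "\<lbrakk>g \<in> vectors H; z \<notin> D\<rbrakk> \<Longrightarrow> g z = 0"
  and vectors_P2: "g \<in> vectors H \<Longrightarrow> g \<in> P2 \<mu>"
  by (auto simp: H_simps polynomials_converge_def P2_iff)

lemma poly_vector: "(\<lambda>z. if z \<in> D then poly p z else 0) \<in> vectors H"
  unfolding H_simps polynomials_converge_def
proof (intro CollectI exI[of _ "\<lambda>_. p"] conjI)
  show "(\<lambda>z. if z \<in> D then poly p z else 0) \<in> L2 \<mu>"
  proof (rule L2_dominated[OF _ poly_L2[of p] zero_le_one])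
    show "(\<lambda>z. if z \<in> D then poly p z else 0) \<in> borel_measurable \<mu>"
      using L2_D(1)[OF poly_L2[of p]] by (subst measurable_cong[of _ _ "poly p"]) (auto simp: space_eq)
  qed simp
  have "L2_norm \<mu> (\<lambda>z. (if z \<in> D then poly p z else 0) - poly p z) = L2_norm \<mu> (\<lambda>z. 0)"
    by (rule L2_norm_cong) simp
  then show "(\<lambda>n. L2_norm \<mu> (\<lambda>z. (if z \<in> D then poly p z else 0) - poly p z)) \<longlonglongrightarrow> 0"
    by (simp add: L2_norm_def)
qed auto

lemma evaluation_bound:
  assumes z: "z \<in> D"
  shows "\<exists>M>0. \<forall>h\<in>vectors H. cmod (h z) \<le> M * L2_norm \<mu> h"
proof -
  obtain M where M: "M > 0" "\<And>p :: complex poly. cmod (poly p z) \<le> M * L2_norm \<mu> (poly p)"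
    using poly_evaluation_bound[OF z] by auto
  have "cmod (h z) \<le> M * L2_norm \<mu> h" if hV: "h \<in> vectors H" for h
  proof -
    obtain p where p: "polynomials_converge p h" using hV by (auto simp: H_simps)
    note hL = polynomials_convergeD(2)[OF p]
    show ?thesis
    proof (rule LIMSEQ_le[OF tendsto_norm[OF polynomials_convergeD(4)[OF p z]]])
      show "(\<lambda>n. M * (L2_norm \<mu> h + L2_norm \<mu> (\<lambda>z. h z - poly (p n) z))) \<longlonglongrightarrow> M * L2_norm \<mu> h"
        using polynomials_convergeD(3)[OF p] by (auto intro!: tendsto_eq_intros)
      have "cmod (poly (p n) z) \<le> M * (L2_norm \<mu> h + L2_norm \<mu> (\<lambda>z. h z - poly (p n) z))" for n
      proof -
        have "L2_norm \<mu> (poly (p n)) \<le> L2_norm \<mu> h + L2_norm \<mu> (\<lambda>z. poly (p n) z - h z)"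
          using L2.hnorm_le_add_diff[of "poly (p n)" \<mu> h] poly_L2 hL by (simp add: hnorm_L2_space)
        also have "L2_norm \<mu> (\<lambda>z. poly (p n) z - h z) = L2_norm \<mu> (\<lambda>z. h z - poly (p n) z)"
          by (rule L2_norm_commute[OF poly_L2 hL])
        finally have "M * L2_norm \<mu> (poly (p n)) \<le> M * (L2_norm \<mu> h + L2_norm \<mu> (\<lambda>z. h z - poly (p n) z))"
          using M(1) by simp
        then show ?thesis using M(2)[of "p n"] by (rule order_trans[rotated])
      qed
      then show "\<exists>N. \<forall>n\<ge>N. cmod (poly (p n) z) \<le> M * (L2_norm \<mu> h + L2_norm \<mu> (\<lambda>z. h z - poly (p n) z))"
        by blast
    qed
  qed
  then show ?thesis using M(1) by blast
qed

lemma H_semi_inner_space: "semi_inner_space H"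
proof
  have "(\<lambda>z. if z \<in> D then poly 0 z else 0) = (\<lambda>_. 0 :: complex)" by auto
  then show "(\<lambda>_. 0) \<in> vectors H" using poly_vector[of 0] by (simp only:)
next
  fix a c assume a: "a \<in> vectors H"
  then obtain p where ap: "polynomials_converge p a" by (auto simp: H_simps)
  note p = polynomials_convergeD[OF ap]
  have "polynomials_converge (\<lambda>n. smult c (p n)) (\<lambda>x. c * a x)"
    unfolding polynomials_converge_def
    using p(1) L2.scale_mem[of a \<mu> c] p(2) P2_scale_seq[OF p(2,3)] tendsto_mult[OF tendsto_const p(4)]
    by auto
  then show "(\<lambda>x. c * a x) \<in> vectors H" by (auto simp: H_simps)
  show "0 \<le> Re (inner_prod H a a)"
    using L2.ip_self_nonneg[of a \<mu>] p(2) by (simp add: H_simps)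
  fix b assume b: "b \<in> vectors H"
  then obtain q where bq: "polynomials_converge q b" by (auto simp: H_simps)
  note q = polynomials_convergeD[OF bq]
  have "polynomials_converge (\<lambda>n. p n + q n) (\<lambda>x. a x + b x)"
    unfolding polynomials_converge_def
    using p(1) q(1) L2.add_mem[of a \<mu> b] p(2) q(2) P2_add_seq[OF p(2) q(2) p(3) q(3)] tendsto_add[OF p(4) q(4)]
    by auto
  then show "(\<lambda>x. a x + b x) \<in> vectors H" by (auto simp: H_simps)
  show "inner_prod H (\<lambda>x. c * a x) b = c * inner_prod H a b"
    using L2.ip_scale_left[of a \<mu> b c] p(2) q(2) by (simp add: H_simps)
  show "cnj (inner_prod H a b) = inner_prod H b a"
    using L2.ip_cnj[of a \<mu> b] p(2) q(2) by (simp add: H_simps)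
  fix u assume "u \<in> vectors H"
  then have "u \<in> L2 \<mu>" by (rule vectors_L2)
  then show "inner_prod H (\<lambda>x. a x + b x) u = inner_prod H a u + inner_prod H b u"
    using L2.ip_add_left[of a \<mu> b u] p(2) q(2) by (simp add: H_simps)
qed

sublocale H: hilbert_function_space H
proof (intro hilbert_function_space.intro semi_hilbert_space.intro H_semi_inner_space, unfold_locales)
  fix s :: "nat \<Rightarrow> complex \<Rightarrow> complex"
  assume s: "\<And>n. s n \<in> vectors H"
    and cau: "\<And>e. e > 0 \<Longrightarrow> \<exists>N. \<forall>m\<ge>N. \<forall>n\<ge>N. hnorm H (\<lambda>x. s m x - s n x) < e"
  have "\<exists>g p. polynomials_converge p g \<and> (\<lambda>n. L2_norm \<mu> (\<lambda>z. s n z - g z)) \<longlonglongrightarrow> 0"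
    by (rule P2_Cauchy_limit) (use s cau vectors_P2 in \<open>simp_all add: hnorm_H\<close>)
  then obtain g p where g: "polynomials_converge p g"
    and lim: "(\<lambda>n. L2_norm \<mu> (\<lambda>z. s n z - g z)) \<longlonglongrightarrow> 0" by (elim exE conjE)
  have "g \<in> vectors H" using g by (auto simp: H_simps)
  then show "\<exists>l\<in>vectors H. (\<lambda>n. hnorm H (\<lambda>x. s n x - l x)) \<longlonglongrightarrow> 0"
    using lim by (intro bexI[of _ g]) (simp_all add: hnorm_H)
next
  fix a assume a: "a \<in> vectors H" and "hnorm H a = 0"
  then have n: "L2_norm \<mu> a = 0" by (simp add: hnorm_H)
  show "a = (\<lambda>_. 0)"
  proof
    fix z show "a z = 0"
    proof (cases "z \<in> D")
      case True
      then obtain M where "\<forall>h\<in>vectors H. cmod (h z) \<le> M * L2_norm \<mu> h"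
        using evaluation_bound by blast
      from bspec[OF this a] show ?thesis using n by simp
    qed (rule vectors_zero[OF a])
  qed
qed

lemma vectors_limit:
  assumes s: "\<And>n. s n \<in> vectors H" and g0: "\<And>z. z \<notin> D \<Longrightarrow> g z = 0" and gL: "g \<in> L2 \<mu>"
    and lim: "(\<lambda>n. L2_norm \<mu> (\<lambda>z. s n z - g z)) \<longlonglongrightarrow> 0"
    and pw: "\<And>z. z \<in> D \<Longrightarrow> (\<lambda>n. s n z) \<longlonglongrightarrow> g z"
  shows "g \<in> vectors H"
proof -
  have sL: "s n \<in> L2 \<mu>" for n by (rule vectors_L2[OF s])
  obtain p where p: "(\<lambda>n. L2_norm \<mu> (\<lambda>z. s n z - poly (p n) z)) \<longlonglongrightarrow> 0"
    using polynomials_close_to[of s, OF vectors_P2[OF s]] by (elim exE)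
  have "polynomials_converge p g"
    unfolding polynomials_converge_def
  proof (intro conjI allI impI ballI g0 gL)
    have lim': "(\<lambda>n. L2_norm \<mu> (\<lambda>z. g z - s n z)) \<longlonglongrightarrow> 0"
      using lim unfolding L2_norm_commute[OF sL gL] .
    show "(\<lambda>n. L2_norm \<mu> (\<lambda>z. g z - poly (p n) z)) \<longlonglongrightarrow> 0"
      by (rule tendsto_sandwich[OF always_eventually always_eventually tendsto_const tendsto_add_zero[OF lim' p]])
        (auto simp: L2_norm_nonneg intro!: L2_norm_triangle sL gL poly_L2)
    fix z assume z: "z \<in> D"
    obtain M where M: "M > 0" "\<forall>h\<in>vectors H. cmod (h z) \<le> M * L2_norm \<mu> h"
      using evaluation_bound[OF z] by blast
    have "cmod (s n z - poly (p n) z) \<le> M * L2_norm \<mu> (\<lambda>z. s n z - poly (p n) z)" for n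
    proof -
      let ?d = "\<lambda>z. s n z - (if z \<in> D then poly (p n) z else 0)"
      have "cmod (?d z) \<le> M * L2_norm \<mu> ?d"
        by (rule bspec[OF M(2) H.diff_mem[OF s poly_vector]])
      moreover have "L2_norm \<mu> ?d = L2_norm \<mu> (\<lambda>z. s n z - poly (p n) z)"
        by (rule L2_norm_cong) simp
      ultimately show ?thesis using z by simp
    qed
    then have "(\<lambda>n. s n z - poly (p n) z) \<longlonglongrightarrow> 0"
      by (intro Lim_null_comparison[OF always_eventually tendsto_mult_right_zero[OF p, of M]]) simp
    from tendsto_diff[OF pw[OF z] this] show "(\<lambda>n. poly (p n) z) \<longlonglongrightarrow> g z" by simp
  qed
  then show ?thesis by (auto simp: H_simps)
qed

text \<open>The evaluation at \<open>z\<close> is a bounded functional on the complete space \<open>H\<close>, so the theorem of Riesz applies.\<close>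

lemma kernel_exists:
  assumes z: "z \<in> D"
  shows "\<exists>k. k \<in> P2 \<mu> \<and> (\<forall>p :: complex poly. poly p z = L2_inner \<mu> (poly p) k)"
proof -
  obtain M where M: "\<forall>h\<in>vectors H. cmod (h z) \<le> M * L2_norm \<mu> h"
    using evaluation_bound[OF z] by blast
  have "\<exists>k\<in>vectors H. \<forall>a\<in>vectors H. a z = inner_prod H a k"
    by (rule H.Riesz_representation[of _ M]) (use M in \<open>auto simp: hnorm_H\<close>)
  then obtain k where k: "k \<in> vectors H" "\<forall>a\<in>vectors H. a z = L2_inner \<mu> a k"
    by (auto simp: H_simps(2))
  have "poly p z = L2_inner \<mu> (poly p) k" for p
  proof -
    have "poly p z = L2_inner \<mu> (\<lambda>z. if z \<in> D then poly p z else 0) k"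
      using bspec[OF k(2) poly_vector[of p]] z by simp
    also have "\<dots> = L2_inner \<mu> (poly p) k"
      unfolding L2_inner_def by (rule Bochner_Integration.integral_cong) (auto simp: space_eq)
    finally show ?thesis .
  qed
  then show ?thesis using vectors_P2[OF k(1)] by blast
qed

lemma P2_eval_limit:
  assumes z: "z \<in> D" and f: "f \<in> P2 \<mu>"
    and p: "(\<lambda>n. L2_norm \<mu> (\<lambda>z. f z - poly (p n) z)) \<longlonglongrightarrow> 0"
  shows "(\<lambda>n. poly (p n) z) \<longlonglongrightarrow> P2_eval \<mu> f z"
proof -
  let ?k = "P2_kernel \<mu> z"
  have kernel: "?k \<in> P2 \<mu> \<and> (\<forall>p :: complex poly. poly p z = L2_inner \<mu> (poly p) ?k)"
    unfolding P2_kernel_def by (rule someI_ex[OF kernel_exists[OF z]])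
  have L: "f \<in> L2 \<mu>" "?k \<in> L2 \<mu>" using f kernel by (auto simp: P2_def)
  have "(\<lambda>n. L2_inner \<mu> (poly (p n)) ?k) \<longlonglongrightarrow> L2_inner \<mu> f ?k"
    using L2.tendsto_ip_left[of "\<lambda>n. poly (p n)" \<mu> f ?k] poly_L2 L p
    unfolding L2_norm_commute[OF L(1) poly_L2] by (simp add: hnorm_L2_space)
  then show ?thesis by (simp add: P2_eval_def spec[OF conjunct2[OF kernel]])
qed

lemma P2_eval_vectors:
  assumes g: "g \<in> vectors H" and z: "z \<in> D"
  shows "P2_eval \<mu> g z = g z"
proof -
  obtain p where p: "polynomials_converge p g" using g by (auto simp: H_simps)
  show ?thesis
    by (rule LIMSEQ_unique[OF P2_eval_limit[OF z vectors_P2[OF g] polynomials_convergeD(3)[OF p]]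
          polynomials_convergeD(4)[OF p z]])
qed

text \<open>An element of $P^2(\mu)$ agrees almost everywhere with the pointwise limit of its approximating
polynomials, and \<open>P2_eval\<close> computes this limit.\<close>

lemma P2_space_eq: "P2_space \<mu> = H"
proof -
  let ?e = "\<lambda>f z. if z \<in> D then P2_eval \<mu> f z else 0"
  have "?e f \<in> vectors H" if f: "f \<in> P2 \<mu>" for f
  proof -
    have "\<exists>g p. polynomials_converge p g \<and> (\<lambda>n::nat. L2_norm \<mu> (\<lambda>z. f z - g z)) \<longlonglongrightarrow> 0"
      by (rule P2_Cauchy_limit[of "\<lambda>_. f"]) (use f in \<open>auto simp: L2_norm_def\<close>)
    then obtain g p where g: "polynomials_converge p g"
      and eq: "(\<lambda>n::nat. L2_norm \<mu> (\<lambda>z. f z - g z)) \<longlonglongrightarrow> 0" by (elim exE conjE)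
    note g' = polynomials_convergeD[OF g]
    have fL: "f \<in> L2 \<mu>" using f by (simp add: P2_def)
    have "(\<lambda>n. L2_norm \<mu> (\<lambda>z. f z - poly (p n) z)) \<longlonglongrightarrow> 0"
      by (rule tendsto_sandwich[OF always_eventually always_eventually tendsto_const tendsto_add_zero[OF eq g'(3)]])
        (auto simp: L2_norm_nonneg intro!: L2_norm_triangle fL g'(2) poly_L2)
    from P2_eval_limit[OF _ f this] have "P2_eval \<mu> f z = g z" if "z \<in> D" for z
      using LIMSEQ_unique g'(4) that by blast
    then have "?e f = g" using g'(1) by auto
    then show ?thesis using g by (auto simp: H_simps)
  qed
  moreover have "g \<in> ?e ` P2 \<mu>" if g: "g \<in> vectors H" for g
    using P2_eval_vectors[OF g] vectors_zero[OF g] vectors_P2[OF g] by (intro image_eqI[of _ _ g]) auto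
  ultimately have "?e ` P2 \<mu> = vectors H" by auto
  then show ?thesis by (simp add: P2_space_def H_def)
qed

lemma vectors_holomorphic:
  assumes h: "h \<in> vectors H"
  shows "h holomorphic_on D"
proof -
  have "P2_eval \<mu> h analytic_on {z}" if "z \<in> D" for z
    using subsetD[OF point_evaluations that] vectors_P2[OF h]
    by (simp add: analytic_bounded_point_evaluations_def)
  then have "P2_eval \<mu> h analytic_on D" using analytic_on_analytic_at by blast
  then have "P2_eval \<mu> h holomorphic_on D" by (rule analytic_imp_holomorphic)
  then show ?thesis by (rule holomorphic_transform) (rule P2_eval_vectors[OF h])
qed

end

section \<open>Dual subalgebras of the multiplier algebra\<close>

text \<open>Sequential convergence against all trace class operators implies weak-* convergence, since the
topology is generated by the corresponding preimages of open sets.\<close>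

lemma weak_star_open_eventually:
  assumes U: "openin (weak_star_topology H) U" and T: "T \<in> U"
    and S: "\<And>n::nat. S n \<in> bounded_operators H"
    and conv: "\<And>x y. \<lbrakk>range x \<subseteq> vectors H; range y \<subseteq> vectors H;
        summable (\<lambda>n::nat. (hnorm H (x n))\<^sup>2); summable (\<lambda>n. (hnorm H (y n))\<^sup>2)\<rbrakk> \<Longrightarrow>
      (\<lambda>n. \<Sum>k. inner_prod H (S n (x k)) (y k)) \<longlonglongrightarrow> (\<Sum>k. inner_prod H (T (x k)) (y k))"
  shows "\<forall>\<^sub>F n in sequentially. S n \<in> U"
proof -
  have "generate_topology_on {{T \<in> bounded_operators H. (\<Sum>n. inner_prod H (T (x n)) (y n)) \<in> U} | x y U.
        range x \<subseteq> vectors H \<and> range y \<subseteq> vectors H \<and>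
        summable (\<lambda>n::nat. (hnorm H (x n))\<^sup>2) \<and> summable (\<lambda>n. (hnorm H (y n))\<^sup>2) \<and> open U} U"
    using U unfolding weak_star_topology_def by (rule openin_topology_generated_by)
  then show ?thesis
    using T
  proof induction
    case (Int a b)
    then show ?case by (auto intro: eventually_conj)
  next
    case (UN K)
    then obtain k where k: "k \<in> K" "T \<in> k" by auto
    then have "\<forall>\<^sub>F n in sequentially. S n \<in> k" using UN by auto
    then show ?case by (rule eventually_mono) (use k in auto)
  next
    case (Basis s)
    then obtain x y W where s: "s = {T \<in> bounded_operators H. (\<Sum>n. inner_prod H (T (x n)) (y n)) \<in> W}"
      and xy: "range x \<subseteq> vectors H" "range y \<subseteq> vectors H"
        "summable (\<lambda>n::nat. (hnorm H (x n))\<^sup>2)" "summable (\<lambda>n. (hnorm H (y n))\<^sup>2)" and W: "open W"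
      by auto
    have "(\<Sum>k. inner_prod H (T (x k)) (y k)) \<in> W" using Basis.prems s by auto
    from topological_tendstoD[OF conv[OF xy] W this] show ?case
      by (rule eventually_mono) (use S s in auto)
  qed auto
qed

lemma topspace_weak_star_subset: "topspace (weak_star_topology H) \<subseteq> bounded_operators H"
  unfolding weak_star_topology_def topology_generated_by_topspace by auto

lemma bounded_operators_subset_topspace:
  assumes "semi_inner_space H"
  shows "bounded_operators H \<subseteq> topspace (weak_star_topology H)"
proof -
  interpret semi_inner_space H by (rule assms)
  have "bounded_operators H \<in> {{T \<in> bounded_operators H. (\<Sum>n. inner_prod H (T (x n)) (y n)) \<in> U} | x y U.
        range x \<subseteq> vectors H \<and> range y \<subseteq> vectors H \<and>
        summable (\<lambda>n::nat. (hnorm H (x n))\<^sup>2) \<and> summable (\<lambda>n. (hnorm H (y n))\<^sup>2) \<and> open U}"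
    using zero_mem
    by (intro CollectI exI[of _ "\<lambda>_ _. 0"] exI[of _ UNIV]) (auto simp: hnorm_zero)
  then show ?thesis
    unfolding weak_star_topology_def topology_generated_by_topspace by (rule Union_upper)
qed

context disk_measure
begin

lemma bounded_limit_multiplies:
  assumes f: "\<And>n. f n \<in> multipliers H" and le: "\<And>n z. z \<in> D \<Longrightarrow> cmod (f n z) \<le> 1"
    and lim: "\<And>z. z \<in> D \<Longrightarrow> (\<lambda>n. f n z) \<longlonglongrightarrow> g z" and g0: "\<And>z. z \<notin> D \<Longrightarrow> g z = 0"
    and h: "h \<in> vectors H"
  shows "(\<lambda>z. g z * h z) \<in> vectors H"
    and "(\<lambda>n. hnorm H (\<lambda>z. f n z * h z - g z * h z)) \<longlonglongrightarrow> 0"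
    and "hnorm H (\<lambda>z. g z * h z) \<le> hnorm H h"
proof -
  have hL: "h \<in> L2 \<mu>" by (rule vectors_L2[OF h])
  have fh: "(\<lambda>z. f n z * h z) \<in> vectors H" for n
    using f[of n] h by (simp add: multipliers_def)
  have gle: "cmod (g z) \<le> 1" if z: "z \<in> D" for z
    by (rule LIMSEQ_le_const2[OF tendsto_norm[OF lim[OF z]]]) (use le[OF z] in auto)
  have pw: "(\<lambda>n. f n z * h z) \<longlonglongrightarrow> g z * h z" if "z \<in> D" for z
    by (intro tendsto_intros lim that)
  have meas: "(\<lambda>z. g z * h z) \<in> borel_measurable \<mu>"
    by (rule borel_measurable_LIMSEQ_metric[OF L2_D(1)[OF vectors_L2[OF fh]]])
      (use pw in \<open>simp add: space_eq\<close>)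
  have gh_le: "cmod (g z * h z) \<le> 1 * cmod (h z)" if "z \<in> space \<mu>" for z
    unfolding norm_mult using gle[of z] that by (intro mult_right_mono) (auto simp: space_eq)
  have ghL: "(\<lambda>z. g z * h z) \<in> L2 \<mu>" by (rule L2_dominated[OF meas hL zero_le_one gh_le])
  have conv: "(\<lambda>n. L2_norm \<mu> (\<lambda>z. f n z * h z - g z * h z)) \<longlonglongrightarrow> 0"
  proof (rule L2_dominated_convergence[OF hL, of _ 2])
    show "(\<lambda>z. f n z * h z - g z * h z) \<in> borel_measurable \<mu>" for n
      using L2_D(1)[OF vectors_L2[OF fh]] meas by (intro borel_measurable_diff)
    show "cmod (f n z * h z - g z * h z) \<le> 2 * cmod (h z)" if "z \<in> space \<mu>" for n z
    proof -
      have "cmod (f n z * h z) \<le> 1 * cmod (h z)"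
        unfolding norm_mult using le[of z n] that by (intro mult_right_mono) (auto simp: space_eq)
      then show ?thesis
        using norm_triangle_ineq4[of "f n z * h z" "g z * h z"] gh_le[OF that] by linarith
    qed
    show "(\<lambda>n. f n z * h z - g z * h z) \<longlonglongrightarrow> 0" if "z \<in> space \<mu>" for z
      using pw[of z] that LIM_zero by (auto simp: space_eq)
  qed simp
  show "(\<lambda>z. g z * h z) \<in> vectors H"
    by (rule vectors_limit[OF fh _ ghL conv pw]) (simp add: g0)
  show "(\<lambda>n. hnorm H (\<lambda>z. f n z * h z - g z * h z)) \<longlonglongrightarrow> 0" unfolding hnorm_H by (rule conv)
  show "hnorm H (\<lambda>z. g z * h z) \<le> hnorm H h"
    using L2_norm_mono[OF hL meas zero_le_one gh_le] by (simp add: hnorm_H)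
qed

text \<open>For every $h$ the functions $f_n h$ converge to $g h$ in norm, by dominated convergence, and the
operators are contractions. By Tannery's theorem the pairings with all trace class operators
converge, so $M_g$ is a weak-* limit of elements of a weak-* closed set. An operator of multiplication
determines its symbol, by its value at the constant function \<open>1\<close>.\<close>

lemma dual_subalgebra_bounded_limits:
  assumes A: "dual_subalgebra H A" and f: "\<And>n. f n \<in> A"
    and le: "\<And>n z. z \<in> D \<Longrightarrow> cmod (f n z) \<le> 1"
    and lim: "\<And>z. z \<in> D \<Longrightarrow> (\<lambda>n. f n z) \<longlonglongrightarrow> g z" and g: "g \<in> functions_on D"
  shows "g \<in> A"
proof -
  have AM: "A \<subseteq> multipliers H" and cl: "closedin (weak_star_topology H) (mult_op H ` A)"
    using A by (auto simp: dual_subalgebra_def)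
  have fM: "f n \<in> multipliers H" for n using f AM by auto
  have g0: "g z = 0" if "z \<notin> D" for z using g that by (simp add: functions_on_def)
  have gV: "(\<lambda>z. g z * h z) \<in> vectors H" and glim: "(\<lambda>n. hnorm H (\<lambda>z. f n z * h z - g z * h z)) \<longlonglongrightarrow> 0"
    and gle: "hnorm H (\<lambda>z. g z * h z) \<le> hnorm H h" if "h \<in> vectors H" for h
    using bounded_limit_multiplies[of f g h] fM le lim g0 that by auto
  have fV: "(\<lambda>z. f n z * h z) \<in> vectors H" if "h \<in> vectors H" for n h
    using fM[of n] that by (simp add: multipliers_def)
  have fle: "hnorm H (\<lambda>z. f n z * h z) \<le> hnorm H h" if h: "h \<in> vectors H" for n h
    using L2_norm_mono[OF vectors_L2[OF h] L2_D(1)[OF vectors_L2[OF fV[OF h]]] zero_le_one, of n] le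
    by (simp add: hnorm_H norm_mult space_eq mult_left_le_one_le)
  have op_mem: "mult_op H F \<in> bounded_operators H"
    if FV: "\<And>h. h \<in> vectors H \<Longrightarrow> (\<lambda>z. F z * h z) \<in> vectors H"
      and Fle: "\<And>h. h \<in> vectors H \<Longrightarrow> hnorm H (\<lambda>z. F z * h z) \<le> hnorm H h" for F
    unfolding bounded_operators_def mult_op_def
    using FV Fle H.add_mem H.scale_mem
    by (auto simp: algebra_simps intro!: exI[of _ 1])
  have gB: "mult_op H g \<in> bounded_operators H" by (rule op_mem[OF gV gle])
  have fB: "mult_op H (f n) \<in> bounded_operators H" for n by (rule op_mem[OF fV fle])
  have conv: "(\<lambda>n. \<Sum>k. inner_prod H (mult_op H (f n) (x k)) (y k)) \<longlonglongrightarrow>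
      (\<Sum>k. inner_prod H (mult_op H g (x k)) (y k))"
    if x: "range x \<subseteq> vectors H" and y: "range y \<subseteq> vectors H"
      and sx: "summable (\<lambda>n::nat. (hnorm H (x n))\<^sup>2)" and sy: "summable (\<lambda>n. (hnorm H (y n))\<^sup>2)" for x y
  proof -
    have V: "x k \<in> vectors H" "y k \<in> vectors H" for k using x y by auto
    show ?thesis
    proof (rule conjunct2[OF conjunct2[OF tannerys_theorem]])
      show "(\<lambda>n. inner_prod H (mult_op H (f n) (x k)) (y k)) \<longlonglongrightarrow> inner_prod H (mult_op H g (x k)) (y k)" for k
        unfolding mult_op_def restrict_apply'[OF V(1)]
        by (rule H.tendsto_ip_left) (intro fV gV glim V)+
      show "summable (\<lambda>k. (hnorm H (x k))\<^sup>2 + (hnorm H (y k))\<^sup>2)" by (intro summable_add sx sy)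
      have "norm (inner_prod H (mult_op H (f n) (x k)) (y k)) \<le> (hnorm H (x k))\<^sup>2 + (hnorm H (y k))\<^sup>2" for n k
      proof -
        have "norm (inner_prod H (mult_op H (f n) (x k)) (y k)) \<le> hnorm H (\<lambda>z. f n z * x k z) * hnorm H (y k)"
          unfolding mult_op_def restrict_apply'[OF V(1)] by (rule H.Cauchy_Schwarz[OF fV[OF V(1)] V(2)])
        also have "\<dots> \<le> hnorm H (x k) * hnorm H (y k)"
          by (rule mult_right_mono[OF fle[OF V(1)] H.hnorm_nonneg[OF V(2)]])
        also have "\<dots> \<le> (hnorm H (x k))\<^sup>2 + (hnorm H (y k))\<^sup>2"
          using sum_squares_bound[of "hnorm H (x k)" "hnorm H (y k)"]
            zero_le_power2[of "hnorm H (x k)"] zero_le_power2[of "hnorm H (y k)"] by linarith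
        finally show ?thesis .
      qed
      then show "\<forall>\<^sub>F (k, n) in at_top \<times>\<^sub>F sequentially.
          norm (inner_prod H (mult_op H (f n) (x k)) (y k)) \<le> (hnorm H (x k))\<^sup>2 + (hnorm H (y k))\<^sup>2"
        by (intro always_eventually) auto
    qed simp
  qed
  have "mult_op H g \<in> mult_op H ` A"
  proof (rule ccontr)
    assume no: "mult_op H g \<notin> mult_op H ` A"
    let ?U = "topspace (weak_star_topology H) - mult_op H ` A"
    have U: "openin (weak_star_topology H) ?U" using cl by (simp add: closedin_def)
    have gU: "mult_op H g \<in> ?U"
      using no gB bounded_operators_subset_topspace[OF H_semi_inner_space] by auto
    have "\<forall>\<^sub>F n in sequentially. mult_op H (f n) \<in> ?U"
      by (rule weak_star_open_eventually[OF U gU fB conv])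
    then have "\<forall>\<^sub>F n::nat in sequentially. False"
      by (rule eventually_mono) (use f in auto)
    then show False by simp
  qed
  then obtain a where a: "a \<in> A" "mult_op H g = mult_op H a" by auto
  let ?one = "\<lambda>z. if z \<in> D then 1 else (0::complex)"
  have one: "?one \<in> vectors H" using poly_vector[of 1] by (simp cong: if_cong)
  have "(\<lambda>z. g z * ?one z) = (\<lambda>z. a z * ?one z)"
    using fun_cong[OF a(2), of ?one] one by (simp add: mult_op_def)
  moreover have "a z = 0" if "z \<notin> D" for z
    using a(1) AM that by (auto simp: multipliers_def functions_on_def H_simps)
  ultimately have "g z = a z" for z
    using g0[of z] by (cases "z \<in> D") (auto dest: fun_cong[of _ _ z])
  then have "g = a" by auto
  then show ?thesis using a(1) by simp
qed

lemma dual_subalgebra_analytic_multiplier_algebra: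
  assumes A: "dual_subalgebra H A"
  shows "analytic_multiplier_algebra H A \<mu>"
proof unfold_locales
  have AM: "A \<subseteq> multipliers H" and cl: "closedin (weak_star_topology H) (mult_op H ` A)"
    using A by (auto simp: dual_subalgebra_def)
  show "vectors H \<subseteq> functions_on (points H)"
    using vectors_zero by (auto simp: functions_on_def H_simps(1))
  show "(\<lambda>x. if x \<in> points H then 1 else 0) \<in> A"
    "\<And>f g. \<lbrakk>f \<in> A; g \<in> A\<rbrakk> \<Longrightarrow> (\<lambda>x. f x + g x) \<in> A"
    "\<And>f c. f \<in> A \<Longrightarrow> (\<lambda>x. c * f x) \<in> A"
    "\<And>f g. \<lbrakk>f \<in> A; g \<in> A\<rbrakk> \<Longrightarrow> (\<lambda>x. f x * g x) \<in> A"
    using A by (auto simp: dual_subalgebra_def)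
  show "mult_op H f \<in> bounded_operators H" if "f \<in> A" for f
    using closedin_subset[OF cl] topspace_weak_star_subset[of H] that by blast
  show "open (points H)" "points H \<noteq> {}" "space \<mu> = points H" "inner_prod H = L2_inner \<mu>"
    by (simp_all add: H_simps space_eq)
  show "vectors H \<subseteq> L2 \<mu>" using vectors_L2 by auto
  show "h holomorphic_on points H" if "h \<in> vectors H" for h
    unfolding H_simps by (rule vectors_holomorphic[OF that])
  show "\<exists>C. \<forall>h\<in>vectors H. cmod (h z) \<le> C * hnorm H h" if "z \<in> points H" for z
    using evaluation_bound[of z] that unfolding hnorm_H H_simps(1) by blast
  show "(\<lambda>z. if z \<in> points H then (z - w) ^ n else 0) \<in> vectors H" for w n
    using poly_vector[of "[:- w, 1:] ^ n"] by (simp add: H_simps(1) poly_power algebra_simps cong: if_cong)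
  show "A \<subseteq> functions_on (points H)" using AM by (auto simp: multipliers_def)
  show "g \<in> A" if "\<And>n::nat. f n \<in> A" "\<And>n z. z \<in> points H \<Longrightarrow> cmod (f n z) \<le> 1"
    "\<And>z. z \<in> points H \<Longrightarrow> (\<lambda>n. f n z) \<longlonglongrightarrow> g z" "g \<in> functions_on (points H)" for f g
    by (rule dual_subalgebra_bounded_limits[OF A, of f]) (use that in \<open>auto simp: H_simps(1)\<close>)
qed

end

theorem theorem4p5:
  fixes \<mu> :: "complex measure" and A :: "(complex \<Rightarrow> complex) set"
  assumes "finite_measure \<mu>"
    and "sets \<mu> = sets (restrict_space borel (ball 0 1))"
    and "ball 0 1 \<subseteq> analytic_bounded_point_evaluations \<mu>"
    and "dual_subalgebra (P2_space \<mu>) A"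
  shows "(\<exists>k. cyclic_kernels (P2_space \<mu>) A k) \<and>
         (\<forall>k. cyclic_kernels (P2_space \<mu>) A k \<longrightarrow> nevanlinna_pick_family (P2_space \<mu>) A k)"
proof -
  interpret disk_measure \<mu> by (rule disk_measure.intro[OF assms(1-3)])
  interpret analytic_multiplier_algebra "P2_space \<mu>" A \<mu>
    using dual_subalgebra_analytic_multiplier_algebra[folded P2_space_eq, OF assms(4)] .
  show ?thesis using cyclic_kernels_exist cyclic_kernels_nevanlinna_pick by blast
qed

end
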